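(* For every $n\ge 1$ and every partition $\lambda=(\lambda_1\ge\lambda_2\ge\cdots\ge\lambda_n\ge 0)$ with at most $n$ nonzero parts, there exist two bijections $\psi_{\mathrm{inv}}=\psi_{\mathrm{inv}}^{(n,\lambda)}$ and $\psi_{\mathrm{quinv}}=\psi_{\mathrm{quinv}}^{(n,\lambda)}$ from $\mathrm{CSF}_n(\lambda)$ to $\mathrm{POP}_n(\lambda)$ (two families of bijections, indexed by all such pairs $(n,\lambda)$) with the following properties. 1. For $v\in\{\mathrm{inv},\mathrm{quinv}\}$ and $F\in\mathrm{CSF}_n(\lambda)$, if $\psi_v(F)=(T,\Lambda)$ then $x^F=x^T$ and $v(F)=|\Lambda|$. 2. For $v\in\{\mathrm{inv},\mathrm{quinv}\}$: (A) $\mathrm{pr}\circ\psi_v=\mathrm{rsort}$ as maps $\mathrm{CSF}_n(\lambda)\to\mathrm{GT}_n(\lambda)$. (B) $\mathrm{br}\circ\psi_v=\psi_v\circ\mathrm{dsplice}$ as maps $\mathrm{CSF}_n(\lambda)\to\bigsqcup_{\mu\prec\lambda}\mathrm{POP}_{n-1}(\mu)$, where on the right-hand side $\psi_v:\bigsqcup_{\mu\prec\lambda}\mathrm{CSF}_{n-1}(\mu)\to\bigsqcup_{\mu\prec\lambda}\mathrm{POP}_{n-1}(\mu)$ is given by $\psi_v^{(n-1,\mu)}$ on the component indexed by $\mu$. 3. $\psi_{\mathrm{quinv}}=\mathrm{boxcomp}\circ\psi_{\mathrm{inv}}$.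
   Context: Diagrams and fillings. $[n]=\{1,\dots,n\}$. The Young diagram of a partition $\lambda$ is $\mathrm{dg}(\lambda)=\{(r,c):1\le c\le\lambda_r\}$, with $r$ the row index from the top and $c$ the column index from the left. $\mathrm{CSF}_n(\lambda)$ is the set of column strict fillings: maps $F:\mathrm{dg}(\lambda)\to[n]$ strictly increasing down each column. $x^F=\prod_{c\in\mathrm{dg}(\lambda)}x_{F(c)}$. Statistics. For a cell $u=(i,j)$ with $i>1$ let $u^\uparrow=(i-1,j)$; $\mathrm{Des}(F)$ is the set of cells $u$ not in the first row with $F(u)>F(u^\uparrow)$; $\mathrm{arm}(u)$ is the number of cells of $\mathrm{dg}(\lambda)$ strictly to the right of $u$ in its row. A cell $u$ Inv-attacks $v$ if they are in the same row with $u$ strictly left of $v$, or $u$ is in the row immediately below that of $v$, in a column strictly to the right of that of $v$. A cell $u$ Quinv-attacks $v$ if they are in the same row with $u$ strictly right of $v$, or $u$ is in the row immediately below that of $v$, in a column strictly to the left of that of $v$. $\mathrm{Inv}(F)$ (resp. $\mathrm{Quinv}(F)$) is the set of pairs $(u,v)$ such that $u$ Inv-attacks (resp. Quinv-attacks) $v$ and $F(u)>F(v)$. Then $\mathrm{inv}(F)=|\mathrm{Inv}(F)|-\sum_{u\in\mathrm{Des}(F)}\mathrm{arm}(u)$ and $\mathrm{quinv}(F)=|\mathrm{Quinv}(F)|-\sum_{u\in\mathrm{Des}(F)}\mathrm{arm}(u^\uparrow)$. Gelfand-Tsetlin patterns. $\mathrm{GT}_n(\lambda)$ is the set of integer arrays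 $T=(T^j_i:1\le i\le j\le n)$ with $T^n_i=\lambda_i$ and, for $1\le i\le j<n$, $\mathrm{NE}_{ij}(T):=T^{j+1}_i-T^j_i\ge 0$ and $\mathrm{SE}_{ij}(T):=T^j_i-T^{j+1}_{i+1}\ge 0$. It is identified with the set of semistandard Young tableaux of shape $\lambda$ with entries in $[n]$ by letting $T^j_i$ be the number of cells of the $i$th row containing entries $\le j$; $x^T$ is the monomial weight of the tableau. Partition overlaid patterns. $\mathrm{POP}_n(\lambda)$ is the set of pairs $(T,\Lambda)$ with $T\in\mathrm{GT}_n(\lambda)$ and $\Lambda=(\Lambda_{ij}:1\le i\le j<n)$ a tuple of partitions such that $\Lambda_{ij}$ fits in an $\mathrm{NE}_{ij}(T)\times\mathrm{SE}_{ij}(T)$ rectangle, i.e. has at most $\mathrm{NE}_{ij}(T)$ nonzero parts, each $\le\mathrm{SE}_{ij}(T)$. $|\Lambda|=\sum_{i,j}|\Lambda_{ij}|$. Projection: $\mathrm{pr}(T,\Lambda)=T$. For $\mu=(\mu_1,\dots,\mu_{n-1})$, write $\mu\prec\lambda$ if $\lambda_i\ge\mu_i\ge\lambda_{i+1}$ for $1\le i<n$. Branching: $\mathrm{br}:\mathrm{POP}_n(\lambda)\to\bigsqcup_{\mu\prec\lambda}\mathrm{POP}_{n-1}(\mu)$, $\mathrm{br}(T,\Lambda)=(T^\dagger,\Lambda^\dagger)$, where $T^\dagger$ is $T$ with the row $(T^n_i)_i$ deleted and $\Lambda^\dagger$ is $\Lambda$ with all $\Lambda_{i,n-1}$ deleted.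 Box complementation: $\mathrm{boxcomp}(T,\Lambda)=(T,\Lambda^c)$, where $(\Lambda^c)_{ij}$ is the complement of $\Lambda_{ij}$ in its $k\times\ell=\mathrm{NE}_{ij}(T)\times\mathrm{SE}_{ij}(T)$ rectangle; the complement of $(\pi_1\ge\dots\ge\pi_k\ge0)$ is $(\ell-\pi_k\ge\dots\ge\ell-\pi_1)$. For $n=1$ the only $\mu\prec\lambda$ is the empty tuple, and $\mathrm{CSF}_0$ and $\mathrm{POP}_0$ of it are one-element sets. Rowsort. $\mathrm{rsort}(F)$ is obtained from $F$ by sorting the entries of each row in ascending order from left to right; it is a semistandard Young tableau, regarded as an element of $\mathrm{GT}_n(\lambda)$. Splice. A column tuple is a (possibly empty) strictly increasing sequence $a=(a_1<\dots<a_p)$ of positive integers, $\mathrm{len}(a)=p$, with convention $a_0=0$. For column tuples $\sigma,\tau$ of lengths $k<\ell$ let $m=\max\{1\le i\le k+1:\sigma_{i-1}<\tau_i\}$ and $\mathrm{splice}(\sigma,\tau)=(\overline\sigma,\overline\tau)$, where $\overline\sigma_i=\sigma_i$ for $1\le i<m$, $\overline\sigma_i=\tau_i$ for $m\le i\le\ell$, $\overline\tau_i=\tau_i$ for $1\le i<m$, $\overline\tau_i=\sigma_i$ for $m\le i\le k$. Delete-and-splice. $\mathrm{dsplice}:\mathrm{CSF}_n(\lambda)\to\bigsqcup_{\mu\prec\lambda}\mathrm{CSF}_{n-1}(\mu)$ is defined as follows: delete all cells of $F$ containing $n$. While the resulting filling is not of partition shape, choose any $j$ such that its $(j+1)$th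 column is longer than its $j$th column, and replace this pair of columns (read top to bottom as column tuples $\sigma^{(j)},\sigma^{(j+1)}$) by $\mathrm{splice}(\sigma^{(j)},\sigma^{(j+1)})$. The process terminates and the final filling, $\mathrm{dsplice}(F)$, does not depend on the choices of $j$. *)

theory Defs
  imports Main "HOL-Library.FuncSet" "HOL-Library.Poly_Mapping"
begin

section \<open>Diagrams and column strict fillings\<close>

text \<open>
  A shape is an \<open>n\<close>-tuple \<open>l\<close> of naturals, trailing zeros included, so that \<open>l ! (r - 1)\<close> is the
  \<open>r\<close>th part.  Cells \<open>(r, c)\<close> and all other indices are 1-based.  Objects indexed by a finite set
  are extensional functions, hence determined by their values on that set.
\<close>

definition is_partition :: "nat \<Rightarrow> nat list \<Rightarrow> bool" where
  "is_partition n l \<longleftrightarrow> length l = n \<and> sorted_wrt (\<ge>) l"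

type_synonym cell = "nat \<times> nat"
type_synonym filling = "cell \<Rightarrow> nat"

definition dg :: "nat list \<Rightarrow> cell set" where
  "dg l = {(r, c). 1 \<le> r \<and> r \<le> length l \<and> 1 \<le> c \<and> c \<le> l ! (r - 1)}"

definition CSF :: "nat \<Rightarrow> nat list \<Rightarrow> filling set" where
  "CSF n l = {F \<in> dg l \<rightarrow>\<^sub>E {1..n}.
     \<forall>r r' c. (r, c) \<in> dg l \<longrightarrow> (r', c) \<in> dg l \<longrightarrow> r < r' \<longrightarrow> F (r, c) < F (r', c)}"

text \<open>Monomials live in the polynomial ring over the integers in the variables \<open>x\<^sub>0, x\<^sub>1, \<dots>\<close>.\<close>

definition var :: "nat \<Rightarrow> (nat \<Rightarrow>\<^sub>0 nat) \<Rightarrow>\<^sub>0 int" where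
  "var i = Poly_Mapping.single (Poly_Mapping.single i 1) 1"

definition x_filling :: "nat list \<Rightarrow> filling \<Rightarrow> (nat \<Rightarrow>\<^sub>0 nat) \<Rightarrow>\<^sub>0 int" where
  "x_filling l F = (\<Prod>u\<in>dg l. var (F u))"

section \<open>The statistics inv and quinv\<close>

definition up :: "cell \<Rightarrow> cell" where
  "up u = (fst u - 1, snd u)"

definition Des :: "nat list \<Rightarrow> filling \<Rightarrow> cell set" where
  "Des l F = {u \<in> dg l. fst u > 1 \<and> F u > F (up u)}"

definition arm :: "nat list \<Rightarrow> cell \<Rightarrow> nat" where
  "arm l u = card {v \<in> dg l. fst v = fst u \<and> snd v > snd u}"

definition Inv_attacks :: "cell \<Rightarrow> cell \<Rightarrow> bool" where
  "Inv_attacks u v \<longleftrightarrow> (fst u = fst v \<and> snd u < snd v) \<or> (fst u = fst v + 1 \<and> snd u > snd v)"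

definition Quinv_attacks :: "cell \<Rightarrow> cell \<Rightarrow> bool" where
  "Quinv_attacks u v \<longleftrightarrow> (fst u = fst v \<and> snd u > snd v) \<or> (fst u = fst v + 1 \<and> snd u < snd v)"

definition Inv :: "nat list \<Rightarrow> filling \<Rightarrow> (cell \<times> cell) set" where
  "Inv l F = {(u, v). u \<in> dg l \<and> v \<in> dg l \<and> Inv_attacks u v \<and> F u > F v}"

definition Quinv :: "nat list \<Rightarrow> filling \<Rightarrow> (cell \<times> cell) set" where
  "Quinv l F = {(u, v). u \<in> dg l \<and> v \<in> dg l \<and> Quinv_attacks u v \<and> F u > F v}"

definition inv_stat :: "nat list \<Rightarrow> filling \<Rightarrow> int" where
  "inv_stat l F = int (card (Inv l F)) - (\<Sum>u\<in>Des l F. int (arm l u))"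

definition quinv_stat :: "nat list \<Rightarrow> filling \<Rightarrow> int" where
  "quinv_stat l F = int (card (Quinv l F)) - (\<Sum>u\<in>Des l F. int (arm l (up u)))"

section \<open>Gelfand-Tsetlin patterns and semistandard tableaux\<close>

text \<open>The entry \<open>T\<^sup>j\<^sub>i\<close> of a pattern is written \<open>T (i, j)\<close>.\<close>

type_synonym pattern = "nat \<times> nat \<Rightarrow> int"

definition tri :: "nat \<Rightarrow> (nat \<times> nat) set" where
  "tri n = {(i, j). 1 \<le> i \<and> i \<le> j \<and> j \<le> n}"

definition tri_less :: "nat \<Rightarrow> (nat \<times> nat) set" where
  "tri_less n = {(i, j). 1 \<le> i \<and> i \<le> j \<and> j < n}"

definition NE :: "pattern \<Rightarrow> nat \<Rightarrow> nat \<Rightarrow> int" where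
  "NE T i j = T (i, j + 1) - T (i, j)"

definition SE :: "pattern \<Rightarrow> nat \<Rightarrow> nat \<Rightarrow> int" where
  "SE T i j = T (i, j) - T (i + 1, j + 1)"

definition GT :: "nat \<Rightarrow> nat list \<Rightarrow> pattern set" where
  "GT n l = {T \<in> extensional (tri n).
     (\<forall>i\<in>{1..n}. T (i, n) = int (l ! (i - 1))) \<and>
     (\<forall>(i, j)\<in>tri_less n. NE T i j \<ge> 0 \<and> SE T i j \<ge> 0)}"

definition SSYT :: "nat \<Rightarrow> nat list \<Rightarrow> filling set" where
  "SSYT n l = {F \<in> CSF n l.
     \<forall>r c c'. (r, c) \<in> dg l \<longrightarrow> (r, c') \<in> dg l \<longrightarrow> c < c' \<longrightarrow> F (r, c) \<le> F (r, c')}"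

definition gt_of_tableau :: "nat \<Rightarrow> nat list \<Rightarrow> filling \<Rightarrow> pattern" where
  "gt_of_tableau n l F =
     restrict (\<lambda>(i, j). int (card {c. (i, c) \<in> dg l \<and> F (i, c) \<le> j})) (tri n)"

definition tableau_of_gt :: "nat \<Rightarrow> nat list \<Rightarrow> pattern \<Rightarrow> filling" where
  "tableau_of_gt n l = the_inv_into (SSYT n l) (gt_of_tableau n l)"

definition x_pattern :: "nat \<Rightarrow> nat list \<Rightarrow> pattern \<Rightarrow> (nat \<Rightarrow>\<^sub>0 nat) \<Rightarrow>\<^sub>0 int" where
  "x_pattern n l T = x_filling l (tableau_of_gt n l T)"

definition rsort :: "nat list \<Rightarrow> filling \<Rightarrow> filling" where
  "rsort l F =
     restrict (\<lambda>(r, c). sort (map (\<lambda>c'. F (r, c')) [1..<Suc (l ! (r - 1))]) ! (c - 1)) (dg l)"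

section \<open>Partition overlaid patterns\<close>

text \<open>The overlaid partitions are lists of nonzero parts, without trailing zeros.\<close>

type_synonym overlay = "nat \<times> nat \<Rightarrow> nat list"

definition box_partitions :: "int \<Rightarrow> int \<Rightarrow> nat list set" where
  "box_partitions k m = {p. sorted_wrt (\<ge>) p \<and> 0 \<notin> set p \<and>
     int (length p) \<le> k \<and> (\<forall>a\<in>set p. int a \<le> m)}"

definition POP :: "nat \<Rightarrow> nat list \<Rightarrow> (pattern \<times> overlay) set" where
  "POP n l = {(T, L). T \<in> GT n l \<and>
     L \<in> (\<Pi>\<^sub>E (i, j)\<in>tri_less n. box_partitions (NE T i j) (SE T i j))}"

definition overlay_size :: "nat \<Rightarrow> overlay \<Rightarrow> nat" where
  "overlay_size n L = (\<Sum>u\<in>tri_less n. sum_list (L u))"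

text \<open>
  An element of a disjoint union over \<open>\<mu>\<close> is a pair whose first component is the index \<open>\<mu>\<close>;
  for \<open>br\<close> this is the new bottom row of the pattern.
\<close>

definition interlaces :: "nat list \<Rightarrow> nat list \<Rightarrow> bool"  (infix "\<prec>" 50) where
  "\<mu> \<prec> l \<longleftrightarrow> length l = length \<mu> + 1 \<and> (\<forall>i<length \<mu>. l ! i \<ge> \<mu> ! i \<and> \<mu> ! i \<ge> l ! (i + 1))"

definition br :: "nat \<Rightarrow> pattern \<times> overlay \<Rightarrow> nat list \<times> pattern \<times> overlay" where
  "br n = (\<lambda>(T, L). (map (\<lambda>i. nat (T (i, n - 1))) [1..<n],
     restrict T (tri (n - 1)), restrict L (tri_less (n - 1))))"

definition partition_compl :: "nat \<Rightarrow> nat \<Rightarrow> nat list \<Rightarrow> nat list" where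
  "partition_compl k m p =
     filter (\<lambda>a. a > 0) (map (\<lambda>a. m - a) (rev (p @ replicate (k - length p) 0)))"

definition boxcomp :: "nat \<Rightarrow> pattern \<times> overlay \<Rightarrow> pattern \<times> overlay" where
  "boxcomp n = (\<lambda>(T, L). (T, restrict
     (\<lambda>(i, j). partition_compl (nat (NE T i j)) (nat (SE T i j)) (L (i, j))) (tri_less n)))"

section \<open>Splicing and delete-and-splice\<close>

text \<open>
  In \<open>splice_index\<close> the index \<open>i\<close> is 1-based and the value \<open>0\<close> stands for the entry
  preceding the first one of \<open>\<sigma>\<close>.
\<close>

definition splice_index :: "nat list \<Rightarrow> nat list \<Rightarrow> nat" where
  "splice_index \<sigma> \<tau> =
     Max {i \<in> {1..length \<sigma> + 1}. (if i = 1 then 0 else \<sigma> ! (i - 2)) < \<tau> ! (i - 1)}"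

definition col_splice :: "nat list \<Rightarrow> nat list \<Rightarrow> nat list \<times> nat list" where
  "col_splice \<sigma> \<tau> = (let m = splice_index \<sigma> \<tau> in
     (take (m - 1) \<sigma> @ drop (m - 1) \<tau>, take (m - 1) \<tau> @ drop (m - 1) \<sigma>))"

definition splice_step :: "nat list list \<Rightarrow> nat list list \<Rightarrow> bool" where
  "splice_step cs cs' \<longleftrightarrow> (\<exists>j. Suc j < length cs \<and> length (cs ! j) < length (cs ! Suc j) \<and>
     (case col_splice (cs ! j) (cs ! Suc j) of (\<sigma>, \<tau>) \<Rightarrow> cs' = cs[j := \<sigma>, Suc j := \<tau>]))"

definition partition_shaped :: "nat list list \<Rightarrow> bool" where
  "partition_shaped cs \<longleftrightarrow> sorted_wrt (\<ge>) (map length cs)"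

definition columns :: "nat list \<Rightarrow> filling \<Rightarrow> nat list list" where
  "columns l F = map (\<lambda>c. map (\<lambda>r. F (r, c)) [1..<Suc (card {r. (r, c) \<in> dg l})])
     [1..<Suc (card {c. (1, c) \<in> dg l})]"

definition shape_of_columns :: "nat \<Rightarrow> nat list list \<Rightarrow> nat list" where
  "shape_of_columns n cs =
     map (\<lambda>r. card {c. c < length cs \<and> r \<le> length (cs ! c)}) [1..<Suc n]"

definition filling_of_columns :: "nat \<Rightarrow> nat list list \<Rightarrow> filling" where
  "filling_of_columns n cs =
     restrict (\<lambda>(r, c). cs ! (c - 1) ! (r - 1)) (dg (shape_of_columns n cs))"

text \<open>
  The splicing process may make any admissible choices; \<open>dsplice\<close> is its unique outcome,
  paired with the resulting shape.
\<close>

definition dsplice_columns :: "nat \<Rightarrow> nat list list \<Rightarrow> nat list list" where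
  "dsplice_columns n cs =
     (THE cs'. splice_step\<^sup>*\<^sup>* (map (removeAll n) cs) cs' \<and> partition_shaped cs')"

definition dsplice :: "nat \<Rightarrow> nat list \<Rightarrow> filling \<Rightarrow> nat list \<times> filling" where
  "dsplice n l F = (let cs = dsplice_columns n (columns l F) in
     (shape_of_columns (n - 1) cs, filling_of_columns (n - 1) cs))"

end

theory Submission
  imports Defs Complex_Main "HOL-Library.Multiset"
begin

text \<open>
  Continue every column \<open>a\<close> by \<open>0\<close> on top and by infinity below.  Since columns are strict, every cell
  outside the first row is a descent, and \<open>inv\<close> becomes the sum over pairs of columns \<open>a\<close>, \<open>b\<close> (from left
  to right) of the number of \<open>i\<close> with \<open>a\<^sub>i\<^sub>-\<^sub>1 < b\<^sub>i < a\<^sub>i\<close>; likewise \<open>quinv\<close> counts \<open>a\<^sub>i < b\<^sub>i < a\<^sub>i\<^sub>+\<^sub>1\<close>.  Both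
  sums make sense for columns whose lengths come in any order.  A splice lowers the first sum by one, keeps
  the second one, keeps the multiset of entries of each row, and lowers the number of pairs of columns with
  the shorter one on the left by one.  Removing \<open>n\<close> does not change the first sum, so
  \<open>inv(F) - inv(dsplice F)\<close> is the number of such pairs right after the removal.  Such a pair consists of two
  columns of \<open>F\<close> of the same length \<open>i\<close>, of which only the left one ends in \<open>n\<close>, so this number is the total
  size of the partitions \<open>\<Lambda>\<close> whose boundary path for \<open>i\<close> records which columns of length \<open>i\<close> end in \<open>n\<close>.
  For \<open>quinv\<close> it is the right one, which gives the complementary partitions.

  Splices can be undone, so the filling after the splicing and the positions of \<open>n\<close> determine \<open>F\<close>, and they
  can be prescribed.  The outcome does not depend on the choices because splices of three columns of
  increasing lengths satisfy the braid relation.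
\<close>

section \<open>Padded columns and splicing\<close>

text \<open>Infinity is a number here: \<open>n\<close> for columns with entries below
  \<open>n\<close>, hence \<open>Suc n\<close> for fillings with entries in \<open>{1..n}\<close>.
  Deleting \<open>n\<close> while lowering infinity from \<open>Suc n\<close> to \<open>n\<close> is
  then a truncation of all padded values by \<open>min n\<close>, and missing cells obey the same
  inequalities as cells. Columns form a list of fixed length, emptied ones included, so no index
  shifts during splicing.

  Only the overlay needs a recursion. The pattern consists of row counts, which splices preserve, so
  the pattern of \<open>dsplice F\<close> is that of \<open>F\<close> without its last row. The
  family for \<open>quinv\<close> is defined as the box complement of the one for
  \<open>inv\<close>; property 3 is then immediate, and the work lies in matching
  \<open>quinv\<close> with the size of the complement.

  As \<open>dsplice\<close> is a definite description, confluence has to come before any statement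
  about it. Its obstacle is a pair of overlapping splices. A case analysis on the positions of all
  splices involved is avoided by running them simultaneously from the bottom row upwards, where each
  row is a small problem about linear order.\<close>

definition col_ok :: "nat \<Rightarrow> nat list \<Rightarrow> bool" where
  "col_ok n a \<longleftrightarrow> sorted_wrt (<) a \<and> (\<forall>x\<in>set a. 1 \<le> x \<and> x < n)"

text \<open>
  A column with entries below \<open>n\<close> is continued by \<open>0\<close> above its first entry and by \<open>n\<close>, in the role
  of infinity, below its last one.
\<close>

definition padded :: "nat \<Rightarrow> nat list \<Rightarrow> nat \<Rightarrow> nat" where
  "padded n a i = (if i = 0 then 0 else if i \<le> length a then a ! (i - 1) else n)"

lemma padded_0 [simp]: "padded n a 0 = 0"
  by (simp add: padded_def)

lemma padded_beyond: "length a < i \<Longrightarrow> padded n a i = n"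
  by (simp add: padded_def)

lemma padded_less: "col_ok n a \<Longrightarrow> 0 < n \<Longrightarrow> i \<le> length a \<Longrightarrow> padded n a i < n"
  by (auto simp: padded_def col_ok_def)

lemma padded_le: "col_ok n a \<Longrightarrow> padded n a i \<le> n"
  by (auto simp: padded_def col_ok_def less_imp_le)

lemma padded_pos: "col_ok n a \<Longrightarrow> 0 < n \<Longrightarrow> 0 < i \<Longrightarrow> 0 < padded n a i"
  by (auto simp: padded_def col_ok_def Suc_le_eq)

lemma padded_eq_iff: "col_ok n a \<Longrightarrow> 0 < n \<Longrightarrow> padded n a i = n \<longleftrightarrow> length a < i"
  using padded_less[of n a i] padded_beyond[of a i n] by (cases "i \<le> length a") auto

lemma padded_strict: 
  assumes "col_ok n a" "0 < n" "i \<le> length a" "i < j" 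
  shows "padded n a i < padded n a j"
proof (cases "i = 0 \<or> length a < j")
  case True
  then show ?thesis
    using assms padded_pos[of n a j] padded_less[of n a i] by (auto simp: padded_beyond)
next
  case False
  then show ?thesis
    using assms by (auto simp: padded_def col_ok_def sorted_wrt_iff_nth_less)
qed

lemma padded_mono: "col_ok n a \<Longrightarrow> 0 < n \<Longrightarrow> i \<le> j \<Longrightarrow> padded n a i \<le> padded n a j"
  using padded_strict[of n a i j] padded_beyond[of a i n] padded_beyond[of a j n]
  by (cases "i = j"; cases "i \<le> length a") auto

lemma padded_ge: "col_ok n a \<Longrightarrow> 0 < n \<Longrightarrow> i \<le> length a \<Longrightarrow> i \<le> padded n a i"
proof (induction i)
  case (Suc i)
  then show ?case using padded_strict[of n a i "Suc i"] by simp
qed simp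

lemma length_col: "col_ok n a \<Longrightarrow> 0 < n \<Longrightarrow> length a < n"
  using padded_ge[of n a "length a"] padded_less[of n a "length a"] by simp

lemma padded_inject:
  assumes "length a = length b" "\<And>i. padded n a i = padded n b i"
  shows "a = b"
proof (rule nth_equalityI)
  fix i assume "i < length a"
  then show "a ! i = b ! i" using assms(2)[of "Suc i"] assms(1) by (simp add: padded_def)
qed (use assms in simp)

text \<open>Entries below \<open>n\<close> make the length visible: it is the last index at which
  the padded value differs from \<open>n\<close>.\<close>

lemma padded_inject_col:
  assumes "col_ok n a" "col_ok n b" "0 < n" "\<And>i. padded n a i = padded n b i"
  shows "a = b"
proof (rule padded_inject[OF _ assms(4)])
  show "length a = length b"
  proof -
    have "length a < i \<longleftrightarrow> length b < i" for i
      using padded_eq_iff[OF assms(1,3), of i] padded_eq_iff[OF assms(2,3), of i] assms(4)[of i] by simp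
    from this[of "length a"] this[of "length b"] show ?thesis by linarith
  qed
qed

lemma col_ok_padded:
  assumes "\<And>i. 1 \<le> i \<Longrightarrow> i \<le> length a \<Longrightarrow> padded n a i < padded n a (Suc i)"
      and "\<And>i. 1 \<le> i \<Longrightarrow> i \<le> length a \<Longrightarrow> 0 < padded n a i \<and> padded n a i < n"
  shows "col_ok n a"
proof -
  have "sorted_wrt (<) a"
    unfolding sorted_wrt_iff_nth_Suc_transp[OF transp_on_less]
  proof safe
    fix i assume "Suc i < length a"
    then show "a ! i < a ! Suc i" using assms(1)[of "Suc i"] by (simp add: padded_def)
  qed
  moreover have "1 \<le> x \<and> x < n" if x: "x \<in> set a" for x
  proof -
    obtain i where "i < length a" "x = a ! i" using x by (auto simp: in_set_conv_nth)
    then show ?thesis using assms(2)[of "Suc i"] by (simp add: padded_def)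
  qed
  ultimately show ?thesis by (simp add: col_ok_def)
qed

section \<open>The splice position in terms of padded columns\<close>

lemma splice_index_eqI:
  assumes "length s < length t" "1 \<le> m" "m \<le> length s + 1" "padded n s (m - 1) < padded n t m"
    and "\<And>i. m < i \<Longrightarrow> i \<le> length s + 1 \<Longrightarrow> padded n t i \<le> padded n s (i - 1)"
  shows "splice_index s t = m"
proof -
  \<comment> \<open>For \<open>i <= length s + 1\<close> the lookups in \<open>t\<close> stay inside
    the list because \<open>t\<close> is longer than \<open>s\<close>; the padded \<open>0\<close>
    replaces the case distinction at \<open>i = 1\<close>.\<close>
  have *: "(if i = 1 then 0 else s ! (i - 2)) = padded n s (i - 1)" "t ! (i - 1) = padded n t i"
    if "i \<in> {1..length s + 1}" for i
    using that assms(1) by (auto simp: padded_def numeral_2_eq_2)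
  have "{i \<in> {1..length s + 1}. (if i = 1 then 0 else s ! (i - 2)) < t ! (i - 1)} =
      {i \<in> {1..length s + 1}. padded n s (i - 1) < padded n t i}" (is "?A = ?B")
    using * by (intro Collect_cong conj_cong) auto
  moreover have "Max ?B = m"
  proof (rule Max_eqI)
    show "finite ?B" by (rule finite_subset[of _ "{1..length s + 1}"]) auto
    fix i assume i: "i \<in> ?B"
    show "i \<le> m"
    proof (rule ccontr)
      assume "\<not> i \<le> m"
      then show False using assms(5)[of i] i by simp
    qed
  qed (use assms(2-4) in auto)
  ultimately show ?thesis unfolding splice_index_def by presburger
qed

lemma splice_indexE:
  assumes "length s < length t" "col_ok n t" "0 < n"
  obtains m where "splice_index s t = m" "1 \<le> m" "m \<le> length s + 1" "padded n s (m - 1) < padded n t m"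
    "\<And>i. m < i \<Longrightarrow> i \<le> length s + 1 \<Longrightarrow> padded n t i \<le> padded n s (i - 1)"
proof -
  let ?B = "{i \<in> {1..length s + 1}. padded n s (i - 1) < padded n t i}"
  \<comment> \<open>Position 1 always qualifies, since the padding \<open>0\<close> lies below the
    first padded value of \<open>t\<close>; hence the maximum exists.\<close>
  have "1 \<in> ?B" using padded_pos[OF assms(2,3), of 1] by simp
  then have m: "Max ?B \<in> ?B" by (intro Max_in) auto
  have mx: "padded n t i \<le> padded n s (i - 1)" if "Max ?B < i" "i \<le> length s + 1" for i
  proof (rule ccontr)
    assume "\<not> ?thesis"
    then have "i \<in> ?B" using that by auto
    then have "i \<le> Max ?B" by (intro Max_ge) auto
    then show False using that by simp
  qed
  show ?thesis
    by (rule that[OF splice_index_eqI[OF assms(1)]]) (use m mx in auto)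
qed

text \<open>Past the end of \<open>s\<close> the padded value is the upper bound \<open>n\<close>,
  so the inequality that expresses maximality of \<open>m\<close> holds in every row from
  \<open>m\<close> on, whatever the lengths.\<close>

lemma col_spliceE:
  assumes "length s < length t" "col_ok n s" "col_ok n t" "0 < n" "col_splice s t = (s', t')"
  obtains m where "1 \<le> m" "m \<le> length s + 1" "padded n s (m - 1) < padded n t m"
    "\<And>i. m \<le> i \<Longrightarrow> padded n t (Suc i) \<le> padded n s i"
    "\<And>i. padded n s' i = (if i < m then padded n s i else padded n t i)"
    "\<And>i. padded n t' i = (if i < m then padded n t i else padded n s i)"
    "length s' = length t" "length t' = length s" "splice_index s t = m"
proof -
  obtain m where m: "splice_index s t = m" "1 \<le> m" "m \<le> length s + 1" "padded n s (m - 1) < padded n t m"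
    "\<And>i. m < i \<Longrightarrow> i \<le> length s + 1 \<Longrightarrow> padded n t i \<le> padded n s (i - 1)"
    using splice_indexE[OF assms(1,3,4)] by blast
  have st: "s' = take (m - 1) s @ drop (m - 1) t" "t' = take (m - 1) t @ drop (m - 1) s"
    using assms(5) m(1) by (auto simp: col_splice_def Let_def)
  have 1: "padded n t (Suc i) \<le> padded n s i" if "m \<le> i" for i
    using m(5)[of "Suc i"] that padded_beyond[of s i n] padded_le[OF assms(3), of "Suc i"]
    by (cases "i \<le> length s") auto
  have 2: "padded n s' i = (if i < m then padded n s i else padded n t i)" for i
    using m(2,3) assms(1) by (auto simp: st padded_def nth_append)
  have 3: "padded n t' i = (if i < m then padded n t i else padded n s i)" for i
    using m(2,3) assms(1) by (auto simp: st padded_def nth_append)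
  show ?thesis
    by (rule that[OF m(2-4) 1 2 3 _ _ m(1)]) (use m(2,3) assms(1) in \<open>auto simp: st\<close>)
qed

text \<open>
  The row rule says that a splice can be run from the bottom row upwards: once row \<open>i + 1\<close> is final, the
  two entries of row \<open>i\<close> stay in place if this keeps the left column strict and are exchanged otherwise.
\<close>

lemma col_splice_props:
  assumes "length s < length t" "col_ok n s" "col_ok n t" "0 < n" "col_splice s t = (s', t')"
  shows col_splice_ok1: "col_ok n s'" and col_splice_ok2: "col_ok n t'"
    and col_splice_length: "length s' = length t" "length t' = length s"
    and col_splice_row: "(padded n s' i, padded n t' i) = (padded n s i, padded n t i) \<or>
                         (padded n s' i, padded n t' i) = (padded n t i, padded n s i)"
    and col_splice_row_le: "padded n s' i \<le> padded n s i"
    and col_splice_row_rule: "(padded n s' i, padded n t' i) = 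
         (if padded n s i < padded n s' (Suc i) then (padded n s i, padded n t i) else (padded n t i, padded n s i))"
    and col_splice_inverse: "col_splice t' s' = (t, s)"
proof -
  obtain m where m: "1 \<le> m" "m \<le> length s + 1" "padded n s (m - 1) < padded n t m"
    "\<And>i. m \<le> i \<Longrightarrow> padded n t (Suc i) \<le> padded n s i"
    "\<And>i. padded n s' i = (if i < m then padded n s i else padded n t i)"
    "\<And>i. padded n t' i = (if i < m then padded n t i else padded n s i)"
    "length s' = length t" "length t' = length s" "splice_index s t = m"
    by (rule col_spliceE[OF assms]) (rule that)
  note S = padded_strict[OF assms(2,4)] and T = padded_strict[OF assms(3,4)]
  note s = padded_mono[OF assms(2,4)] and t = padded_mono[OF assms(3,4)]
  show l: "length s' = length t" "length t' = length s" using m by auto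
  show "(padded n s' i, padded n t' i) = (padded n s i, padded n t i) \<or>
        (padded n s' i, padded n t' i) = (padded n t i, padded n s i)"
    by (simp add: m(5,6))
  show "padded n s' i \<le> padded n s i"
    using m(4)[of i] t[of i "Suc i"] by (auto simp: m(5,6) intro: order_trans)
  show ok1: "col_ok n s'"
  proof (rule col_ok_padded)
    fix i assume i: "1 \<le> i" "i \<le> length s'"
    then have i': "i \<le> length t" using l by simp
    consider "Suc i < m" | "Suc i = m" | "m \<le> i" by linarith
    then show "padded n s' i < padded n s' (Suc i)"
      using S[of i "Suc i"] T[of i "Suc i"] m(2,3) i' by cases (auto simp: m(5))
    show "0 < padded n s' i \<and> padded n s' i < n"
      using i i' m(2) padded_pos[OF assms(2,4), of i] padded_pos[OF assms(3,4), of i]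
        padded_less[OF assms(2,4), of i] padded_less[OF assms(3,4), of i] by (auto simp: m(5))
  qed
  \<comment> \<open>The comparison passes through row \<open>m + 1\<close> of \<open>t\<close>:
    \<open>t\<close> increases strictly from row \<open>m - 1\<close> to row \<open>m + 1\<close>,
    and maximality of \<open>m\<close> bounds the latter entry by row \<open>m\<close> of
    \<open>s\<close>.\<close>
  have low: "padded n t (m - 1) < padded n s m" if "m \<le> length s"
    using T[of "m - 1" "Suc m"] m(4)[of m] that assms(1) by linarith
  show ok2: "col_ok n t'"
  proof (rule col_ok_padded)
    fix i assume i: "1 \<le> i" "i \<le> length t'"
    then have i': "i \<le> length s" using l by simp
    have lo: "padded n t (m - 1) < padded n s m"
    proof (cases "m \<le> length s")
      case False
      then show ?thesis
        using padded_less[OF assms(3,4), of "m - 1"] m(2) assms(1) padded_beyond[of s m n] by simp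
    qed (rule low)
    consider "Suc i < m" | "Suc i = m" | "m \<le> i" by linarith
    then show "padded n t' i < padded n t' (Suc i)"
    proof cases
      case 1
      then show ?thesis using T[of i "Suc i"] i' assms(1) by (simp add: m(6))
    next
      case 2
      then show ?thesis using lo by (auto simp: m(6))
    next
      case 3
      then show ?thesis using S[of i "Suc i"] i' by (simp add: m(6))
    qed
    show "0 < padded n t' i \<and> padded n t' i < n"
      using i i' m(2) assms(1) padded_pos[OF assms(2,4), of i] padded_pos[OF assms(3,4), of i]
        padded_less[OF assms(2,4), of i] padded_less[OF assms(3,4), of i] by (auto simp: m(6))
  qed
  show "(padded n s' i, padded n t' i) = 
         (if padded n s i < padded n s' (Suc i) then (padded n s i, padded n t i) else (padded n t i, padded n s i))"
  proof -
    consider "Suc i < m" | "Suc i = m" | "m \<le> i" by linarith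
    then show ?thesis
      using S[of i "Suc i"] m(2,3) m(4)[of i] by cases (auto simp: m(5,6))
  qed
  \<comment> \<open>The swapped pair is cut at the same place: at \<open>m\<close> strictness of
    \<open>t\<close> is needed, and further down the inequalities are those that made
    \<open>m\<close> maximal the first time.\<close>
  have "splice_index t' s' = m"
  proof (rule splice_index_eqI[where n = n])
    fix i assume "m < i"
    then show "padded n s' i \<le> padded n t' (i - 1)"
      using m(4)[of "i - 1"] by (auto simp: m(5,6))
  qed (use m(1,2,7,8) assms(1) T[of "m - 1" m] in \<open>auto simp: m(5,6)\<close>)
  then have "col_splice t' s' = 
    (take (m - 1) t' @ drop (m - 1) s', take (m - 1) s' @ drop (m - 1) t')"
    by (simp add: col_splice_def Let_def)
  moreover have "s' = take (m - 1) s @ drop (m - 1) t" "t' = take (m - 1) t @ drop (m - 1) s"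
    using assms(5) m(9) by (auto simp: col_splice_def Let_def)
  ultimately show "col_splice t' s' = (t, s)"
    using m(1,2) assms(1) by (simp add: min_def drop_take)
qed

section \<open>The braid relation\<close>

text \<open>
  The inductive step of the braid relation.  Consecutive rows \<open>x\<close> and \<open>a\<close> of three columns are followed
  through the splices at positions 1, 2, 1 (rows \<open>u, v, w\<close> over \<open>b, c, d\<close>) and 2, 1, 2 (rows \<open>p, q, r\<close>
  over \<open>e, f, d\<close>); the lower rows are assumed to end up equal.  The statement lives in the reals because
  it is closed by a decision procedure for real linear arithmetic.
\<close>

lemma braid_row_real:
  fixes n :: real
  defines "lt \<equiv> \<lambda>x y. x < y \<or> (x = n \<and> y = n)"
    and "sw \<equiv> \<lambda>p q p' q'. p' \<le> p \<and> (p' = p \<and> q' = q \<or> p' = q \<and> q' = p)"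
    and "rl \<equiv> \<lambda>p q y p' q'. (p < y \<and> p' = p \<and> q' = q) \<or> (\<not> p < y \<and> p' = q \<and> q' = p)"
  assumes Y: "sw a1 a2 b1 b2" "sw b2 a3 c2 c3" "sw b1 c2 d1 d2"
    "sw a2 a3 e2 e3" "sw a1 e2 d1 f2" "sw f2 e3 d2 c3"
    and R: "rl x1 x2 b1 u1 u2" "rl u2 x3 c2 v2 v3" "rl u1 v2 d1 w1 w2"
    "rl x2 x3 e2 p2 p3" "rl x1 p2 d1 q1 q2" "rl q2 p3 d2 r2 r3"
    and N: "a1 \<le> n" "a2 \<le> n" "a3 \<le> n"
    and L: "lt x1 a1" "lt x2 a2" "lt x3 a3" "lt u1 b1" "lt u2 b2"
      "lt v2 c2" "lt v3 c3" "lt w1 d1" "lt w2 d2" "lt p2 e2" "lt p3 e3"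
      "lt q1 d1" "lt q2 f2" "lt r2 d2" "lt r3 c3"
  shows "w1 = q1 \<and> v3 = r3"
  using Y R L N unfolding lt_def sw_def rl_def
  using [[argo_timeout = 100]]
  by argo

text \<open>Real arithmetic settles the two outer columns. The middle one is then forced, because
  both sequences of splices permute the same three entries and so preserve their sum.\<close>

lemma braid_row:
  fixes n :: nat
  defines "lt \<equiv> \<lambda>x y. x < y \<or> (x = n \<and> y = n)"
    and "sw \<equiv> \<lambda>p q p' q'. p' \<le> p \<and> (p' = p \<and> q' = q \<or> p' = q \<and> q' = p)"
    and "rl \<equiv> \<lambda>p q y p' q'. (p', q') = (if p < y then (p, q) else (q, p))"
  assumes Y: "sw a1 a2 b1 b2" "sw b2 a3 c2 c3" "sw b1 c2 d1 d2"
    "sw a2 a3 e2 e3" "sw a1 e2 d1 f2" "sw f2 e3 d2 c3"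
    and R: "rl x1 x2 b1 u1 u2" "rl u2 x3 c2 v2 v3" "rl u1 v2 d1 w1 w2"
    "rl x2 x3 e2 p2 p3" "rl x1 p2 d1 q1 q2" "rl q2 p3 d2 r2 r3"
    and N: "a1 \<le> n" "a2 \<le> n" "a3 \<le> n"
    and L: "lt x1 a1" "lt x2 a2" "lt x3 a3" "lt u1 b1" "lt u2 b2"
      "lt v2 c2" "lt v3 c3" "lt w1 d1" "lt w2 d2" "lt p2 e2" "lt p3 e3"
      "lt q1 d1" "lt q2 f2" "lt r2 d2" "lt r3 c3"
  shows "w1 = q1 \<and> w2 = r2 \<and> v3 = r3"
proof -
  have lt: "lt x y \<Longrightarrow> real x < real y \<or> (real x = real n \<and> real y = real n)" for x y
    by (auto simp: lt_def)
  have sw: "sw p q p' q' \<Longrightarrow> real p' \<le> real p \<and>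
      (real p' = real p \<and> real q' = real q \<or> real p' = real q \<and> real q' = real p)" for p q p' q'
    by (auto simp: sw_def)
  have rl: "rl p q y p' q' \<Longrightarrow> (real p < real y \<and> real p' = real p \<and> real q' = real q) \<or>
      (\<not> real p < real y \<and> real p' = real q \<and> real q' = real p)" for p q y p' q'
    by (auto simp: rl_def split: if_splits)
  have "real w1 = real q1 \<and> real v3 = real r3"
    by (rule braid_row_real) (rule Y[THEN sw] R[THEN rl] L[THEN lt] N[folded of_nat_le_iff[where ?'a = real]])+
  moreover have "w1 + w2 + v3 = q1 + r2 + r3"
    using R by (auto simp: rl_def split: if_splits)
  ultimately show ?thesis by simp
qed

text \<open>By the row rule each splice computes row \<open>i\<close> with the help of row
  \<open>i + 1\<close>, so agreement of the two sequences spreads upwards from the rows that consist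
  of padding. This is the overlap that local confluence has to resolve.\<close>

lemma braid:
  assumes n: "0 < n" and ok: "col_ok n a" "col_ok n b" "col_ok n c"
    and len: "length a < length b" "length b < length c"
    and s: "col_splice a b = (a1, b1)" "col_splice b1 c = (b2, c1)" "col_splice a1 b2 = (a3, b3)"
    and t: "col_splice b c = (b4, c4)" "col_splice a b4 = (a5, b5)" "col_splice b5 c4 = (b6, c6)"
  shows "a3 = a5 \<and> b3 = b6 \<and> c1 = c6"
proof -
  note p1 = col_splice_props[OF len(1) ok(1,2) n s(1)]
  have l: "length b1 < length c" using len p1(4) by simp
  note p2 = col_splice_props[OF l p1(2) ok(3) n s(2)]
  have l: "length a1 < length b2" using len p1(3) p2(3) by simp
  note p3 = col_splice_props[OF l p1(1) p2(1) n s(3)]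
  note q1 = col_splice_props[OF len(2) ok(2,3) n t(1)]
  have l: "length a < length b4" using len q1(3) by simp
  note q2 = col_splice_props[OF l ok(1) q1(1) n t(2)]
  have l: "length b5 < length c4" using len q2(4) q1(4) by simp
  note q3 = col_splice_props[OF l q2(2) q1(2) n t(3)]
  have lt: "padded n x i < padded n x (Suc i) \<or> (padded n x i = n \<and> padded n x (Suc i) = n)"
    if "col_ok n x" for x i
    using padded_strict[OF that n, of i "Suc i"] padded_beyond[of x i n] padded_beyond[of x "Suc i" n]
    by (cases "i \<le> length x") auto
  have top: "padded n x i = n" if "col_ok n x" "n \<le> i" for x i
    using length_col[OF that(1) n] that(2) by (simp add: padded_beyond)
  \<comment> \<open>Induction over the rows from the bottom: \<open>k\<close> bounds the distance
    from row \<open>n\<close>, and from row \<open>n\<close> on all values are padding, since a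
    column has fewer than \<open>n\<close> entries.\<close>
  have "n \<le> i + k \<Longrightarrow> padded n a3 i = padded n a5 i \<and> padded n b3 i = padded n b6 i \<and> padded n c1 i = padded n c6 i" for i k
  proof (induction k arbitrary: i)
    case 0
    then show ?case
      using p3(1,2) q2(1) q3(1) p2(2) q3(2) by (simp add: top)
  next
    case (Suc k)
    then have IH: "padded n a3 (Suc i) = padded n a5 (Suc i)" "padded n b3 (Suc i) = padded n b6 (Suc i)"
      "padded n c1 (Suc i) = padded n c6 (Suc i)" by auto
    note r = p1(6)[of "Suc i"] p2(6)[of "Suc i"] p3(6)[of "Suc i"] q1(6)[of "Suc i"] q2(6)[of "Suc i"] q3(6)[of "Suc i"]
    note r' = p1(5)[of "Suc i"] p2(5)[of "Suc i"] p3(5)[of "Suc i"] q1(5)[of "Suc i"] q2(5)[of "Suc i"] q3(5)[of "Suc i"]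
    have sw: "padded n x' j \<le> padded n x j \<and> (padded n x' j = padded n x j \<and> padded n y' j = padded n y j \<or>
        padded n x' j = padded n y j \<and> padded n y' j = padded n x j)"
      if "padded n x' j \<le> padded n x j" "(padded n x' j, padded n y' j) = (padded n x j, padded n y j) \<or>
                         (padded n x' j, padded n y' j) = (padded n y j, padded n x j)" for x y x' y' j
      using that by auto
    show ?case
      by (rule braid_row[where n = n and
        ?a1.0 = "padded n a (Suc i)" and ?a2.0 = "padded n b (Suc i)" and ?a3.0 = "padded n c (Suc i)" and
        ?b1.0 = "padded n a1 (Suc i)" and ?b2.0 = "padded n b1 (Suc i)" and ?c2.0 = "padded n b2 (Suc i)" and
        ?c3.0 = "padded n c1 (Suc i)" and ?d1.0 = "padded n a3 (Suc i)" and ?d2.0 = "padded n b3 (Suc i)" and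
        ?e2.0 = "padded n b4 (Suc i)" and ?e3.0 = "padded n c4 (Suc i)" and ?f2.0 = "padded n b5 (Suc i)" and
        ?x1.0 = "padded n a i" and ?x2.0 = "padded n b i" and ?x3.0 = "padded n c i" and
        ?u1.0 = "padded n a1 i" and ?u2.0 = "padded n b1 i" and ?v2.0 = "padded n b2 i" and
        ?v3.0 = "padded n c1 i" and ?w1.0 = "padded n a3 i" and ?w2.0 = "padded n b3 i" and
        ?p2.0 = "padded n b4 i" and ?p3.0 = "padded n c4 i" and ?q1.0 = "padded n a5 i" and
        ?q2.0 = "padded n b5 i" and ?r2.0 = "padded n b6 i" and ?r3.0 = "padded n c6 i",
        OF sw[OF r(1) r'(1)] sw[OF r(2) r'(2)] sw[OF r(3) r'(3)]
          sw[OF r(4) r'(4)] sw[OF r(5) r'(5), folded IH] sw[OF r(6) r'(6), folded IH]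
          p1(7)[of i] p2(7)[of i] p3(7)[of i] q1(7)[of i]
          q2(7)[of i, folded IH] q3(7)[of i, folded IH]])
        (simp_all only: lt ok p1(1,2) p2(1,2) p3(1,2) q1(1,2) q2(1,2) q3(1,2) padded_le 
          lt[OF q2(1), of i, folded IH] lt[OF q3(1), of i, folded IH] lt[OF q3(2), of i, folded IH])
  qed
  from this[of _ n] have "padded n a3 i = padded n a5 i" "padded n b3 i = padded n b6 i" "padded n c1 i = padded n c6 i" for i
    by auto
  then show ?thesis
    using padded_inject_col[OF p3(1) q2(1) n] padded_inject_col[OF p3(2) q3(1) n] padded_inject_col[OF p2(2) q3(2) n]
    by blast
qed

section \<open>Confluence of splicing\<close>

primrec pair_sum :: "('a \<Rightarrow> 'a \<Rightarrow> nat) \<Rightarrow> 'a list \<Rightarrow> nat" where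
  "pair_sum f [] = 0"
| "pair_sum f (x # xs) = (\<Sum>y\<leftarrow>xs. f x y) + pair_sum f xs"

lemma pair_sum_append: "pair_sum f (xs @ ys) = pair_sum f xs + pair_sum f ys + (\<Sum>x\<leftarrow>xs. \<Sum>y\<leftarrow>ys. f x y)"
  by (induction xs) auto

lemma pair_sum_eq_0_iff: "pair_sum f xs = 0 \<longleftrightarrow> sorted_wrt (\<lambda>x y. f x y = 0) xs"
  by (induction xs) auto

lemma pair_sum_map: "pair_sum f (map g xs) = pair_sum (\<lambda>x y. f (g x) (g y)) xs"
  by (induction xs) (auto simp: comp_def)

text \<open>If the other entries cannot tell the two pairs apart, only the mutual terms
  \<open>f a b\<close> and \<open>f a' b'\<close> change. They are added crosswise to avoid
  subtraction of naturals.\<close>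

lemma pair_sum_replace2:
  assumes "\<And>c. f a c + f b c = f a' c + f b' c" "\<And>c. f c a + f c b = f c a' + f c b'"
  shows "pair_sum f (xs @ a # b # ys) + f a' b' = pair_sum f (xs @ a' # b' # ys) + f a b"
proof -
  have "(\<Sum>y\<leftarrow>ys. f a y) + (\<Sum>y\<leftarrow>ys. f b y) = (\<Sum>y\<leftarrow>ys. f a' y) + (\<Sum>y\<leftarrow>ys. f b' y)"
    by (simp add: sum_list_addf[symmetric] assms(1))
  moreover have "(\<Sum>x\<leftarrow>xs. \<Sum>y\<leftarrow>a # b # ys. f x y) = (\<Sum>x\<leftarrow>xs. \<Sum>y\<leftarrow>a' # b' # ys. f x y)"
    by (simp add: add.assoc[symmetric] assms(2))
  ultimately show ?thesis by (simp add: pair_sum_append)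
qed

abbreviation len_inversions :: "nat list \<Rightarrow> nat" where
  "len_inversions \<equiv> pair_sum (\<lambda>x y. of_bool (x < y))"

lemma len_inversions_eq_0_iff: "len_inversions ds = 0 \<longleftrightarrow> sorted_wrt (\<ge>) ds"
  by (simp add: pair_sum_eq_0_iff not_less)

lemma len_inversions_swap: "x < y \<Longrightarrow> len_inversions (xs @ x # y # ys) = Suc (len_inversions (xs @ y # x # ys))"
  using pair_sum_replace2[of "\<lambda>x y. of_bool (x < y)" x y y x xs ys] by simp

lemma len_inversions_pos_split:
  assumes "len_inversions ds \<noteq> 0"
  obtains xs x y ys where "ds = xs @ x # y # ys" "x < y"
proof -
  obtain j where j: "Suc j < length ds" "ds ! j < ds ! Suc j"
    using assms unfolding len_inversions_eq_0_iff sorted_wrt_iff_nth_Suc_transp[OF transp_on_ge] by (auto simp: not_le)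
  then have "ds = take j ds @ ds ! j # ds ! Suc j # drop (Suc (Suc j)) ds"
    by (simp add: Cons_nth_drop_Suc)
  then show ?thesis using that j(2) by blast
qed

abbreviation cols_ok :: "nat \<Rightarrow> nat list list \<Rightarrow> bool" where
  "cols_ok n cs \<equiv> \<forall>a\<in>set cs. col_ok n a"

section \<open>Splicing as a terminating and confluent rewriting process\<close>

lemma splice_step_iff:
  "splice_step cs cs' \<longleftrightarrow> (\<exists>xs a b ys a' b'. cs = xs @ a # b # ys \<and> length a < length b \<and>
     col_splice a b = (a', b') \<and> cs' = xs @ a' # b' # ys)"
proof
  assume "splice_step cs cs'"
  then obtain j where j: "Suc j < length cs" "length (cs ! j) < length (cs ! Suc j)"
    "case col_splice (cs ! j) (cs ! Suc j) of (\<sigma>, \<tau>) \<Rightarrow> cs' = cs[j := \<sigma>, Suc j := \<tau>]"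
    unfolding splice_step_def by (elim exE conjE) (rule that)
  obtain a' b' where s: "col_splice (cs ! j) (cs ! Suc j) = (a', b')" by (meson surj_pair)
  have "cs = take j cs @ cs ! j # cs ! Suc j # drop (Suc (Suc j)) cs"
    using j(1) by (simp add: Cons_nth_drop_Suc)
  moreover have "cs' = take j cs @ a' # b' # drop (Suc (Suc j)) cs"
    using j(1,3) s by (simp add: upd_conv_take_nth_drop take_update_swap drop_update_swap nth_append)
  ultimately show "\<exists>xs a b ys a' b'. cs = xs @ a # b # ys \<and> length a < length b \<and>
     col_splice a b = (a', b') \<and> cs' = xs @ a' # b' # ys"
    using j(2) s by blast
next
  assume "\<exists>xs a b ys a' b'. cs = xs @ a # b # ys \<and> length a < length b \<and>
     col_splice a b = (a', b') \<and> cs' = xs @ a' # b' # ys"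
  then obtain xs a b ys a' b' where *: "cs = xs @ a # b # ys" "length a < length b"
     "col_splice a b = (a', b')" "cs' = xs @ a' # b' # ys" by blast
  then show "splice_step cs cs'"
    unfolding splice_step_def
    by (intro exI[of _ "length xs"]) (simp add: nth_append list_update_append)
qed

lemma splice_stepI:
  "length a < length b \<Longrightarrow> col_splice a b = (a', b') \<Longrightarrow> splice_step (xs @ a # b # ys) (xs @ a' # b' # ys)"
  unfolding splice_step_iff by blast

lemma splice_step_ok: "splice_step cs cs' \<Longrightarrow> 0 < n \<Longrightarrow> cols_ok n cs \<Longrightarrow> cols_ok n cs'"
proof -
  assume *: "splice_step cs cs'" "0 < n" "cols_ok n cs"
  obtain xs a b ys a' b' where "cs = xs @ a # b # ys" "length a < length b"
     "col_splice a b = (a', b')" "cs' = xs @ a' # b' # ys"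
    using *(1) unfolding splice_step_iff by blast
  then show "cols_ok n cs'"
    using * col_splice_ok1[of a b n a' b'] col_splice_ok2[of a b n a' b'] by auto
qed

lemma splice_steps_ok: "splice_step\<^sup>*\<^sup>* cs cs' \<Longrightarrow> 0 < n \<Longrightarrow> cols_ok n cs \<Longrightarrow> cols_ok n cs'"
  by (induction rule: rtranclp_induct) (auto dest: splice_step_ok)

lemma splice_step_length: "splice_step cs cs' \<Longrightarrow> length cs' = length cs"
  unfolding splice_step_iff by auto

lemma splice_steps_length: "splice_step\<^sup>*\<^sup>* cs cs' \<Longrightarrow> length cs' = length cs"
  by (induction rule: rtranclp_induct) (auto dest: splice_step_length)

text \<open>A splice exchanges the lengths of two neighbours, which is a step of bubble sort. The
  exact decrease serves twice: as termination measure, and as the amount to be compared with the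
  loss in \<open>inv\<close>.\<close>

lemma splice_step_len_inversions:
  assumes "splice_step cs cs'" "0 < n" "cols_ok n cs"
  shows "len_inversions (map length cs) = Suc (len_inversions (map length cs'))"
proof -
  obtain xs a b ys a' b' where *: "cs = xs @ a # b # ys" "length a < length b"
     "col_splice a b = (a', b')" "cs' = xs @ a' # b' # ys"
    using assms(1) unfolding splice_step_iff by blast
  then show ?thesis
    using col_splice_length[OF *(2) _ _ assms(2) *(3)] assms(3)
      len_inversions_swap[OF *(2), of "map length xs" "map length ys"] by simp
qed

lemma partition_shaped_iff: "partition_shaped cs \<longleftrightarrow> len_inversions (map length cs) = 0"
  by (simp add: partition_shaped_def len_inversions_eq_0_iff)

lemma splice_step_exists:
  assumes "\<not> partition_shaped cs"
  shows "\<exists>cs'. splice_step cs cs'"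
proof -
  obtain xs x y ys where "map length cs = xs @ x # y # ys" "x < y"
    using assms len_inversions_pos_split unfolding partition_shaped_iff by metis
  then obtain us a b vs where "cs = us @ a # b # vs" "length a < length b"
    by (auto simp: map_eq_append_conv map_eq_Cons_conv)
  moreover obtain a' b' where "col_splice a b = (a', b')" by (meson surj_pair)
  ultimately show ?thesis using splice_stepI by blast
qed

lemma splice_normal_form:
  assumes "0 < n" "cols_ok n cs"
  shows "\<exists>cs'. splice_step\<^sup>*\<^sup>* cs cs' \<and> partition_shaped cs'"
  using assms(2)
proof (induction "len_inversions (map length cs)" arbitrary: cs)
  case 0
  then show ?case by (auto simp: partition_shaped_iff)
next
  case (Suc k)
  then have "\<not> partition_shaped cs" by (simp add: partition_shaped_iff)
  then obtain cs1 where 1: "splice_step cs cs1" using splice_step_exists by blast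
  then have "k = len_inversions (map length cs1)" using splice_step_len_inversions[OF 1 assms(1) Suc(3)] Suc(2) by simp
  then obtain cs' where "splice_step\<^sup>*\<^sup>* cs1 cs'" "partition_shaped cs'"
    using Suc(1) splice_step_ok[OF 1 assms(1) Suc(3)] by blast
  then show ?case using 1 by (blast intro: converse_rtranclp_into_rtranclp)
qed

text \<open>The list \<open>zs\<close> separates the starting points of the two splices. If it is
  empty, the splices coincide; if it has at least two members, they commute; if it is
  \<open>[a]\<close>, three columns of increasing lengths are involved and the braid relation joins
  the results.\<close>

lemma splice_local_confluence_aux:
  assumes n: "0 < n" and ok: "cols_ok n cs"
    and 1: "cs = xs @ a # b # ys" "length a < length b" "col_splice a b = (a', b')"
    and 2: "cs = us @ c # d # vs" "length c < length d" "col_splice c d = (c', d')"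
    and le: "length xs \<le> length us"
  shows "\<exists>e. splice_step\<^sup>*\<^sup>* (xs @ a' # b' # ys) e \<and> splice_step\<^sup>*\<^sup>* (us @ c' # d' # vs) e"
proof -
  obtain zs where zs: "us = xs @ zs" "a # b # ys = zs @ c # d # vs"
    using 1(1) 2(1) le by (auto simp: append_eq_append_conv2)
  consider "zs = []" | "zs = [a]" | ws where "zs = a # b # ws"
    using zs(2) by (cases zs rule: remdups_adj.cases) auto
  then show ?thesis
  proof cases
    case 1
    then show ?thesis using zs assms(5) 2(3) by auto
  next
    case 2
    then have eq: "us = xs @ [a]" "c = b" "ys = d # vs" using zs by auto
    have ok': "col_ok n a" "col_ok n b" "col_ok n d" using ok assms(3) eq by auto
    have len: "length a < length b" "length b < length d" using assms(4,7) eq by auto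
    have s2: "col_splice b d = (c', d')" using assms(8) eq by simp
    obtain b2 c1 where s1: "col_splice b' d = (b2, c1)" by (meson surj_pair)
    obtain a3 b3 where s3: "col_splice a' b2 = (a3, b3)" by (meson surj_pair)
    obtain a5 b5 where t1: "col_splice a c' = (a5, b5)" by (meson surj_pair)
    obtain b6 c6 where t2: "col_splice b5 d' = (b6, c6)" by (meson surj_pair)
    note p1 = col_splice_props[OF len(1) ok'(1,2) n assms(5)]
    have l1: "length b' < length d" using len p1(4) by simp
    note p2 = col_splice_props[OF l1 p1(2) ok'(3) n s1]
    have l2: "length a' < length b2" using len p1(3) p2(3) by simp
    note q1 = col_splice_props[OF len(2) ok'(2,3) n s2]
    have l3: "length a < length c'" using len q1(3) by simp
    note q2 = col_splice_props[OF l3 ok'(1) q1(1) n t1]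
    have l4: "length b5 < length d'" using len q2(4) q1(4) by simp
    have br: "a3 = a5" "b3 = b6" "c1 = c6"
      using braid[OF n ok' len assms(5) s1 s3 s2 t1 t2] by auto
    have "splice_step (xs @ a' # b' # ys) (xs @ a' # b2 # c1 # vs)"
      using splice_stepI[OF l1 s1, of "xs @ [a']" vs] eq by simp
    moreover have "splice_step (xs @ a' # b2 # c1 # vs) (xs @ a3 # b3 # c1 # vs)"
      by (rule splice_stepI[OF l2 s3])
    moreover have "splice_step (us @ c' # d' # vs) (xs @ a5 # b5 # d' # vs)"
      using splice_stepI[OF l3 t1, of "xs" "d' # vs"] eq by simp
    moreover have "splice_step (xs @ a5 # b5 # d' # vs) (xs @ a5 # b6 # c6 # vs)"
      using splice_stepI[OF l4 t2, of "xs @ [a5]" vs] by simp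
    ultimately have "splice_step\<^sup>*\<^sup>* (xs @ a' # b' # ys) (xs @ a3 # b3 # c1 # vs)"
      "splice_step\<^sup>*\<^sup>* (us @ c' # d' # vs) (xs @ a3 # b3 # c1 # vs)"
      unfolding br by (meson converse_rtranclp_into_rtranclp r_into_rtranclp)+
    then show ?thesis by blast
  next
    case 3
    then have eq: "us = xs @ a # b # ws" "ys = ws @ c # d # vs" using zs by auto
    have "splice_step (xs @ a' # b' # ys) (xs @ a' # b' # ws @ c' # d' # vs)"
      using splice_stepI[OF assms(7,8), of "xs @ a' # b' # ws" vs] eq by simp
    moreover have "splice_step (us @ c' # d' # vs) (xs @ a' # b' # ws @ c' # d' # vs)"
      using splice_stepI[OF assms(4,5), of xs "ws @ c' # d' # vs"] eq by simp
    ultimately show ?thesis by blast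
  qed
qed

lemma splice_local_confluence:
  assumes "0 < n" "cols_ok n cs" "splice_step cs c1" "splice_step cs c2"
  shows "\<exists>e. splice_step\<^sup>*\<^sup>* c1 e \<and> splice_step\<^sup>*\<^sup>* c2 e"
proof -
  obtain xs a b ys a' b' where 1: "cs = xs @ a # b # ys" "length a < length b"
     "col_splice a b = (a', b')" "c1 = xs @ a' # b' # ys"
    using assms(3) unfolding splice_step_iff by blast
  obtain us c d vs c' d' where 2: "cs = us @ c # d # vs" "length c < length d"
     "col_splice c d = (c', d')" "c2 = us @ c' # d' # vs"
    using assms(4) unfolding splice_step_iff by blast
  show ?thesis
    using splice_local_confluence_aux[OF assms(1,2) 1(1-3) 2(1-3)]
      splice_local_confluence_aux[OF assms(1,2) 2(1-3) 1(1-3)] 1(4) 2(4)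
    by (cases "length xs \<le> length us") auto
qed

text \<open>Newman's argument, with the number of ascending pairs of lengths as measure: local
  confluence joins the two first steps, the common successor is continued to a final
  \<open>f\<close>, and the induction hypothesis identifies both outcomes with
  \<open>f\<close>.\<close>

lemma splice_normal_form_unique:
  assumes "0 < n" "cols_ok n cs"
    and "splice_step\<^sup>*\<^sup>* cs c1" "partition_shaped c1" "splice_step\<^sup>*\<^sup>* cs c2" "partition_shaped c2"
  shows "c1 = c2"
  using assms(2-)
proof (induction "len_inversions (map length cs)" arbitrary: cs c1 c2 rule: less_induct)
  case less
  have final: "c = c'" if "splice_step\<^sup>*\<^sup>* c c'" "partition_shaped c" "cols_ok n c" for c c'
    using that(1)
  proof (cases rule: converse_rtranclpE)
    case (step y)
    then show ?thesis
      using splice_step_len_inversions[OF step(1) assms(1) that(3)] that(2) by (simp add: partition_shaped_iff)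
  qed
  show ?case
  proof (cases "partition_shaped cs")
    case True
    then show ?thesis using final less.prems by metis
  next
    case False
    obtain d1 where d1: "splice_step cs d1" "splice_step\<^sup>*\<^sup>* d1 c1"
      using less.prems(2,3) False by (auto elim: converse_rtranclpE)
    obtain d2 where d2: "splice_step cs d2" "splice_step\<^sup>*\<^sup>* d2 c2"
      using less.prems(4,5) False by (auto elim: converse_rtranclpE)
    have ok: "cols_ok n d1" "cols_ok n d2"
      using splice_step_ok[OF _ assms(1) less.prems(1)] d1(1) d2(1) by auto
    obtain e where e: "splice_step\<^sup>*\<^sup>* d1 e" "splice_step\<^sup>*\<^sup>* d2 e"
      using splice_local_confluence[OF assms(1) less.prems(1) d1(1) d2(1)] by blast
    obtain f where f: "splice_step\<^sup>*\<^sup>* e f" "partition_shaped f"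
      using splice_normal_form[OF assms(1)] splice_steps_ok[OF e(1) assms(1) ok(1)] by blast
    have ef: "splice_step\<^sup>*\<^sup>* d1 f" "splice_step\<^sup>*\<^sup>* d2 f"
      using e f(1) by (auto intro: rtranclp_trans)
    have "c1 = f"
      using less.hyps[OF _ ok(1) d1(2) less.prems(3) _ f(2)] ef
        splice_step_len_inversions[OF d1(1) assms(1) less.prems(1)] by simp
    moreover have "c2 = f"
      using less.hyps[OF _ ok(2) d2(2) less.prems(5) _ f(2)] ef
        splice_step_len_inversions[OF d2(1) assms(1) less.prems(1)] by simp
    ultimately show ?thesis by simp
  qed
qed

section \<open>Reversing splices and invariants\<close>

text \<open>A splice can be run backwards wherever a longer column stands directly left of a shorter
  one, so the bubble sort of the lengths can be undone towards any rearrangement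
  \<open>ds\<close>.\<close>

lemma splice_reverse:
  assumes "0 < n" "cols_ok n g" "partition_shaped g" "mset ds = mset (map length g)"
  shows "\<exists>cs. cols_ok n cs \<and> map length cs = ds \<and> splice_step\<^sup>*\<^sup>* cs g"
  using assms(4)
proof (induction "len_inversions ds" arbitrary: ds)
  case 0
  have "sorted (rev ds)" "sorted (rev (map length g))"
    using 0(1) assms(3) by (simp_all add: partition_shaped_iff len_inversions_eq_0_iff sorted_wrt_rev)
  then have "ds = map length g"
    using 0(2) by (metis mset_rev properties_for_sort rev_rev_ident)
  then show ?case using assms(2) by auto
next
  case (Suc k)
  then have "len_inversions ds \<noteq> 0" by simp
  then obtain xs x y ys where ds: "ds = xs @ x # y # ys" "x < y" by (rule len_inversions_pos_split)
  have "k = len_inversions (xs @ y # x # ys)" using Suc(2) len_inversions_swap[OF ds(2), of xs ys] ds(1) by simp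
  moreover have "mset (xs @ y # x # ys) = mset (map length g)" using Suc(3) ds by (simp add: add_mset_commute)
  ultimately obtain cs where cs: "cols_ok n cs" "map length cs = xs @ y # x # ys"
    "splice_step\<^sup>*\<^sup>* cs g" using Suc(1) by blast
  obtain us t s vs where us: "cs = us @ t # s # vs" "map length us = xs" "length t = y"
    "length s = x" "map length vs = ys"
    using cs(2) by (auto simp: map_eq_append_conv map_eq_Cons_conv)
  \<comment> \<open>Here \<open>t\<close> is the longer column and stands left of \<open>s\<close>.
    Splicing is inverted by splicing with the columns swapped, so \<open>a\<close>, \<open>b\<close>
    is the pair whose splice is \<open>t\<close>, \<open>s\<close>.\<close>
  obtain b a where ba: "col_splice s t = (b, a)" by (meson surj_pair)
  have l: "length s < length t" and ok: "col_ok n s" "col_ok n t" using us ds cs(1) by auto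
  note p = col_splice_props[OF l ok assms(1) ba]
  have "splice_step (us @ a # b # vs) (us @ t # s # vs)"
    by (rule splice_stepI) (use p l in auto)
  then have "splice_step\<^sup>*\<^sup>* (us @ a # b # vs) g"
    using cs(3) us(1) by (simp add: converse_rtranclp_into_rtranclp)
  moreover have "cols_ok n (us @ a # b # vs)" using cs(1) us(1) p(1,2) by auto
  moreover have "map length (us @ a # b # vs) = ds" using us ds p(3,4) by simp
  ultimately show ?case by blast
qed

text \<open>Equal lengths allow a first splice at the same place on both sides. Uniqueness of the
  outcome keeps \<open>g\<close> reachable after it, induction identifies the results, and the
  inverse splice leads back to the original columns.\<close>

lemma splice_cancel:
  assumes "0 < n" "partition_shaped g"
    and "cols_ok n cs" "cols_ok n cs'" "map length cs = map length cs'"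
    and "splice_step\<^sup>*\<^sup>* cs g" "splice_step\<^sup>*\<^sup>* cs' g"
  shows "cs = cs'"
  using assms(3-)
proof (induction "len_inversions (map length cs)" arbitrary: cs cs')
  case 0
  have "partition_shaped cs" "partition_shaped cs'"
    using 0 by (simp_all add: partition_shaped_iff)
  then show ?case
    using splice_normal_form_unique[OF assms(1) 0(2) rtranclp.rtrancl_refl _ 0(5) assms(2)]
      splice_normal_form_unique[OF assms(1) 0(3) rtranclp.rtrancl_refl _ 0(6) assms(2)] by simp
next
  case (Suc k)
  then have "len_inversions (map length cs) \<noteq> 0" by simp
  then obtain xs x y ys where ds: "map length cs = xs @ x # y # ys" "x < y" by (rule len_inversions_pos_split)
  obtain us s t vs where us: "cs = us @ s # t # vs" "map length us = xs" "length s = x"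
    "length t = y" "map length vs = ys"
    using ds(1) by (auto simp: map_eq_append_conv map_eq_Cons_conv)
  have "map length cs' = xs @ x # y # ys" using ds Suc.prems(3) by simp
  then obtain us' s' t' vs' where us': "cs' = us' @ s' # t' # vs'" "map length us' = xs" "length s' = x"
    "length t' = y" "map length vs' = ys"
    by (auto simp: map_eq_append_conv map_eq_Cons_conv)
  obtain a b where ab: "col_splice s t = (a, b)" by (meson surj_pair)
  obtain a' b' where ab': "col_splice s' t' = (a', b')" by (meson surj_pair)
  have l: "length s < length t" "length s' < length t'" using us us' ds by auto
  have ok: "col_ok n s" "col_ok n t" "col_ok n s'" "col_ok n t'" using Suc.prems(1,2) us us' by auto
  note p = col_splice_props[OF l(1) ok(1,2) assms(1) ab]
  note p' = col_splice_props[OF l(2) ok(3,4) assms(1) ab']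
  let ?d = "us @ a # b # vs" and ?d' = "us' @ a' # b' # vs'"
  have st: "splice_step cs ?d" "splice_step cs' ?d'"
    unfolding us(1) us'(1) by (intro splice_stepI l ab ab')+
  have reach: "splice_step\<^sup>*\<^sup>* d g" if c: "splice_step c d" "cols_ok n c" "splice_step\<^sup>*\<^sup>* c g" for c d
  proof -
    obtain f where f: "splice_step\<^sup>*\<^sup>* d f" "partition_shaped f"
      using splice_normal_form[OF assms(1) splice_step_ok[OF c(1) assms(1) c(2)]] by blast
    then have "f = g"
      using splice_normal_form_unique[OF assms(1) c(2) _ f(2) c(3) assms(2)] c(1)
      by (blast intro: converse_rtranclp_into_rtranclp)
    then show ?thesis using f by simp
  qed
  have "?d = ?d'"
  proof (rule Suc.hyps(1))
    show "k = len_inversions (map length ?d)"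
      using splice_step_len_inversions[OF st(1) assms(1) Suc.prems(1)] Suc.hyps(2) by simp
    show "map length ?d = map length ?d'" using us us' p(3,4) p'(3,4) by simp
    show "cols_ok n ?d" "cols_ok n ?d'"
      by (rule splice_step_ok[OF st(1) assms(1) Suc.prems(1)] splice_step_ok[OF st(2) assms(1) Suc.prems(2)])+
    show "splice_step\<^sup>*\<^sup>* ?d g" "splice_step\<^sup>*\<^sup>* ?d' g"
      using reach[OF st(1) Suc.prems(1,4)] reach[OF st(2) Suc.prems(2,5)] by auto
  qed
  moreover have "length us = length us'"
    using us(2) us'(2) by (metis length_map)
  ultimately have "us = us'" "a = a'" "b = b'" "vs = vs'" by auto
  moreover have "s = s'" "t = t'"
    using p(8) p'(8) \<open>a = a'\<close> \<open>b = b'\<close> by auto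
  ultimately show ?case using us us' by simp
qed

text \<open>
  The offset \<open>e = 0\<close> gives the contribution of a pair of columns to \<open>inv\<close>, and \<open>e = 1\<close> that to \<open>quinv\<close>.
\<close>

definition col_stat :: "nat \<Rightarrow> nat \<Rightarrow> nat list \<Rightarrow> nat list \<Rightarrow> nat" where
  "col_stat e n a b = (\<Sum>i=1..n. of_bool (padded n a (i - 1 + e) < padded n b i \<and> padded n b i < padded n a (i + e)))"

text \<open>Towards a column on the right, each row counts the intervals between consecutive entries
  of \<open>a\<close> and \<open>b\<close> around an entry; exchanging tails matters only for the
  intervals across the cut. Towards a column on the left, each row only permutes its entries. Within
  the pair, offset 0 counts row \<open>m\<close> before the splice but not after it, and no row
  further down. Offset 1 never counts a row from \<open>m\<close> on, and in row
  \<open>m - 1\<close> the upper bound holds before and after.\<close>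

lemma col_stat_splice:
  assumes "length a < length b" "col_ok n a" "col_ok n b" "0 < n" "col_splice a b = (a', b')"
  shows col_stat_splice_left: "col_stat e n a c + col_stat e n b c = col_stat e n a' c + col_stat e n b' c"
    and col_stat_splice_right: "col_stat e n c a + col_stat e n c b = col_stat e n c a' + col_stat e n c b'"
    and col_stat_splice_inv: "col_stat 0 n a b = Suc (col_stat 0 n a' b')"
    and col_stat_splice_quinv: "col_stat (Suc 0) n a b = col_stat (Suc 0) n a' b'"
proof -
  obtain m where m: "1 \<le> m" "m \<le> length a + 1" "padded n a (m - 1) < padded n b m"
    "\<And>i. m \<le> i \<Longrightarrow> padded n b (Suc i) \<le> padded n a i"
    "\<And>i. padded n a' i = (if i < m then padded n a i else padded n b i)"
    "\<And>i. padded n b' i = (if i < m then padded n b i else padded n a i)"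
    by (rule col_spliceE[OF assms]) (rule that)
  note A = padded_mono[OF assms(2,4)] and B = padded_mono[OF assms(3,4)]
  note B' = padded_strict[OF assms(3,4)]
  \<comment> \<open>Across the cut every lower end lies below every upper end. The number of
    intervals around \<open>x\<close> is therefore the number of lower ends below \<open>x\<close>
    minus the number of upper ends at most \<open>x\<close>, which an exchange of the upper ends
    does not change.\<close>
  have mid: "padded n a k < padded n a m" "padded n a k < padded n b m" "padded n b k < padded n a m" "padded n b k < padded n b m"
    if "Suc k = m" for k
    using that m(2,3) m(4)[of m] padded_strict[OF assms(2,4), of k m] B'[of k m] B[of m "Suc m"] assms(1)
    by auto
  have t: "of_bool (padded n a k < x \<and> x < padded n a (Suc k)) + of_bool (padded n b k < x \<and> x < padded n b (Suc k)) =
      of_bool (padded n a' k < x \<and> x < padded n a' (Suc k)) + (of_bool (padded n b' k < x \<and> x < padded n b' (Suc k)) :: nat)"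
    for x k
  proof -
    consider "Suc k < m" | "Suc k = m" | "m \<le> k" by linarith
    then show ?thesis
    proof cases
      case 2
      then show ?thesis using mid[OF 2] by (auto simp: m(5,6))
    qed (auto simp: m(5,6))
  qed
  show "col_stat e n a c + col_stat e n b c = col_stat e n a' c + col_stat e n b' c"
    unfolding col_stat_def sum.distrib[symmetric]
  proof (rule sum.cong[OF refl])
    fix i assume "i \<in> {1..n}"
    then have e: "i + e = Suc (i - 1 + e)" by simp
    show "of_bool (padded n a (i - 1 + e) < padded n c i \<and> padded n c i < padded n a (i + e)) +
         of_bool (padded n b (i - 1 + e) < padded n c i \<and> padded n c i < padded n b (i + e)) =
         of_bool (padded n a' (i - 1 + e) < padded n c i \<and> padded n c i < padded n a' (i + e)) +
         (of_bool (padded n b' (i - 1 + e) < padded n c i \<and> padded n c i < padded n b' (i + e)) :: nat)"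
      unfolding e by (rule t)
  qed
  show "col_stat e n c a + col_stat e n c b = col_stat e n c a' + col_stat e n c b'"
    unfolding col_stat_def sum.distrib[symmetric] by (rule sum.cong[OF refl]) (simp add: m(5,6))
  show "col_stat 0 n a b = Suc (col_stat 0 n a' b')"
  proof -
    have "m \<in> {1..n}" using m(1,2) assms(1) length_col[OF assms(3,4)] by simp
    then have "(\<Sum>i=1..n. of_bool (i = m)) = (1::nat)" by (simp add: of_bool_def)
    moreover have "of_bool (padded n a (i - 1) < padded n b i \<and> padded n b i < padded n a i) =
        of_bool (padded n a' (i - 1) < padded n b' i \<and> padded n b' i < padded n a' i) + (of_bool (i = m) :: nat)"
      if "i \<in> {1..n}" for i
    proof -
      consider "i < m" | "i = m" | "m < i" by linarith
      then show ?thesis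
      proof cases
        case 2
        have "padded n b m < padded n a m" 
          using B'[of m "Suc m"] m(2) m(4)[of m] assms(1) by simp
        then show ?thesis using 2 m(1,3) by (simp add: m(5,6))
      next
        case 3
        then have "padded n b i \<le> padded n a (i - 1)" "padded n b i \<le> padded n a i"
          using m(4)[of "i - 1"] m(4)[of i] B[of i "Suc i"] by auto
        then show ?thesis using 3 by (auto simp: m(5,6))
      qed (use that in \<open>auto simp: m(5,6)\<close>)
    qed
    ultimately show ?thesis by (simp add: col_stat_def sum.distrib)
  qed
  show "col_stat (Suc 0) n a b = col_stat (Suc 0) n a' b'"
    unfolding col_stat_def
  proof (rule sum.cong[OF refl])
    fix i assume i: "i \<in> {1..n}"
    then have e: "i - 1 + Suc 0 = i" "i + Suc 0 = Suc i" by auto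
    consider "Suc i < m" | "Suc i = m" | "m \<le> i" by linarith
    then have "of_bool (padded n a i < padded n b i \<and> padded n b i < padded n a (Suc i)) =
        (of_bool (padded n a' i < padded n b' i \<and> padded n b' i < padded n a' (Suc i)) :: nat)"
    proof cases
      case 2
      have "padded n b i < padded n b m" using B'[of i m] 2 m(2) assms(1) by simp
      moreover have "padded n b m \<le> padded n a m" using m(4)[of m] B[of m "Suc m"] by simp
      ultimately show ?thesis using 2 by (auto simp: m(5,6))
    next
      case 3
      then have "padded n b i \<le> padded n a i" "padded n b (Suc i) \<le> padded n a i"
        using m(4)[of i] B[of i "Suc i"] by auto
      then show ?thesis using 3 by (auto simp: m(5,6))
    qed (auto simp: m(5,6))
    then show "of_bool (padded n a (i - 1 + Suc 0) < padded n b i \<and> padded n b i < padded n a (i + Suc 0)) =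
       (of_bool (padded n a' (i - 1 + Suc 0) < padded n b' i \<and> padded n b' i < padded n a' (i + Suc 0)) :: nat)"
      unfolding e .
  qed
qed

lemma splice_step_invariants:
  assumes "splice_step cs cs'" "0 < n" "cols_ok n cs"
  shows "pair_sum (col_stat 0 n) cs = Suc (pair_sum (col_stat 0 n) cs')"
    and "pair_sum (col_stat (Suc 0) n) cs = pair_sum (col_stat (Suc 0) n) cs'"
    and "image_mset (\<lambda>a. padded n a i) (mset cs) = image_mset (\<lambda>a. padded n a i) (mset cs')"
proof -
  obtain xs a b ys a' b' where *: "cs = xs @ a # b # ys" "length a < length b"
     "col_splice a b = (a', b')" "cs' = xs @ a' # b' # ys"
    using assms(1) unfolding splice_step_iff by blast
  have ok: "col_ok n a" "col_ok n b" using assms(3) * by auto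
  note p = col_stat_splice[OF *(2) ok assms(2) *(3)]
  show "pair_sum (col_stat 0 n) cs = Suc (pair_sum (col_stat 0 n) cs')"
    using pair_sum_replace2[of "col_stat 0 n", OF p(1,2), of xs ys] p(3) * by simp
  show "pair_sum (col_stat (Suc 0) n) cs = pair_sum (col_stat (Suc 0) n) cs'"
    using pair_sum_replace2[of "col_stat (Suc 0) n", OF p(1,2), of xs ys] p(4) * by simp
  show "image_mset (\<lambda>a. padded n a i) (mset cs) = image_mset (\<lambda>a. padded n a i) (mset cs')"
    using col_splice_row[OF *(2) ok assms(2) *(3), of i] * by auto
qed

text \<open>The sum for offset 0 and the number of ascending pairs drop together; the crosswise form
  states that their difference is constant.\<close>

lemma splice_steps_invariants:
  assumes "splice_step\<^sup>*\<^sup>* cs cs'" "0 < n" "cols_ok n cs"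
  shows "pair_sum (col_stat 0 n) cs + len_inversions (map length cs') = pair_sum (col_stat 0 n) cs' + len_inversions (map length cs)"
    and "pair_sum (col_stat (Suc 0) n) cs = pair_sum (col_stat (Suc 0) n) cs'"
    and "image_mset (\<lambda>a. padded n a i) (mset cs) = image_mset (\<lambda>a. padded n a i) (mset cs')"
  using assms(1)
proof (induction rule: rtranclp_induct)
  case (step y z)
  note ok = splice_steps_ok[OF step(1) assms(2,3)]
  case 1 show ?case
    using step(3) splice_step_invariants(1)[OF step(2) assms(2) ok] splice_step_len_inversions[OF step(2) assms(2) ok] by simp
  case 2 show ?case
    using step(4) splice_step_invariants(2)[OF step(2) assms(2) ok] by simp
  case 3 show ?case
    using step(5) splice_step_invariants(3)[OF step(2) assms(2) ok] by simp
qed auto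

section \<open>Partitions in a box as binary words\<close>

text \<open>
  A binary word is a lattice path; the parts count, for each \<open>True\<close>, the later occurrences of \<open>False\<close>.
\<close>

fun word_partition :: "bool list \<Rightarrow> nat list" where
  "word_partition [] = []"
| "word_partition (False # w) = word_partition w"
| "word_partition (True # w) = (if count_list w False = 0 then [] else count_list w False # word_partition w)"

lemma word_partition_le: "a \<in> set (word_partition w) \<Longrightarrow> 0 < a \<and> a \<le> count_list w False"
  by (induction w rule: word_partition.induct) (auto split: if_splits)

lemma word_partition_sorted: "sorted_wrt (\<ge>) (word_partition w)"
  by (induction w rule: word_partition.induct) (auto dest: word_partition_le)

lemma word_partition_length: "length (word_partition w) \<le> count_list w True"
  by (induction w rule: word_partition.induct) auto

lemma word_partition_box: "word_partition w \<in> box_partitions (int (count_list w True)) (int (count_list w False))"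
  using word_partition_le[of _ w] word_partition_sorted[of w] word_partition_length[of w] by (auto simp: box_partitions_def)

lemma word_partition_no_False: "count_list w False = 0 \<Longrightarrow> word_partition w = []"
  by (induction w rule: word_partition.induct) auto

text \<open>The letter counts belong to the data, since dropped zero parts leave the box
  undetermined. If the first letters differed, the word that starts with \<open>False\<close> would
  have a part larger than the number of its remaining \<open>False\<close>.\<close>

lemma word_partition_inj:
  "count_list w True = count_list w' True \<Longrightarrow> count_list w False = count_list w' False \<Longrightarrow>
   word_partition w = word_partition w' \<Longrightarrow> w = w'"
proof (induction w arbitrary: w')
  case Nil
  then show ?case by (cases w') (auto split: if_splits)
next
  case (Cons x w)
  have "w' \<noteq> []" using Cons.prems by (cases x) auto
  then obtain y v where w': "w' = y # v" by (cases w') auto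
  have "x = y"
  proof (rule ccontr)
    assume "x \<noteq> y"
    then consider "x" "\<not> y" | "\<not> x" "y" by blast
    then show False
    proof cases
      case 1
      then have "count_list w False = Suc (count_list v False)" "word_partition (True # w) = word_partition v"
        using Cons.prems w' by auto
      moreover from this have "count_list w False \<in> set (word_partition v)" by (metis list.set_intros(1) nat.distinct(1) word_partition.simps(3))
      ultimately show False using word_partition_le[of "count_list w False" v] by simp
    next
      case 2
      then have "count_list v False = Suc (count_list w False)" "word_partition (True # v) = word_partition w"
        using Cons.prems w' by auto
      moreover from this have "count_list v False \<in> set (word_partition w)" by (metis list.set_intros(1) nat.distinct(1) word_partition.simps(3))
      ultimately show False using word_partition_le[of "count_list v False" w] by simp
    qed
  qed
  moreover have "word_partition w = word_partition v"
    using Cons.prems w' \<open>x = y\<close> word_partition_no_False[of w] word_partition_no_False[of v] by (cases x) (auto split: if_splits)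
  ultimately show ?case using Cons.IH[of v] Cons.prems w' by (cases x) auto
qed

text \<open>The largest part decides the first letter: \<open>True\<close> if it fills the width
  \<open>m\<close>, and \<open>False\<close> if all parts fit into width \<open>m - 1\<close>. In a
  box of width zero only \<open>True\<close> remains.\<close>

lemma word_partition_surj:
  assumes "p \<in> box_partitions (int k) (int m)"
  shows "\<exists>w. count_list w True = k \<and> count_list w False = m \<and> word_partition w = p"
  using assms
proof (induction "k + m" arbitrary: k m p)
  case 0
  then show ?case by (intro exI[of _ "[]"]) (auto simp: box_partitions_def)
next
  case (Suc s)
  have p: "sorted_wrt (\<ge>) p" "0 \<notin> set p" "length p \<le> k" "\<And>a. a \<in> set p \<Longrightarrow> a \<le> m"
    using Suc.prems by (auto simp: box_partitions_def)
  consider "m = 0" | m' where "m = Suc m'" "\<forall>a\<in>set p. a \<le> m'" 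
    | m' q where "m = Suc m'" "p = m # q"
  proof (cases m)
    case (Suc m')
    show ?thesis
    proof (cases p)
      case (Cons a q)
      then show ?thesis using that(2,3)[OF Suc] p(1) p(4)[of a] Suc
        by (cases "a = m") fastforce+
    qed (use that(2)[OF Suc] in simp)
  qed (use that(1) in simp)
  then show ?case
  proof cases
    case 1
    then have "p = []" using p(2,4) by (cases p) auto
    moreover have "count_list (replicate k True) True = k" "count_list (replicate k True) False = 0"
      by (induction k) auto
    ultimately show ?thesis using 1 word_partition_no_False by (intro exI[of _ "replicate k True"]) simp
  next
    case 2
    have "\<exists>w. count_list w True = k \<and> count_list w False = m' \<and> word_partition w = p"
      by (rule Suc.hyps(1)) (use Suc.hyps(2) 2 p in \<open>auto simp: box_partitions_def\<close>)
    then obtain w where "count_list w True = k" "count_list w False = m'" "word_partition w = p" by blast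
    then show ?thesis using 2 by (intro exI[of _ "False # w"]) simp
  next
    case 3
    then obtain k' where k: "k = Suc k'" using p(3) by (cases k) auto
    have "\<exists>w. count_list w True = k' \<and> count_list w False = m \<and> word_partition w = q"
      by (rule Suc.hyps(1)) (use Suc.hyps(2) 3(2) p k in \<open>auto simp: box_partitions_def\<close>)
    then obtain w where "count_list w True = k'" "count_list w False = m" "word_partition w = q" by blast
    then show ?thesis using 3 k by (intro exI[of _ "True # w"]) simp
  qed
qed

lemma sum_list_of_bool_count: "(\<Sum>y\<leftarrow>w. of_bool (\<not> y)) = count_list w False" 
  "(\<Sum>y\<leftarrow>w. of_bool y) = count_list w True"
  by (induction w) auto

lemma word_partition_sum: "sum_list (word_partition w) = pair_sum (\<lambda>x y. of_bool (x \<and> \<not> y)) w"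
proof (induction w)
  case (Cons x w)
  then show ?case
    using word_partition_no_False[of w] by (cases x; cases "count_list w False = 0") (simp_all add: sum_list_of_bool_count)
qed simp

text \<open>A \<open>True\<close> and a \<open>False\<close> stand in exactly one of the two orders,
  so the two counts together fill the box. This is how \<open>quinv\<close> meets the box
  complement.\<close>

lemma pair_sum_True_False:
  "pair_sum (\<lambda>x y. of_bool (x \<and> \<not> y)) w + pair_sum (\<lambda>x y. of_bool (\<not> x \<and> y)) w =
   count_list w True * count_list w False"
  by (induction w) (auto simp: sum_list_of_bool_count)

text \<open>In a weakly decreasing list all zeros are at the end. This mediates between partitions
  without zero parts and the lists of fixed length on which the complement acts.\<close>

lemma filter_pos_append_replicate:
  "sorted_wrt (\<ge>) (xs :: nat list) \<Longrightarrow>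
   filter (\<lambda>a. 0 < a) xs @ replicate (length xs - length (filter (\<lambda>a. 0 < a) xs)) 0 = xs"
proof (induction xs)
  case (Cons x xs)
  show ?case
  proof (cases "x = 0")
    case True
    then have "\<forall>y\<in>set xs. y = 0" using Cons.prems by auto
    then have "filter (\<lambda>a. 0 < a) xs = []" "xs = replicate (length xs) 0"
      by (auto simp: filter_empty_conv intro: replicate_eqI)
    then show ?thesis using True by (metis append_Nil diff_zero filter.simps(2) length_Cons less_irrefl list.size(3) replicate_Suc)
  qed (use Cons in auto)
qed simp

lemma partition_compl:
  assumes "p \<in> box_partitions (int k) (int m)"
  shows partition_compl_box: "partition_compl k m p \<in> box_partitions (int k) (int m)"
    and partition_compl_invol: "partition_compl k m (partition_compl k m p) = p"
    and partition_compl_sum: "sum_list (partition_compl k m p) + sum_list p = k * m"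
proof -
  \<comment> \<open>\<open>P\<close> and \<open>Q\<close> are the partition and its complement with
    all \<open>k\<close> parts, zeros included. On such lists the complement is a reversal combined
    with \<open>m - a\<close> for each part \<open>a\<close>, an involution because no part exceeds
    \<open>m\<close>.\<close>
  define P where "P = p @ replicate (k - length p) 0"
  define Q where "Q = map (\<lambda>a. m - a) (rev P)"
  have p: "sorted_wrt (\<ge>) p" "0 \<notin> set p" "length p \<le> k" "\<And>a. a \<in> set p \<Longrightarrow> a \<le> m"
    using assms by (auto simp: box_partitions_def)
  have sr: "sorted_wrt (\<ge>) (replicate j (0::nat))" for j
    by (induction j) auto
  have P: "length P = k" "\<And>a. a \<in> set P \<Longrightarrow> a \<le> m" "sorted_wrt (\<ge>) P"
    using p sr by (auto simp: P_def sorted_wrt_append)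
  have Q: "length Q = k" "\<And>a. a \<in> set Q \<Longrightarrow> a \<le> m" "sorted_wrt (\<ge>) Q"
    using P by (auto simp: Q_def sorted_wrt_map sorted_wrt_rev intro: sorted_wrt_mono_rel[of _ "(\<ge>)"])
  have c: "partition_compl k m p = filter (\<lambda>a. 0 < a) Q"
    by (simp add: partition_compl_def Q_def P_def)
  show "partition_compl k m p \<in> box_partitions (int k) (int m)"
    using Q by (auto simp: c box_partitions_def sorted_wrt_filter intro: le_trans[OF length_filter_le])
  have "filter (\<lambda>a. 0 < a) Q @ replicate (k - length (filter (\<lambda>a. 0 < a) Q)) 0 = Q"
    using filter_pos_append_replicate[OF Q(3)] Q(1) by simp
  then have "partition_compl k m (partition_compl k m p) = filter (\<lambda>a. 0 < a) (map (\<lambda>a. m - a) (rev Q))"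
    unfolding c by (simp add: partition_compl_def)
  also have "map (\<lambda>a. m - a) (rev Q) = map (\<lambda>a. m - (m - a)) P"
    by (simp add: Q_def rev_map comp_def)
  also have "\<dots> = P" using P(2) by (intro map_idI) simp
  also have "filter (\<lambda>a. 0 < a) P = p"
    using p(2) by (auto simp: P_def filter_id_conv) (metis gr0I)
  finally show "partition_compl k m (partition_compl k m p) = p" .
  have f: "sum_list (filter (\<lambda>a. 0 < a) xs) = sum_list (xs :: nat list)" for xs
    by (induction xs) auto
  have "sum_list (map (\<lambda>a. m - a) xs) + sum_list xs = length xs * m" if "\<And>a. a \<in> set xs \<Longrightarrow> a \<le> m" for xs :: "nat list"
    using that by (induction xs) force+
  from this[of P] P(1,2) have "sum_list Q + sum_list P = k * m"
    by (simp add: Q_def rev_map[symmetric])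
  then show "sum_list (partition_compl k m p) + sum_list p = k * m"
    by (simp add: c f P_def sum_list_replicate)
qed

section \<open>Fillings and their columns\<close>

text \<open>Zero outside the list, so that \<open>part l (Suc i)\<close> delimits the columns of
  length \<open>i\<close> also when \<open>i\<close> is the last row.\<close>

definition part :: "nat list \<Rightarrow> nat \<Rightarrow> nat" where
  "part l r = (if 1 \<le> r \<and> r \<le> length l then l ! (r - 1) else 0)"

lemma dg_iff: "(r, c) \<in> dg l \<longleftrightarrow> 1 \<le> r \<and> 1 \<le> c \<and> c \<le> part l r"
  by (auto simp: dg_def part_def)

lemma part_antimono: "is_partition n l \<Longrightarrow> 1 \<le> r \<Longrightarrow> r \<le> r' \<Longrightarrow> part l r' \<le> part l r"
  by (cases "r = r'") (auto simp: part_def is_partition_def sorted_wrt_iff_nth_less)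

lemma part_beyond: "is_partition n l \<Longrightarrow> n < r \<Longrightarrow> part l r = 0"
  by (auto simp: part_def is_partition_def)

lemma dg_bound: "is_partition n l \<Longrightarrow> (r, c) \<in> dg l \<Longrightarrow> 1 \<le> r \<and> r \<le> n \<and> 1 \<le> c \<and> c \<le> part l 1"
  using part_antimono[of n l 1 r] by (auto simp: dg_iff part_def is_partition_def split: if_splits)

lemma finite_dg: "finite (dg l)"
proof -
  have "dg l = (\<Union>r\<in>{1..length l}. {r} \<times> {1..l ! (r - 1)})" by (auto simp: dg_def)
  then show ?thesis by simp
qed

lemma down_closed_interval:
  fixes S :: "nat set"
  assumes "finite S" "0 \<notin> S" "\<And>r r'. r \<in> S \<Longrightarrow> 1 \<le> r' \<Longrightarrow> r' \<le> r \<Longrightarrow> r' \<in> S"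
  shows "S = {1..card S}"
proof -
  let ?k = "Max (insert 0 S)"
  have "S = {1..?k}"
  proof (intro equalityI subsetI)
    fix r assume "r \<in> S"
    then show "r \<in> {1..?k}" using assms(1,2) by (auto simp: Suc_le_eq intro!: Nat.gr0I Max_ge)
  next
    fix r assume r: "r \<in> {1..?k}"
    then have "?k \<in> S" using Max_in[of "insert 0 S"] assms(1) by auto
    then show "r \<in> S" using assms(3) r by auto
  qed
  then have "card S = ?k" by (metis card_atLeastAtMost diff_Suc_1)
  then show ?thesis using \<open>S = {1..?k}\<close> by simp
qed

text \<open>The conjugate partition.\<close>

definition col_len :: "nat list \<Rightarrow> nat \<Rightarrow> nat" where
  "col_len l c = card {r. (r, c) \<in> dg l}"

lemma dg_col_len_iff:
  assumes "is_partition n l" "1 \<le> c"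
  shows "(r, c) \<in> dg l \<longleftrightarrow> 1 \<le> r \<and> r \<le> col_len l c"
proof -
  have "finite {r. (r, c) \<in> dg l}"
    by (rule finite_subset[of _ "{1..n}"]) (auto dest: dg_bound[OF assms(1)])
  then have "{r. (r, c) \<in> dg l} = {1..col_len l c}"
    unfolding col_len_def
  proof (rule down_closed_interval)
    fix r r' assume "r \<in> {r. (r, c) \<in> dg l}" "1 \<le> r'" "r' \<le> r"
    then show "r' \<in> {r. (r, c) \<in> dg l}"
      using part_antimono[OF assms(1), of r' r] by (simp add: dg_iff)
  qed (simp add: dg_iff)
  then show ?thesis by (simp add: set_eq_iff)
qed

lemma col_len_le: 
  assumes "is_partition n l" "1 \<le> c" 
  shows "col_len l c \<le> n"
proof (cases "col_len l c = 0")
  case False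
  then have "(col_len l c, c) \<in> dg l" by (simp add: dg_col_len_iff[OF assms])
  then show ?thesis using dg_bound[OF assms(1)] by blast
qed simp

lemma col_len_antimono:
  assumes "is_partition n l" "1 \<le> c" "c \<le> c'"
  shows "col_len l c' \<le> col_len l c"
  using assms dg_col_len_iff[OF assms(1,2), of "col_len l c'"] dg_col_len_iff[OF assms(1), of c' "col_len l c'"]
  by (cases "col_len l c' = 0") (auto simp: dg_iff)

definition column :: "nat list \<Rightarrow> filling \<Rightarrow> nat \<Rightarrow> nat list" where
  "column l F c = map (\<lambda>r. F (r, c)) [1..<Suc (col_len l c)]"

text \<open>
  The number \<open>M\<close> may exceed the number of columns; the additional columns are empty.
\<close>

definition first_columns :: "nat \<Rightarrow> nat list \<Rightarrow> filling \<Rightarrow> nat list list" where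
  "first_columns M l F = map (column l F) [1..<Suc M]"

lemma length_column [simp]: "length (column l F c) = col_len l c"
  by (simp add: column_def)

lemma length_cols [simp]: "length (first_columns M l F) = M"
  by (simp add: first_columns_def)

lemma padded_column:
  assumes "is_partition n l" "1 \<le> c"
  shows "padded N (column l F c) r = (if r = 0 then 0 else if (r, c) \<in> dg l then F (r, c) else N)"
  using dg_col_len_iff[OF assms, of r] by (auto simp: padded_def column_def nth_append simp del: upt_Suc)

lemma columns_eq: "columns l F = first_columns (part l 1) l F"
proof -
  have "{c. (1, c) \<in> dg l} = {1..part l 1}" by (auto simp: dg_iff)
  then show ?thesis by (simp add: columns_def first_columns_def column_def[abs_def] col_len_def)
qed

lemma CSF_range: "F \<in> CSF n l \<Longrightarrow> u \<in> dg l \<Longrightarrow> 1 \<le> F u \<and> F u \<le> n"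
  by (auto simp: CSF_def PiE_iff)

lemma CSF_strict: "F \<in> CSF n l \<Longrightarrow> (r, c) \<in> dg l \<Longrightarrow> (r', c) \<in> dg l \<Longrightarrow> r < r' \<Longrightarrow> F (r, c) < F (r', c)"
  by (auto simp: CSF_def)

lemma col_ok_column:
  assumes "is_partition n l" "F \<in> CSF n l" "1 \<le> c"
  shows "col_ok (Suc n) (column l F c)"
proof (rule col_ok_padded)
  fix i assume i: "1 \<le> i" "i \<le> length (column l F c)"
  then have d: "(i, c) \<in> dg l" using dg_col_len_iff[OF assms(1,3)] by simp
  show "0 < padded (Suc n) (column l F c) i \<and> padded (Suc n) (column l F c) i < Suc n"
    using d i CSF_range[OF assms(2) d] by (auto simp: padded_column[OF assms(1,3)])
  show "padded (Suc n) (column l F c) i < padded (Suc n) (column l F c) (Suc i)"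
    using d i CSF_range[OF assms(2) d] CSF_strict[OF assms(2) d, of "Suc i"] by (auto simp: padded_column[OF assms(1,3)])
qed

lemma cols_ok_cols: "is_partition n l \<Longrightarrow> F \<in> CSF n l \<Longrightarrow> cols_ok (Suc n) (first_columns M l F)"
  by (auto simp: first_columns_def intro: col_ok_column)

lemma cols_sorted: "is_partition n l \<Longrightarrow> sorted_wrt (\<lambda>a b. length b \<le> length a) (first_columns M l F)"
  unfolding sorted_wrt_iff_nth_less
  by (auto simp: first_columns_def nth_append simp del: upt_Suc intro!: col_len_antimono)

lemma CSF_eqI:
  assumes "is_partition n l" "F \<in> CSF n l" "F' \<in> CSF n l" "part l 1 \<le> M" "first_columns M l F = first_columns M l F'"
  shows "F = F'"
proof (rule extensionalityI)
  show "F \<in> extensional (dg l)" "F' \<in> extensional (dg l)" using assms(2,3) by (auto simp: CSF_def PiE_iff)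
  fix u assume u: "u \<in> dg l"
  then obtain r c where rc: "u = (r, c)" "1 \<le> r" "1 \<le> c" "c \<le> M" 
    using dg_bound[OF assms(1)] assms(4) by (cases u) fastforce
  have "column l F c = column l F' c"
    using assms(5) rc by (auto simp: first_columns_def simp del: upt_Suc)
  then show "F u = F' u"
    using padded_column[OF assms(1) rc(3), of 0 F r] padded_column[OF assms(1) rc(3), of 0 F' r] u rc by simp
qed

text \<open>The padding \<open>N\<close> exceeds \<open>j\<close>, so neither the rows below the end
  of a column nor the empty columns up to \<open>M\<close> are counted. Pattern entries thus become
  row invariants of a list of columns.\<close>

lemma row_count:
  assumes "is_partition n l" "part l 1 \<le> M" "1 \<le> i" "j < N"
  shows "card {c. (i, c) \<in> dg l \<and> F (i, c) \<le> j} = length (filter (\<lambda>a. padded N a i \<le> j) (first_columns M l F))"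
proof -
  have "length (filter (\<lambda>a. padded N a i \<le> j) (first_columns M l F)) = 
      length (filter (\<lambda>c. padded N (column l F c) i \<le> j) [1..<Suc M])"
    by (simp add: first_columns_def filter_map comp_def del: upt_Suc)
  also have "\<dots> = card (set (filter (\<lambda>c. padded N (column l F c) i \<le> j) [1..<Suc M]))"
    by (rule distinct_card[symmetric]) (simp del: upt_Suc)
  also have "set (filter (\<lambda>c. padded N (column l F c) i \<le> j) [1..<Suc M]) = {c. (i, c) \<in> dg l \<and> F (i, c) \<le> j}"
  proof (rule set_eqI)
    fix c
    show "c \<in> set (filter (\<lambda>c. padded N (column l F c) i \<le> j) [1..<Suc M]) \<longleftrightarrow> c \<in> {c. (i, c) \<in> dg l \<and> F (i, c) \<le> j}"
      using assms(2-) dg_bound[OF assms(1), of i c] 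
      by (cases "1 \<le> c") (auto simp: padded_column[OF assms(1)] simp del: upt_Suc split: if_splits)
  qed
  finally show ?thesis by simp
qed

lemma shape_part:
  assumes "1 \<le> r" "r \<le> n"
  shows "part (shape_of_columns n g) r = card {c. c < length g \<and> r \<le> length (g ! c)}"
  using assms by (cases r) (simp_all add: part_def shape_of_columns_def del: upt_Suc)

lemma shape_partition: "is_partition n (shape_of_columns n g)"
  unfolding is_partition_def sorted_wrt_iff_nth_less
  by (auto simp: shape_of_columns_def nth_append simp del: upt_Suc intro!: card_mono)

lemma shape_dg_iff:
  assumes "partition_shaped g" "\<And>a. a \<in> set g \<Longrightarrow> length a \<le> n"
  shows "(r, c) \<in> dg (shape_of_columns n g) \<longleftrightarrow> 1 \<le> r \<and> 1 \<le> c \<and> c \<le> length g \<and> r \<le> length (g ! (c - 1))"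
proof (cases "1 \<le> r \<and> r \<le> n")
  case True
  let ?S = "{c. 1 \<le> c \<and> c \<le> length g \<and> r \<le> length (g ! (c - 1))}"
  have mono: "length (g ! c') \<le> length (g ! c)" if "c \<le> c'" "c' < length g" for c c'
    using assms(1) that unfolding partition_shaped_def sorted_wrt_iff_nth_less by (cases "c = c'") auto
  have "?S = {1..card ?S}"
  proof (rule down_closed_interval)
    show "finite ?S" by (rule finite_subset[of _ "{1..length g}"]) auto
    fix c c' assume "c \<in> ?S" "1 \<le> c'" "c' \<le> c"
    then show "c' \<in> ?S" using mono[of "c' - 1" "c - 1"] by (auto simp: le_diff_conv intro: le_trans)
  qed simp
  moreover have "card ?S = card {c. c < length g \<and> r \<le> length (g ! c)}"
    by (rule card_bij_eq[of "\<lambda>c. c - 1" _ _ Suc]) (auto simp: inj_on_def)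
  ultimately have "?S = {1..part (shape_of_columns n g) r}" using shape_part True by simp
  then show ?thesis using True unfolding dg_iff by (auto simp: set_eq_iff)
next
  case False
  then show ?thesis
    using dg_bound[OF shape_partition, of r c n g] assms(2)[of "g ! (c - 1)"] by auto
qed

text \<open>The list may end in empty columns, which the shape forgets; taking exactly
  \<open>length g\<close> columns restores them.\<close>

lemma filling_of_columns:
  assumes "partition_shaped g" "cols_ok (Suc m) g"
  shows filling_of_columns_CSF: "filling_of_columns m g \<in> CSF m (shape_of_columns m g)"
    and shape_part1_le: "part (shape_of_columns m g) 1 \<le> length g"
    and cols_filling_of_columns: "first_columns (length g) (shape_of_columns m g) (filling_of_columns m g) = g"
proof -
  let ?l = "shape_of_columns m g" and ?F = "filling_of_columns m g"
  have len: "length a \<le> m" if "a \<in> set g" for a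
    using length_col[of "Suc m" a] assms(2) that by auto
  note d = shape_dg_iff[OF assms(1) len]
  have F: "?F (r, c) = padded (Suc m) (g ! (c - 1)) r" "g ! (c - 1) \<in> set g" if "(r, c) \<in> dg ?l" for r c
    using that by (auto simp: filling_of_columns_def d padded_def)
  show "?F \<in> CSF m ?l"
  proof -
    have "?F \<in> extensional (dg ?l)" by (simp add: filling_of_columns_def)
    moreover have "1 \<le> ?F (r, c) \<and> ?F (r, c) \<le> m" if "(r, c) \<in> dg ?l" for r c
      using that F[OF that] padded_less[of "Suc m" "g ! (c - 1)" r] padded_pos[of "Suc m" "g ! (c - 1)" r] assms(2)
      by (auto simp: d Suc_le_eq)
    moreover have "?F (r, c) < ?F (r', c)" if "(r, c) \<in> dg ?l" "(r', c) \<in> dg ?l" "r < r'" for r r' c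
      using that F[OF that(1)] F[OF that(2)] padded_strict[of "Suc m" "g ! (c - 1)" r r'] assms(2)
      by (auto simp: d)
    ultimately show ?thesis by (auto simp: CSF_def PiE_iff)
  qed
  show "part ?l 1 \<le> length g"
    using d[of 1 "part ?l 1"] by (cases "part ?l 1 = 0") (auto simp: dg_iff)
  show "first_columns (length g) ?l ?F = g"
  proof (rule nth_equalityI)
    fix i assume "i < length (first_columns (length g) ?l ?F)"
    then have i: "i < length g" by simp
    have "col_len ?l (Suc i) = card {1..length (g ! i)}"
      unfolding col_len_def by (rule arg_cong[of _ _ card]) (use i in \<open>auto simp: d\<close>)
    then have "col_len ?l (Suc i) = length (g ! i)" by simp
    moreover have "padded (Suc m) (column ?l ?F (Suc i)) r = padded (Suc m) (g ! i) r" for r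
      using F[of r "Suc i"] i by (auto simp: padded_column[OF shape_partition] d padded_beyond)
    ultimately have "column ?l ?F (Suc i) = g ! i" by (intro padded_inject[where n = "Suc m"]) auto
    then show "first_columns (length g) ?l ?F ! i = g ! i" using i by (simp add: first_columns_def nth_append del: upt_Suc)
  qed simp
qed

section \<open>The statistics as sums over pairs of columns\<close>

definition Pairs :: "nat \<Rightarrow> (nat \<times> nat) set" where
  "Pairs M = {(c, c'). 1 \<le> c \<and> c < c' \<and> c' \<le> M}"

lemma finite_Pairs: "finite (Pairs M)"
  by (rule finite_subset[of _ "{1..M} \<times> {1..M}"]) (auto simp: Pairs_def)

lemma pair_sum_upt:
  "pair_sum f (map g [1..<Suc M]) = (\<Sum>(c, c')\<in>Pairs M. f (g c) (g c'))"
proof (induction M)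
  case 0
  have "Pairs 0 = {}" by (auto simp: Pairs_def)
  then show ?case by simp
next
  case (Suc M)
  have "Pairs (Suc M) = Pairs M \<union> (\<lambda>c. (c, Suc M)) ` {1..M}" by (auto simp: Pairs_def)
  moreover have "Pairs M \<inter> (\<lambda>c. (c, Suc M)) ` {1..M} = {}" by (auto simp: Pairs_def)
  ultimately have "(\<Sum>(c, c')\<in>Pairs (Suc M). f (g c) (g c')) = 
      (\<Sum>(c, c')\<in>Pairs M. f (g c) (g c')) + (\<Sum>c\<in>{1..M}. f (g c) (g (Suc M)))"
    by (simp add: sum.union_disjoint finite_Pairs sum.reindex inj_on_def)
  moreover have "(\<Sum>c\<in>{1..M}. f (g c) (g (Suc M))) = (\<Sum>x\<leftarrow>map g [1..<Suc M]. f x (g (Suc M)))"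
    by (simp add: interv_sum_list_conv_sum_set_nat comp_def atLeastLessThanSuc_atLeastAtMost del: upt_Suc)
  moreover have "map g [1..<Suc (Suc M)] = map g [1..<Suc M] @ [g (Suc M)]" by simp
  ultimately show ?case using Suc by (simp only: pair_sum_append) simp
qed

lemma card_triples:
  assumes "finite P" "finite R"
  shows "card {(p, r). p \<in> P \<and> r \<in> R \<and> Q p r} = (\<Sum>p\<in>P. \<Sum>r\<in>R. of_bool (Q p r))"
proof -
  have "{(p, r). p \<in> P \<and> r \<in> R \<and> Q p r} = (SIGMA p:P. {r \<in> R. Q p r})" by auto
  then show ?thesis
    using assms by (simp add: of_bool_def sum.If_cases Int_def)
qed

lemma sum_card_Sigma:
  "finite A \<Longrightarrow> (\<And>a. a \<in> A \<Longrightarrow> finite (B a)) \<Longrightarrow> (\<Sum>a\<in>A. int (card (B a))) = int (card (SIGMA a:A. B a))"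
  by simp

text \<open>Double counting over triples of two columns and a row: \<open>f\<close> and
  \<open>g\<close> parametrise the attacking pairs within a row and between adjacent rows,
  \<open>h\<close> the arm cells to be subtracted. What remains is a comparison of indicators for a
  single triple.\<close>

lemma stat_decomposition:
  fixes f g h :: "(nat \<times> nat) \<times> nat \<Rightarrow> 'a" and T :: "(nat \<times> nat) \<times> nat \<Rightarrow> nat"
  assumes "X = f ` {(p, r). p \<in> P \<and> r \<in> R \<and> Q1 p r} \<union> g ` {(p, r). p \<in> P \<and> r \<in> R \<and> Q2 p r}"
    and "f ` {(p, r). p \<in> P \<and> r \<in> R \<and> Q1 p r} \<inter> g ` {(p, r). p \<in> P \<and> r \<in> R \<and> Q2 p r} = {}"
    and "Y = h ` {(p, r). p \<in> P \<and> r \<in> R \<and> Q3 p r}"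
    and inj: "inj_on f {(p, r). p \<in> P \<and> r \<in> R \<and> Q1 p r}" "inj_on g {(p, r). p \<in> P \<and> r \<in> R \<and> Q2 p r}"
      "inj_on h {(p, r). p \<in> P \<and> r \<in> R \<and> Q3 p r}"
    and fin: "finite P" "finite R"
    and summand: "\<And>p r. p \<in> P \<Longrightarrow> r \<in> R \<Longrightarrow> of_bool (Q1 p r) + of_bool (Q2 p r) = of_bool (Q3 p r) + T (p, r)"
  shows "int (card X) - int (card Y) = int (\<Sum>p\<in>P. \<Sum>r\<in>R. T (p, r))"
proof -
  have fin': "finite {(p, r). p \<in> P \<and> r \<in> R \<and> Q p r}" for Q
    by (rule finite_subset[of _ "P \<times> R"]) (use fin in auto)
  have "card X = card {(p, r). p \<in> P \<and> r \<in> R \<and> Q1 p r} + card {(p, r). p \<in> P \<and> r \<in> R \<and> Q2 p r}"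
    unfolding assms(1) by (subst card_Un_disjoint) (use fin' assms(2) inj in \<open>auto simp: card_image\<close>)
  also have "\<dots> = (\<Sum>p\<in>P. \<Sum>r\<in>R. of_bool (Q1 p r) + of_bool (Q2 p r))"
    by (simp only: card_triples[OF fin] sum.distrib)
  also have "\<dots> = (\<Sum>p\<in>P. \<Sum>r\<in>R. of_bool (Q3 p r) + T (p, r))"
    by (intro sum.cong refl summand)
  also have "\<dots> = card Y + (\<Sum>p\<in>P. \<Sum>r\<in>R. T (p, r))"
    unfolding assms(3) card_image[OF inj(3)] by (simp only: card_triples[OF fin] sum.distrib)
  finally show ?thesis by simp
qed

context
  fixes n M :: nat and l :: "nat list" and F :: filling
  assumes part: "is_partition n l" and F: "F \<in> CSF n l" and M: "part l 1 \<le> M"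
begin

lemma pair_sum_cols: "pair_sum (col_stat e (Suc n)) (first_columns M l F) = (\<Sum>p\<in>Pairs M. \<Sum>r=1..Suc n. of_bool
   (padded (Suc n) (column l F (fst p)) (r - 1 + e) < padded (Suc n) (column l F (snd p)) r \<and>
    padded (Suc n) (column l F (snd p)) r < padded (Suc n) (column l F (fst p)) (r + e)))"
  unfolding first_columns_def pair_sum_upt col_stat_def case_prod_beta ..

lemma Des_eq: "Des l F = {u \<in> dg l. 1 < fst u}"
proof -
  have "F (up u) < F u" if "u \<in> dg l" "1 < fst u" for u
  proof -
    have "(fst u - 1, snd u) \<in> dg l" 
      using that part_antimono[OF part, of "fst u - 1" "fst u"] dg_iff[of "fst u" "snd u" l]
      by (auto simp: dg_iff Suc_le_eq)
    then show ?thesis using CSF_strict[OF F, of "fst u - 1" "snd u" "fst u"] that by (simp add: up_def)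
  qed
  then show ?thesis by (auto simp: Des_def)
qed

lemma dg_left: "(r, c') \<in> dg l \<Longrightarrow> 1 \<le> c \<Longrightarrow> c \<le> c' \<Longrightarrow> (r, c) \<in> dg l"
  by (auto simp: dg_iff)

lemma dg_up: "(Suc r, c) \<in> dg l \<Longrightarrow> 1 \<le> r \<Longrightarrow> (r, c) \<in> dg l"
  using part_antimono[OF part, of r "Suc r"] by (auto simp: dg_iff)

lemma dg_M: "(r, c) \<in> dg l \<Longrightarrow> 1 \<le> r \<and> r \<le> n \<and> 1 \<le> c \<and> c \<le> M"
  using dg_bound[OF part, of r c] M by auto

lemma finite_arm: "finite {v \<in> dg l. P v}"
  using finite_dg by simp

text \<open>Below row 1, at least one of \<open>a (r - 1) < b r\<close> and \<open>b r < a r\<close>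
  holds because \<open>a\<close> increases, so counting those that hold and subtracting one for the
  arm gives the indicator that both hold. In row 1 the padding \<open>0\<close> makes the first
  inequality automatic and no arm is subtracted. Where the right column has ended,
  \<open>b r\<close> is infinity and nothing is counted.\<close>

lemma inv_stat_eq: "inv_stat l F = int (pair_sum (col_stat 0 (Suc n)) (first_columns M l F))"
proof -
  let ?E = "\<lambda>c. padded (Suc n) (column l F c)"
  let ?f = "\<lambda>((c, c'), r :: nat). ((r, c :: nat), (r, c' :: nat))"
  let ?g = "\<lambda>((c, c'), r :: nat). ((r, c' :: nat), (r - 1, c :: nat))"
  let ?P = "Pairs M" and ?R = "{1..Suc n}"
  let ?Q1 = "\<lambda>(c, c') r. (r, c) \<in> dg l \<and> (r, c') \<in> dg l \<and> F (r, c') < F (r, c)"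
  let ?Q2 = "\<lambda>(c, c') r. 2 \<le> r \<and> (r - 1, c) \<in> dg l \<and> (r, c') \<in> dg l \<and> F (r - 1, c) < F (r, c')"
  let ?Q3 = "\<lambda>(c, c') r. 2 \<le> r \<and> (r, c) \<in> dg l \<and> (r, c') \<in> dg l"
  have "(\<Sum>u\<in>Des l F. int (arm l u)) = int (card (SIGMA u:Des l F. {v \<in> dg l. fst v = fst u \<and> snd u < snd v}))"
    unfolding arm_def by (rule sum_card_Sigma) (auto simp: Des_eq finite_arm)
  then have "inv_stat l F = int (card (Inv l F)) - 
      int (card (SIGMA u:Des l F. {v \<in> dg l. fst v = fst u \<and> snd u < snd v}))"
    by (simp add: inv_stat_def)
  also have "\<dots> = int (\<Sum>p\<in>?P. \<Sum>r\<in>?R. (\<lambda>(p, r). of_bool (?E (fst p) (r - 1 + 0) < ?E (snd p) r \<and>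
        ?E (snd p) r < ?E (fst p) (r + 0))) (p, r))"
  proof (rule stat_decomposition[where ?f = ?f and ?g = ?g and ?h = ?f and ?P = ?P and ?R = ?R
        and ?Q1.0 = ?Q1 and ?Q2.0 = ?Q2 and ?Q3.0 = ?Q3])
    show "Inv l F = ?f ` {(p, r). p \<in> ?P \<and> r \<in> ?R \<and> ?Q1 p r} \<union> ?g ` {(p, r). p \<in> ?P \<and> r \<in> ?R \<and> ?Q2 p r}"
    proof (intro equalityI subsetI)
      fix x assume "x \<in> Inv l F"
      then obtain r c r' c' where x: "x = ((r, c), (r', c'))" "(r, c) \<in> dg l" "(r', c') \<in> dg l"
        "F (r', c') < F (r, c)" "r = r' \<and> c < c' \<or> r = r' + 1 \<and> c' < c"
        by (auto simp: Inv_def Inv_attacks_def)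
      note b = dg_M[OF x(2)] dg_M[OF x(3)]
      from x(5) show "x \<in> ?f ` {(p, r). p \<in> ?P \<and> r \<in> ?R \<and> ?Q1 p r} \<union> ?g ` {(p, r). p \<in> ?P \<and> r \<in> ?R \<and> ?Q2 p r}"
      proof
        assume "r = r' \<and> c < c'"
        then show ?thesis
          using x b by (intro UnI1 image_eqI[where x = "((c, c'), r)"]) (auto simp: Pairs_def)
      next
        assume "r = r' + 1 \<and> c' < c"
        then show ?thesis
          using x b by (intro UnI2 image_eqI[where x = "((c', c), r)"]) (auto simp: Pairs_def)
      qed
    qed (auto simp: Inv_def Inv_attacks_def Pairs_def)
    show "(SIGMA u:Des l F. {v \<in> dg l. fst v = fst u \<and> snd u < snd v}) = ?f ` {(p, r). p \<in> ?P \<and> r \<in> ?R \<and> ?Q3 p r}"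
    proof (intro equalityI subsetI)
      fix x assume "x \<in> (SIGMA u:Des l F. {v \<in> dg l. fst v = fst u \<and> snd u < snd v})"
      then obtain r c c' where x: "x = ((r, c), (r, c'))" "(r, c) \<in> dg l" "(r, c') \<in> dg l" "1 < r" "c < c'"
        by (auto simp: Des_eq)
      then show "x \<in> ?f ` {(p, r). p \<in> ?P \<and> r \<in> ?R \<and> ?Q3 p r}"
        using dg_M[OF x(2)] dg_M[OF x(3)] by (intro image_eqI[where x = "((c, c'), r)"]) (auto simp: Pairs_def)
    qed (auto simp: Des_eq Pairs_def)
    fix p r assume "p \<in> ?P" "r \<in> ?R"
    then obtain c c' where p: "p = (c, c')" "1 \<le> c" "c < c'" "1 \<le> r" by (auto simp: Pairs_def)
    have E: "?E d r = (if (r, d) \<in> dg l then F (r, d) else Suc n)"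
      "?E d (r - 1) = (if r = 1 then 0 else if (r - 1, d) \<in> dg l then F (r - 1, d) else Suc n)" if "1 \<le> d" for d
      using p(4) by (auto simp: padded_column[OF part that])
    show "of_bool (?Q1 p r) + of_bool (?Q2 p r) = of_bool (?Q3 p r) +
        (\<lambda>(p, r). of_bool (?E (fst p) (r - 1 + 0) < ?E (snd p) r \<and> ?E (snd p) r < ?E (fst p) (r + 0)) :: nat) (p, r)"
    proof (cases "(r, c') \<in> dg l")
      case True
      then have d: "(r, c) \<in> dg l" using dg_left p by simp
      show ?thesis
      proof (cases "r = 1")
        case False
        then have d1: "(r - 1, c) \<in> dg l" using dg_up[of "r - 1" c] d p(4) by simp
        then have "F (r - 1, c) < F (r, c)" using CSF_strict[OF F d1 d] p(4) by simp
        then show ?thesis using p True d d1 False E by auto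
      qed (use p True d E CSF_range[OF F True] in auto)
    next
      case False
      then show ?thesis
        using p E CSF_range[OF F, of "(r, c)"] by auto
    qed
  qed (auto simp: inj_on_def Pairs_def finite_Pairs[unfolded Pairs_def One_nat_def])
  also have "\<dots> = int (pair_sum (col_stat 0 (Suc n)) (first_columns M l F))"
    unfolding pair_sum_cols by simp
  finally show ?thesis .
qed

text \<open>The arm is that of the cell above the descent, so for a descent in row
  \<open>r + 1\<close> its cells lie in row \<open>r\<close>, next to the attacked ones. Where the
  left column ends in row \<open>r\<close>, the upper bound is infinity and row \<open>r + 1\<close>
  supplies neither an attack nor a descent.\<close>

lemma quinv_stat_eq: "quinv_stat l F = int (pair_sum (col_stat (Suc 0) (Suc n)) (first_columns M l F))"
proof -
  let ?E = "\<lambda>c. padded (Suc n) (column l F c)"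
  let ?f = "\<lambda>((c, c'), r :: nat). ((r, c' :: nat), (r, c :: nat))"
  let ?g = "\<lambda>((c, c'), r :: nat). ((Suc r, c :: nat), (r, c' :: nat))"
  let ?P = "Pairs M" and ?R = "{1..Suc n}"
  let ?Q1 = "\<lambda>(c, c') r. (r, c) \<in> dg l \<and> (r, c') \<in> dg l \<and> F (r, c) < F (r, c')"
  let ?Q2 = "\<lambda>(c, c') r. (Suc r, c) \<in> dg l \<and> (r, c') \<in> dg l \<and> F (r, c') < F (Suc r, c)"
  let ?Q3 = "\<lambda>(c, c') r. (Suc r, c) \<in> dg l \<and> (r, c') \<in> dg l"
  have "(\<Sum>u\<in>Des l F. int (arm l (up u))) = 
      int (card (SIGMA u:Des l F. {v \<in> dg l. fst v = fst (up u) \<and> snd (up u) < snd v}))"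
    unfolding arm_def by (rule sum_card_Sigma) (auto simp: Des_eq finite_arm)
  then have "quinv_stat l F = int (card (Quinv l F)) - 
      int (card (SIGMA u:Des l F. {v \<in> dg l. fst v = fst (up u) \<and> snd (up u) < snd v}))"
    by (simp add: quinv_stat_def)
  also have "\<dots> = int (\<Sum>p\<in>?P. \<Sum>r\<in>?R. (\<lambda>(p, r). of_bool (?E (fst p) (r - 1 + Suc 0) < ?E (snd p) r \<and>
        ?E (snd p) r < ?E (fst p) (r + Suc 0))) (p, r))"
  proof (rule stat_decomposition[where ?f = ?f and ?g = ?g and ?h = ?g and ?P = ?P and ?R = ?R
        and ?Q1.0 = ?Q1 and ?Q2.0 = ?Q2 and ?Q3.0 = ?Q3])
    show "Quinv l F = ?f ` {(p, r). p \<in> ?P \<and> r \<in> ?R \<and> ?Q1 p r} \<union> ?g ` {(p, r). p \<in> ?P \<and> r \<in> ?R \<and> ?Q2 p r}"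
    proof (intro equalityI subsetI)
      fix x assume "x \<in> Quinv l F"
      then obtain r c r' c' where x: "x = ((r, c), (r', c'))" "(r, c) \<in> dg l" "(r', c') \<in> dg l"
        "F (r', c') < F (r, c)" "r = r' \<and> c' < c \<or> r = r' + 1 \<and> c < c'"
        by (auto simp: Quinv_def Quinv_attacks_def)
      note b = dg_M[OF x(2)] dg_M[OF x(3)]
      from x(5) show "x \<in> ?f ` {(p, r). p \<in> ?P \<and> r \<in> ?R \<and> ?Q1 p r} \<union> ?g ` {(p, r). p \<in> ?P \<and> r \<in> ?R \<and> ?Q2 p r}"
      proof
        assume "r = r' \<and> c' < c"
        then show ?thesis
          using x b by (intro UnI1 image_eqI[where x = "((c', c), r)"]) (auto simp: Pairs_def)
      next
        assume "r = r' + 1 \<and> c < c'"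
        then show ?thesis
          using x b by (intro UnI2 image_eqI[where x = "((c, c'), r')"]) (auto simp: Pairs_def)
      qed
    qed (auto simp: Quinv_def Quinv_attacks_def Pairs_def)
    show "(SIGMA u:Des l F. {v \<in> dg l. fst v = fst (up u) \<and> snd (up u) < snd v}) =
        ?g ` {(p, r). p \<in> ?P \<and> r \<in> ?R \<and> ?Q3 p r}"
    proof (intro equalityI subsetI)
      fix x assume "x \<in> (SIGMA u:Des l F. {v \<in> dg l. fst v = fst (up u) \<and> snd (up u) < snd v})"
      then obtain r c c' where x: "x = ((Suc r, c), (r, c'))" "(Suc r, c) \<in> dg l" "(r, c') \<in> dg l" "c < c'"
        by (auto simp: Des_eq up_def gr0_conv_Suc less_eq_Suc_le)
      then show "x \<in> ?g ` {(p, r). p \<in> ?P \<and> r \<in> ?R \<and> ?Q3 p r}"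
        using dg_M[OF x(2)] dg_M[OF x(3)] by (intro image_eqI[where x = "((c, c'), r)"]) (auto simp: Pairs_def)
    qed (auto simp: Des_eq Pairs_def up_def)
    fix p r assume "p \<in> ?P" "r \<in> ?R"
    then obtain c c' where p: "p = (c, c')" "1 \<le> c" "c < c'" "1 \<le> r" by (auto simp: Pairs_def)
    have E: "?E d r = (if (r, d) \<in> dg l then F (r, d) else Suc n)"
      "?E d (Suc r) = (if (Suc r, d) \<in> dg l then F (Suc r, d) else Suc n)" if "1 \<le> d" for d
      using p(4) by (auto simp: padded_column[OF part that])
    have e: "r - 1 + Suc 0 = r" "r + Suc 0 = Suc r" using p(4) by auto
    show "of_bool (?Q1 p r) + of_bool (?Q2 p r) = of_bool (?Q3 p r) +
        (\<lambda>(p, r). of_bool (?E (fst p) (r - 1 + Suc 0) < ?E (snd p) r \<and> ?E (snd p) r < ?E (fst p) (r + Suc 0)) :: nat) (p, r)"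
    proof (cases "(r, c') \<in> dg l")
      case True
      then have d: "(r, c) \<in> dg l" using dg_left p by simp
      show ?thesis
      proof (cases "(Suc r, c) \<in> dg l")
        case d1: True
        then have "F (r, c) < F (Suc r, c)" using CSF_strict[OF F d d1] by simp
        then show ?thesis using p True d d1 E unfolding prod.case e by auto
      next
        case False
        then show ?thesis using p True d E CSF_range[OF F True] unfolding prod.case e by auto
      qed
    next
      case False
      have "?E c (Suc r) \<le> Suc n" 
        using padded_le[OF col_ok_column[OF part F p(2)]] .
      then show ?thesis
        using False p E unfolding prod.case e by auto
    qed
  qed (auto simp: inj_on_def Pairs_def finite_Pairs[unfolded Pairs_def One_nat_def])
  also have "\<dots> = int (pair_sum (col_stat (Suc 0) (Suc n)) (first_columns M l F))"
    unfolding pair_sum_cols by simp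
  finally show ?thesis .
qed

end

section \<open>Deleting the largest entry\<close>

text \<open>Strictness puts \<open>n\<close> at the bottom of its column, so the deletion shifts no
  other entry: the deleted \<open>n\<close> and the old infinity \<open>Suc n\<close> both turn into
  the new infinity \<open>n\<close>.\<close>

lemma remove_max:
  assumes "col_ok (Suc n) a" "0 < n"
  shows col_ok_remove: "col_ok n (removeAll n a)"
    and padded_remove: "padded n (removeAll n a) i = min n (padded (Suc n) a i)"
    and length_remove: "length (removeAll n a) + of_bool (n \<in> set a) = length a"
    and n_in_iff: "n \<in> set a \<longleftrightarrow> a \<noteq> [] \<and> padded (Suc n) a (length a) = n"
proof -
  have "col_ok n (removeAll n a) \<and> padded n (removeAll n a) i = min n (padded (Suc n) a i) \<and>
    length (removeAll n a) + of_bool (n \<in> set a) = length a \<and>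
    (n \<in> set a \<longleftrightarrow> a \<noteq> [] \<and> padded (Suc n) a (length a) = n)"
  proof (cases a rule: rev_cases)
    case Nil
    then show ?thesis using assms by (simp add: col_ok_def padded_def)
  next
    case (snoc b x)
    then have b: "sorted_wrt (<) b" "\<And>y. y \<in> set b \<Longrightarrow> 1 \<le> y \<and> y < x" "1 \<le> x" "x \<le> n"
      using assms(1) by (auto simp: col_ok_def sorted_wrt_append)
    have nb: "n \<notin> set b" using b(2)[of n] b(4) by auto
    have l: "length a = Suc (length b)" using snoc by simp
    have e: "b ! (i - 1) < n" if "0 < i" "i \<le> length b" for i
      using b(2)[of "b ! (i - 1)"] b(4) that by (simp add: less_le_trans)
    show ?thesis
    proof (cases "x = n")
      case True
      then have r: "removeAll n a = b" using snoc nb by simp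
      have "col_ok n b" using b True by (simp add: col_ok_def)
      moreover have "padded n b i = min n (padded (Suc n) a i)"
        using e[of i] snoc True by (auto simp: padded_def nth_append less_imp_le min_def not_le)
      ultimately show ?thesis using snoc True nb by (simp add: r padded_def nth_append)
    next
      case False
      then have r: "removeAll n a = a" using snoc nb by simp
      have "col_ok n a" using b False snoc
        by (force simp: col_ok_def sorted_wrt_append)
      moreover have "padded n a i = min n (padded (Suc n) a i)"
        using padded_le[OF \<open>col_ok n a\<close>, of i] by (auto simp: padded_def)
      ultimately show ?thesis using snoc False nb by (simp add: r padded_def nth_append)
    qed
  qed
  then show "col_ok n (removeAll n a)"
    "padded n (removeAll n a) i = min n (padded (Suc n) a i)"
    "length (removeAll n a) + of_bool (n \<in> set a) = length a"
    "n \<in> set a \<longleftrightarrow> a \<noteq> [] \<and> padded (Suc n) a (length a) = n" by auto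
qed

text \<open>In a counted row the entry of \<open>b\<close> is finite, so truncation endangers only
  its upper inequality, in the form \<open>n < Suc n\<close>. For offset 0 this would require
  \<open>b\<close> to have an entry in a row where \<open>a\<close> has ended already. For offset 1
  the bound is taken one row lower, and one configuration is lost: the columns end in the same row
  and only \<open>b\<close> ends in \<open>n\<close>.\<close>

lemma col_stat_remove:
  assumes "col_ok (Suc n) a" "col_ok (Suc n) b" "0 < n" "length b \<le> length a"
  shows col_stat_remove_inv: "col_stat 0 (Suc n) a b = col_stat 0 n (removeAll n a) (removeAll n b)"
    and col_stat_remove_quinv: "col_stat (Suc 0) (Suc n) a b = col_stat (Suc 0) n (removeAll n a) (removeAll n b) +
      of_bool (length a = length b \<and> n \<notin> set a \<and> n \<in> set b)"
proof -
  let ?A = "padded (Suc n) a" and ?B = "padded (Suc n) b"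
  note ra = padded_remove[OF assms(1,3)] and rb = padded_remove[OF assms(2,3)]
  have top: "?B (Suc n) = Suc n"
    using length_col[OF assms(2)] by (simp add: padded_beyond)
  have A: "?A i < Suc n \<longleftrightarrow> i \<le> length a" "?A i \<le> Suc n" for i
    using padded_less[OF assms(1), of i] padded_beyond[of a i "Suc n"] padded_le[OF assms(1), of i]
    by (cases "i \<le> length a"; simp)+
  have B: "?B i < Suc n \<longleftrightarrow> i \<le> length b" "?B i \<le> Suc n" for i
    using padded_less[OF assms(2), of i] padded_beyond[of b i "Suc n"] padded_le[OF assms(2), of i]
    by (cases "i \<le> length b"; simp)+
  have "?A (i - 1) < ?B i \<and> ?B i < ?A i \<longleftrightarrow> min n (?A (i - 1)) < min n (?B i) \<and> min n (?B i) < min n (?A i)" for i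
    using A[of i] B[of i] assms(4) by linarith
  then show "col_stat 0 (Suc n) a b = col_stat 0 n (removeAll n a) (removeAll n b)"
    by (simp add: col_stat_def ra rb top A not_less)
  have len: "?A i < ?B i \<and> ?B i < ?A (Suc i) \<and> ?B i = n \<longleftrightarrow>
      i = length a \<and> length a = length b \<and> n \<notin> set a \<and> n \<in> set b" if "1 \<le> i" for i
  proof
    assume *: "?A i < ?B i \<and> ?B i < ?A (Suc i) \<and> ?B i = n"
    then have "i \<le> length a" "\<not> Suc i \<le> length a" "i \<le> length b"
      using A(1)[of i] A(1)[of "Suc i"] B(1)[of i] by auto
    then have "i = length a" "i = length b" using assms(4) by auto
    then show "i = length a \<and> length a = length b \<and> n \<notin> set a \<and> n \<in> set b"
      using * that n_in_iff[OF assms(1,3)] n_in_iff[OF assms(2,3)] by auto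
  next
    assume *: "i = length a \<and> length a = length b \<and> n \<notin> set a \<and> n \<in> set b"
    then have "?A i \<noteq> n" "?B i = n" using that n_in_iff[OF assms(1,3)] n_in_iff[OF assms(2,3)] by auto
    moreover have "?A i < Suc n" "?A (Suc i) = Suc n" using * A(1)[of i] by (auto simp: padded_beyond)
    ultimately show "?A i < ?B i \<and> ?B i < ?A (Suc i) \<and> ?B i = n" by auto
  qed
  let ?K = "length a = length b \<and> n \<notin> set a \<and> n \<in> set b"
  have t: "of_bool (?A i < ?B i \<and> ?B i < ?A (Suc i)) =
      of_bool (min n (?A i) < min n (?B i) \<and> min n (?B i) < min n (?A (Suc i))) + (of_bool (i = length a \<and> ?K) :: nat)"
    if "1 \<le> i" for i
  proof (cases "?B i < n")
    case True
    then show ?thesis using len[OF that] by (auto simp: min_def)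
  next
    case False
    then have "?B i = n \<or> ?B i = Suc n" using B(2)[of i] by linarith
    then show ?thesis using len[OF that] A(2)[of "Suc i"] False by (auto simp: min_def)
  qed
  have "col_stat (Suc 0) (Suc n) a b = (\<Sum>i=1..Suc n. of_bool (?A i < ?B i \<and> ?B i < ?A (Suc i)))"
    unfolding col_stat_def by (rule sum.cong) auto
  also have "\<dots> = (\<Sum>i=1..n. of_bool (?A i < ?B i \<and> ?B i < ?A (Suc i)))"
    using A(2)[of "Suc (Suc n)"] by (simp add: top)
  also have "\<dots> = (\<Sum>i=1..n. of_bool (min n (?A i) < min n (?B i) \<and> min n (?B i) < min n (?A (Suc i))) +
      of_bool (i = length a \<and> ?K))"
    by (rule sum.cong[OF refl t]) simp
  also have "\<dots> = (\<Sum>i=1..n. of_bool (min n (?A i) < min n (?B i) \<and> min n (?B i) < min n (?A (Suc i)))) +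
      (\<Sum>i=1..n. of_bool (i = length a \<and> ?K))"
    by (rule sum.distrib)
  also have "(\<Sum>i=1..n. of_bool (min n (?A i) < min n (?B i) \<and> min n (?B i) < min n (?A (Suc i)))) =
      col_stat (Suc 0) n (removeAll n a) (removeAll n b)"
    unfolding col_stat_def ra rb by (rule sum.cong) auto
  also have "(\<Sum>i=1..n. of_bool (i = length a \<and> ?K)) = (of_bool ?K :: nat)"
  proof (cases ?K)
    case True
    then have "length a \<in> {1..n}" using length_col[OF assms(1)] by (auto simp: Suc_le_eq)
    then show ?thesis using True by (simp add: of_bool_def)
  qed auto
  finally show "col_stat (Suc 0) (Suc n) a b = col_stat (Suc 0) n (removeAll n a) (removeAll n b) +
      of_bool (length a = length b \<and> n \<notin> set a \<and> n \<in> set b)" .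
qed

lemma pair_sum_cong:
  "sorted_wrt (\<lambda>x y. f x y = g x y) xs \<Longrightarrow> pair_sum f xs = pair_sum g xs"
  by (induction xs) (auto intro!: arg_cong[of _ _ sum_list])

lemma pair_sum_add: "pair_sum (\<lambda>x y. f x y + g x y) xs = pair_sum f xs + pair_sum g xs"
  by (induction xs) (auto simp: sum_list_addf)

lemma pair_sum_remove:
  assumes "cols_ok (Suc n) cs" "0 < n" "sorted_wrt (\<lambda>a b. length b \<le> length a) cs"
  shows pair_sum_remove_inv: "pair_sum (col_stat 0 (Suc n)) cs = pair_sum (col_stat 0 n) (map (removeAll n) cs)"
    and pair_sum_remove_quinv: "pair_sum (col_stat (Suc 0) (Suc n)) cs = pair_sum (col_stat (Suc 0) n) (map (removeAll n) cs) +
      pair_sum (\<lambda>a b. of_bool (length a = length b \<and> n \<notin> set a \<and> n \<in> set b)) cs"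
    and len_inversions_remove: "len_inversions (map length (map (removeAll n) cs)) =
      pair_sum (\<lambda>a b. of_bool (length a = length b \<and> n \<in> set a \<and> n \<notin> set b)) cs"
proof -
  show "pair_sum (col_stat 0 (Suc n)) cs = pair_sum (col_stat 0 n) (map (removeAll n) cs)"
    unfolding pair_sum_map
    by (rule pair_sum_cong, rule sorted_wrt_mono_rel[rotated, OF assms(3)]) (use assms(1,2) col_stat_remove_inv in blast)
  show "pair_sum (col_stat (Suc 0) (Suc n)) cs = pair_sum (col_stat (Suc 0) n) (map (removeAll n) cs) +
      pair_sum (\<lambda>a b. of_bool (length a = length b \<and> n \<notin> set a \<and> n \<in> set b)) cs"
    unfolding pair_sum_map pair_sum_add[symmetric]
    by (rule pair_sum_cong, rule sorted_wrt_mono_rel[rotated, OF assms(3)]) (use assms(1,2) col_stat_remove_quinv in blast)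
  show "len_inversions (map length (map (removeAll n) cs)) =
      pair_sum (\<lambda>a b. of_bool (length a = length b \<and> n \<in> set a \<and> n \<notin> set b)) cs"
    unfolding pair_sum_map
  proof (rule pair_sum_cong, rule sorted_wrt_mono_rel[rotated, OF assms(3)])
    fix a b assume "a \<in> set cs" "b \<in> set cs" "length b \<le> length a"
    then show "of_bool (length (removeAll n a) < length (removeAll n b)) =
      (of_bool (length a = length b \<and> n \<in> set a \<and> n \<notin> set b) :: nat)"
      using assms(1,2) length_remove[of n a] length_remove[of n b]
      by (cases "n \<in> set a"; cases "n \<in> set b") auto
  qed
qed

text \<open>
  The columns of length exactly \<open>i\<close>.  Only these can contain the largest entry in row \<open>i\<close>.
\<close>

definition block :: "nat list \<Rightarrow> nat \<Rightarrow> nat list" where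
  "block l i = [Suc (part l (Suc i))..<Suc (part l i)]"

lemma set_block: "set (block l i) = {Suc (part l (Suc i))..part l i}"
  by (auto simp: block_def)

lemma col_len_block:
  assumes "is_partition n l" "1 \<le> i" "c \<in> set (block l i)"
  shows "col_len l c = i"
proof -
  have c: "1 \<le> c" "(i, c) \<in> dg l" "(Suc i, c) \<notin> dg l"
    using assms(2,3) by (auto simp: set_block dg_iff)
  show ?thesis using c(2,3) unfolding dg_col_len_iff[OF assms(1) c(1)] by simp
qed

text \<open>The columns up to \<open>part l r\<close> are those of length at least \<open>r\<close>,
  so the sum is built up from the longest columns. Mixed terms vanish because each newly added block
  is shorter than everything to its left.\<close>

lemma pair_sum_blocks:
  assumes "is_partition n l"
    and "\<And>c c'. 1 \<le> c \<Longrightarrow> col_len l c' < col_len l c \<Longrightarrow> f c c' = 0"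
  shows "pair_sum f [1..<Suc (part l 1)] = (\<Sum>i=1..n. pair_sum f (block l i))"
proof -
  have "pair_sum f [1..<Suc (part l (Suc n - k))] = (\<Sum>i=Suc n - k..n. pair_sum f (block l i))" if "k \<le> n" for k
    using that
  proof (induction k)
    case 0
    then show ?case using part_beyond[OF assms(1), of "Suc n"] by simp
  next
    case (Suc k)
    define i where "i = n - k"
    have i: "1 \<le> i" "Suc n - k = Suc i" "Suc n - Suc k = i" "i \<le> n" using Suc.prems by (auto simp: i_def)
    have le: "part l (Suc i) \<le> part l i" using part_antimono[OF assms(1) i(1)] by simp
    then have "[1..<Suc (part l i)] = [1..<Suc (part l (Suc i))] @ block l i"
      unfolding block_def using upt_add_eq_append[of 1 "Suc (part l (Suc i))" "part l i - part l (Suc i)"] by simp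
    moreover have "(\<Sum>x\<leftarrow>[1..<Suc (part l (Suc i))]. \<Sum>y\<leftarrow>block l i. f x y) = 0"
    proof -
      have "f x y = 0" if "x \<in> set [1..<Suc (part l (Suc i))]" "y \<in> set (block l i)" for x y
      proof (rule assms(2))
        show x: "1 \<le> x" using that(1) by (simp del: upt_Suc)
        have "(Suc i, x) \<in> dg l" using that(1) by (simp add: dg_iff del: upt_Suc)
        then show "col_len l y < col_len l x"
          using col_len_block[OF assms(1) i(1) that(2)] unfolding dg_col_len_iff[OF assms(1) x] by simp
      qed
      then have "\<forall>x\<in>set [1..<Suc (part l (Suc i))]. (\<Sum>y\<leftarrow>block l i. f x y) = 0"
        by (simp add: sum_list_eq_0_iff del: upt_Suc)
      then show ?thesis by (simp only: sum_list_eq_0_iff set_map) auto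
    qed
    ultimately have "pair_sum f [1..<Suc (part l i)] = pair_sum f [1..<Suc (part l (Suc i))] + pair_sum f (block l i)"
      by (simp only: pair_sum_append)
    also have "pair_sum f [1..<Suc (part l (Suc i))] = (\<Sum>i=Suc i..n. pair_sum f (block l i))"
      using Suc i by simp
    finally show ?case using i by (simp add: sum.atLeast_Suc_atMost[of i n])
  qed
  from this[of n] show ?thesis by simp
qed

definition word :: "nat \<Rightarrow> nat list \<Rightarrow> filling \<Rightarrow> nat \<Rightarrow> bool list" where
  "word n l F i = map (\<lambda>c. F (i, c) = n) (block l i)"

lemma length_word: "length (word n l F i) = part l i - part l (Suc i)"
  by (simp add: word_def block_def del: upt_Suc)

lemma count_word: "count_list (word n l F i) b = card {c \<in> set (block l i). (F (i, c) = n) = b}"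
proof -
  have "count_list (map g xs) b = length (filter (\<lambda>c. g c = b) xs)" for g :: "nat \<Rightarrow> bool" and xs
    by (induction xs) auto
  then have "count_list (word n l F i) b = length (filter (\<lambda>c. (F (i, c) = n) = b) (block l i))"
    by (simp add: word_def)
  also have "\<dots> = card (set (filter (\<lambda>c. (F (i, c) = n) = b) (block l i)))"
    by (rule distinct_card[symmetric]) (simp add: block_def)
  finally show ?thesis by simp
qed

context
  fixes n :: nat and l :: "nat list" and F :: filling
  assumes part: "is_partition n l" and F: "F \<in> CSF n l" and n: "0 < n"
begin

lemma n_in_column:
  assumes "1 \<le> i" "c \<in> set (block l i)"
  shows "n \<in> set (column l F c) \<longleftrightarrow> F (i, c) = n"
proof -
  have c: "1 \<le> c" "(i, c) \<in> dg l" using assms by (auto simp: set_block dg_iff)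
  have len: "length (column l F c) = i" using col_len_block[OF part assms] by simp
  show ?thesis
    unfolding n_in_iff[OF col_ok_column[OF part F c(1)] n] len padded_column[OF part c(1)]
    using c assms(1) by (auto simp: len[symmetric] simp del: length_column)
qed

text \<open>Column strictness forces the \<open>i\<close>-th entry of a column to be at least
  \<open>i\<close>, so a column of length \<open>n\<close> ends in \<open>n\<close>. This matches
  the absence of an overlay component for \<open>i = n\<close>.\<close>

lemma word_n: "count_list (word n l F n) False = 0"
proof -
  have "F (n, c) = n" if c: "c \<in> set (block l n)" for c
  proof -
    have c': "1 \<le> c" "(n, c) \<in> dg l" using c n by (auto simp: set_block dg_iff)
    have "n \<le> padded (Suc n) (column l F c) n"
      by (rule padded_ge[OF col_ok_column[OF part F c'(1)]]) (use col_len_block[OF part _ c] n in auto)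
    then show ?thesis
      using CSF_range[OF F c'(2)] c'(2) n by (simp add: padded_column[OF part c'(1)])
  qed
  then show ?thesis by (auto simp: count_word)
qed

lemma pair_sum_word:
  "pair_sum (\<lambda>a b. of_bool (length a = length b \<and> n \<in> set a \<and> n \<notin> set b)) (first_columns (part l 1) l F) =
     (\<Sum>i=1..<n. sum_list (word_partition (word n l F i)))"
  "pair_sum (\<lambda>a b. of_bool (length a = length b \<and> n \<notin> set a \<and> n \<in> set b)) (first_columns (part l 1) l F) =
     (\<Sum>i=1..<n. pair_sum (\<lambda>x y. of_bool (\<not> x \<and> y)) (word n l F i))"
proof -
  \<comment> \<open>Both orders of a column ending in \<open>n\<close> and one not ending in it are
    treated at once through \<open>R\<close>. The block \<open>i = n\<close> drops out because its
    word is constant.\<close>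
  have *: "pair_sum (\<lambda>a b. of_bool (length a = length b \<and> R (n \<in> set a) (n \<in> set b))) (first_columns (part l 1) l F) =
     (\<Sum>i=1..<n. pair_sum (\<lambda>x y. of_bool (R x y)) (word n l F i))"
    if R: "\<And>x. \<not> R x True \<or> \<not> R True x" "R True True = False" "R False False = False" for R
  proof -
    have "pair_sum (\<lambda>a b. of_bool (length a = length b \<and> R (n \<in> set a) (n \<in> set b))) (first_columns (part l 1) l F) =
      (\<Sum>i=1..n. pair_sum (\<lambda>c c'. of_bool (length (column l F c) = length (column l F c') \<and>
         R (n \<in> set (column l F c)) (n \<in> set (column l F c')))) (block l i))"
      unfolding first_columns_def pair_sum_map by (rule pair_sum_blocks[OF part]) simp
    also have "\<dots> = (\<Sum>i=1..n. pair_sum (\<lambda>x y. of_bool (R x y)) (word n l F i))"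
      unfolding word_def pair_sum_map
    proof (intro sum.cong refl pair_sum_cong)
      fix i assume "i \<in> {1..n}"
      then have i: "1 \<le> i" by simp
      have "sorted_wrt (\<lambda>x y. True) (block l i)" by (simp add: sorted_wrt_iff_nth_less)
      then show "sorted_wrt (\<lambda>c c'. of_bool (length (column l F c) = length (column l F c') \<and>
         R (n \<in> set (column l F c)) (n \<in> set (column l F c'))) = of_bool (R (F (i, c) = n) (F (i, c') = n))) (block l i)"
        by (rule sorted_wrt_mono_rel[rotated])
          (simp only: length_column col_len_block[OF part i] n_in_column[OF i] simp_thms)
    qed
    also have "\<dots> = (\<Sum>i=1..<n. pair_sum (\<lambda>x y. of_bool (R x y)) (word n l F i)) + pair_sum (\<lambda>x y. of_bool (R x y)) (word n l F n)"
      using n by (simp add: sum.last_plus add.commute)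
    also have "pair_sum (\<lambda>x y. of_bool (R x y)) (word n l F n) = 0"
    proof -
      have "False \<notin> set (word n l F n)" using word_n by (simp add: count_list_0_iff)
      then have "x = True" if "x \<in> set (word n l F n)" for x using that by (cases x) auto
      then have "sorted_wrt (\<lambda>x y. x = True \<and> y = True) (word n l F n)"
        unfolding sorted_wrt_iff_nth_less by (meson less_trans nth_mem)
      then show ?thesis
        unfolding pair_sum_eq_0_iff by (rule sorted_wrt_mono_rel[rotated]) (use R in auto)
    qed
    finally show ?thesis by simp
  qed
  show "pair_sum (\<lambda>a b. of_bool (length a = length b \<and> n \<in> set a \<and> n \<notin> set b)) (first_columns (part l 1) l F) =
     (\<Sum>i=1..<n. sum_list (word_partition (word n l F i)))"
    unfolding word_partition_sum by (rule *[of "\<lambda>x y. x \<and> \<not> y"]) auto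
  show "pair_sum (\<lambda>a b. of_bool (length a = length b \<and> n \<notin> set a \<and> n \<in> set b)) (first_columns (part l 1) l F) =
     (\<Sum>i=1..<n. pair_sum (\<lambda>x y. of_bool (\<not> x \<and> y)) (word n l F i))"
    by (rule *[of "\<lambda>x y. \<not> x \<and> y"]) auto
qed

end

section \<open>The recursive map\<close>

lemma dg_inject:
  assumes "length l = length l'" "\<And>r c. (r, c) \<in> dg l \<longleftrightarrow> (r, c) \<in> dg l'"
  shows "l = l'"
proof (rule nth_equalityI[OF assms(1)])
  fix i assume i: "i < length l"
  have "{c. (Suc i, c) \<in> dg k} = {1..part k (Suc i)}" for k by (auto simp: dg_iff)
  then have "{1..part l (Suc i)} = {1..part l' (Suc i)}" using assms(2) by blast
  then have "part l (Suc i) = part l' (Suc i)" by (metis card_atLeastAtMost diff_Suc_1)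
  then show "l ! i = l' ! i" using i assms(1) by (simp add: part_def)
qed

lemma partition_shaped_cols: "is_partition n l \<Longrightarrow> partition_shaped (first_columns M l F)"
  using cols_sorted[of n l M F] by (simp add: partition_shaped_def sorted_wrt_map)

lemma columns_roundtrip:
  assumes "is_partition m \<mu>" "G \<in> CSF m \<mu>" "part \<mu> 1 \<le> M"
  shows shape_of_cols: "shape_of_columns m (first_columns M \<mu> G) = \<mu>"
    and filling_of_cols: "filling_of_columns m (first_columns M \<mu> G) = G"
proof -
  let ?g = "first_columns M \<mu> G"
  have ps: "partition_shaped ?g" by (rule partition_shaped_cols[OF assms(1)])
  have ok: "cols_ok (Suc m) ?g" by (rule cols_ok_cols[OF assms(1,2)])
  have len: "length a \<le> m" if "a \<in> set ?g" for a
    using length_col[of "Suc m" a] ok that by auto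
  show shape: "shape_of_columns m ?g = \<mu>"
  proof (rule dg_inject)
    show "length (shape_of_columns m ?g) = length \<mu>"
      using assms(1) by (simp add: is_partition_def shape_of_columns_def)
    fix r c
    have *: "?g ! (c - 1) = column \<mu> G c" if "1 \<le> c" "c \<le> M"
      using that by (simp add: first_columns_def del: upt_Suc)
    show "(r, c) \<in> dg (shape_of_columns m ?g) \<longleftrightarrow> (r, c) \<in> dg \<mu>"
    proof (cases "1 \<le> c \<and> c \<le> M")
      case True
      then show ?thesis using * by (simp add: shape_dg_iff[OF ps len] dg_col_len_iff[OF assms(1)])
    next
      case False
      then have "(r, c) \<notin> dg \<mu>" using dg_bound[OF assms(1), of r c] assms(3) by auto
      then show ?thesis using False by (auto simp: shape_dg_iff[OF ps len])
    qed
  qed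
  show "filling_of_columns m ?g = G"
    using CSF_eqI[OF assms(1) filling_of_columns_CSF[OF ps ok, unfolded shape] assms(2,3)]
      cols_filling_of_columns[OF ps ok] shape by simp
qed

lemma cols_ok_remove:
  assumes "is_partition n l" "F \<in> CSF n l" "0 < n"
  shows "cols_ok n (map (removeAll n) (first_columns M l F))"
  using cols_ok_cols[OF assms(1,2), of M] col_ok_remove[OF _ assms(3)] by auto

text \<open>Confluence turns the definite description into a rule: any single run that ends in
  partition shape computes \<open>dsplice\<close>.\<close>

lemma dsplice_eqI:
  assumes "is_partition (Suc m) l" "F \<in> CSF (Suc m) l"
    and "splice_step\<^sup>*\<^sup>* (map (removeAll (Suc m)) (first_columns (part l 1) l F)) g" "partition_shaped g"
  shows "dsplice (Suc m) l F = (shape_of_columns m g, filling_of_columns m g)"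
proof -
  have "dsplice_columns (Suc m) (columns l F) = g"
    unfolding dsplice_columns_def columns_eq
    by (rule the_equality)
      (use assms(3,4) splice_normal_form_unique[OF _ cols_ok_remove[OF assms(1,2)]] in auto)
  then show ?thesis by (simp add: dsplice_def Let_def)
qed

lemma count_True_False: "count_list w True + count_list w False = length w"
  by (induction w) auto

section \<open>One level of delete-and-splice: rows, shape and statistics\<close>

context
  fixes m :: nat and l :: "nat list" and F :: filling and \<mu> :: "nat list" and G :: filling
  assumes part: "is_partition (Suc m) l" and F: "F \<in> CSF (Suc m) l"
    and ds: "dsplice (Suc m) l F = (\<mu>, G)"
begin

text \<open>The run is recorded with all \<open>part l 1\<close> columns although
  \<open>\<mu>\<close> may have fewer; emptied columns end up on the right.\<close>

lemma dsplice_basic: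
  shows dsplice_partition: "is_partition m \<mu>"
    and dsplice_CSF: "G \<in> CSF m \<mu>"
    and dsplice_part1: "part \<mu> 1 \<le> part l 1"
    and dsplice_steps: "splice_step\<^sup>*\<^sup>* (map (removeAll (Suc m)) (first_columns (part l 1) l F)) (first_columns (part l 1) \<mu> G)"
proof -
  let ?cs = "map (removeAll (Suc m)) (first_columns (part l 1) l F)"
  have ok: "cols_ok (Suc m) ?cs" by (rule cols_ok_remove[OF part F]) simp
  obtain g where g: "splice_step\<^sup>*\<^sup>* ?cs g" "partition_shaped g"
    using splice_normal_form[OF _ ok] by auto
  have gok: "cols_ok (Suc m) g" by (rule splice_steps_ok[OF g(1) _ ok]) simp
  have len: "length g = part l 1" using splice_steps_length[OF g(1)] by simp
  have eq: "\<mu> = shape_of_columns m g" "G = filling_of_columns m g"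
    using dsplice_eqI[OF part F g] ds by auto
  show "is_partition m \<mu>" unfolding eq by (rule shape_partition)
  show "G \<in> CSF m \<mu>" unfolding eq by (rule filling_of_columns_CSF[OF g(2) gok])
  show "part \<mu> 1 \<le> part l 1" unfolding eq len[symmetric] by (rule shape_part1_le[OF g(2) gok])
  show "splice_step\<^sup>*\<^sup>* ?cs (first_columns (part l 1) \<mu> G)"
    unfolding eq len[symmetric] cols_filling_of_columns[OF g(2) gok] unfolding len by (rule g(1))
qed

text \<open>Splices permute the padded values of each row, and truncation at \<open>Suc m\<close>
  does not affect entries up to \<open>m\<close>. Compatibility with \<open>br\<close> on the side
  of the patterns comes from here.\<close>

lemma dsplice_row_count:
  assumes "1 \<le> i" "j \<le> m"
  shows "card {c. (i, c) \<in> dg \<mu> \<and> G (i, c) \<le> j} = card {c. (i, c) \<in> dg l \<and> F (i, c) \<le> j}"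
proof -
  let ?cs = "map (removeAll (Suc m)) (first_columns (part l 1) l F)"
  have ok: "cols_ok (Suc m) ?cs" by (rule cols_ok_remove[OF part F]) simp
  have flt: "length (filter (\<lambda>a. f a \<le> j) xs) = size (filter_mset (\<lambda>x. x \<le> j) (image_mset f (mset xs)))"
    for f :: "nat list \<Rightarrow> nat" and xs
    by (simp add: filter_mset_image_mset comp_def flip: mset_filter)
  have "card {c. (i, c) \<in> dg \<mu> \<and> G (i, c) \<le> j} = length (filter (\<lambda>a. padded (Suc m) a i \<le> j) (first_columns (part l 1) \<mu> G))"
    using row_count[OF dsplice_partition dsplice_part1 assms(1)] assms(2) by simp
  also have "\<dots> = length (filter (\<lambda>a. padded (Suc m) a i \<le> j) ?cs)"
    unfolding flt using splice_steps_invariants(3)[OF dsplice_steps _ ok, of i] by simp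
  also have "\<dots> = length (filter (\<lambda>a. padded (Suc m) (removeAll (Suc m) a) i \<le> j) (first_columns (part l 1) l F))"
    by (simp add: filter_map comp_def)
  also have "\<dots> = length (filter (\<lambda>a. padded (Suc (Suc m)) a i \<le> j) (first_columns (part l 1) l F))"
  proof (intro arg_cong[of _ _ length] filter_cong refl)
    fix a assume "a \<in> set (first_columns (part l 1) l F)"
    then have "col_ok (Suc (Suc m)) a" using cols_ok_cols[OF part F] by blast
    then show "padded (Suc m) (removeAll (Suc m) a) i \<le> j \<longleftrightarrow> padded (Suc (Suc m)) a i \<le> j"
      using assms(2) by (simp add: padded_remove min_le_iff_disj)
  qed
  also have "\<dots> = card {c. (i, c) \<in> dg l \<and> F (i, c) \<le> j}"
    using row_count[OF part order_refl assms(1), of j "Suc (Suc m)" F] assms(2) by simp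
  finally show ?thesis .
qed

lemma dsplice_row_length:
  assumes "1 \<le> i"
  shows "part \<mu> i = card {c. (i, c) \<in> dg l \<and> F (i, c) \<le> m}"
proof -
  have "{c. (i, c) \<in> dg \<mu> \<and> G (i, c) \<le> m} = {1..part \<mu> i}"
    using CSF_range[OF dsplice_CSF] assms by (auto simp: dg_iff)
  then show ?thesis using dsplice_row_count[OF assms order_refl] by simp
qed

text \<open>Row \<open>i\<close> of \<open>\<mu>\<close> has as many cells as row \<open>i\<close>
  of \<open>F\<close> has entries up to \<open>m\<close>. Every cell with a cell below it carries
  such an entry by strictness, and the word tells which bottom cells do. The letter counts are thus
  the sides of the box at \<open>(i, m)\<close>.\<close>

lemma dsplice_count:
  assumes i: "1 \<le> i"
  shows dsplice_count_False: "part \<mu> i = part l (Suc i) + count_list (word (Suc m) l F i) False"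
    and dsplice_count_True: "part l i = part \<mu> i + count_list (word (Suc m) l F i) True"
proof -
  have le: "part l (Suc i) \<le> part l i" using part_antimono[OF part i] by simp
  have low: "F (i, c) \<le> m" if "1 \<le> c" "c \<le> part l (Suc i)" for c
  proof -
    have "(i, c) \<in> dg l" "(Suc i, c) \<in> dg l" using that i le by (auto simp: dg_iff)
    then have "F (i, c) < F (Suc i, c)" "F (Suc i, c) \<le> Suc m"
      using CSF_strict[OF F] CSF_range[OF F] by auto
    then show ?thesis by simp
  qed
  have "{c. (i, c) \<in> dg l \<and> F (i, c) \<le> m} = {1..part l (Suc i)} \<union> {c \<in> set (block l i). (F (i, c) = Suc m) = False}"
    (is "?A = ?B \<union> ?C")
  proof (intro equalityI subsetI)
    fix c assume "c \<in> ?A"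
    then show "c \<in> ?B \<union> ?C" using i by (auto simp: dg_iff set_block)
  next
    fix c assume c: "c \<in> ?B \<union> ?C"
    then have d: "(i, c) \<in> dg l" using i le by (auto simp: dg_iff set_block)
    then show "c \<in> ?A" using c low CSF_range[OF F d] by auto
  qed
  moreover have "?B \<inter> ?C = {}" by (auto simp: set_block)
  ultimately show *: "part \<mu> i = part l (Suc i) + count_list (word (Suc m) l F i) False"
    unfolding dsplice_row_length[OF i] count_word by (simp add: card_Un_disjoint)
  show "part l i = part \<mu> i + count_list (word (Suc m) l F i) True"
    using * count_True_False[of "word (Suc m) l F i"] le by (simp add: length_word)
qed

lemma dsplice_interlaces: "\<mu> \<prec> l"
proof -
  have len: "length l = Suc m" "length \<mu> = m"
    using part dsplice_partition by (auto simp: is_partition_def)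
  have "l ! i \<ge> \<mu> ! i \<and> \<mu> ! i \<ge> l ! (i + 1)" if "i < m" for i
    using dsplice_count[of "Suc i"] that len by (simp add: part_def)
  then show ?thesis using len by (simp add: interlaces_def)
qed

lemma dsplice_stat:
  shows dsplice_inv: "inv_stat l F = inv_stat \<mu> G + int (\<Sum>i=1..m. sum_list (word_partition (word (Suc m) l F i)))"
    and dsplice_quinv: "quinv_stat l F = quinv_stat \<mu> G +
      int (\<Sum>i=1..m. pair_sum (\<lambda>x y. of_bool (\<not> x \<and> y)) (word (Suc m) l F i))"
proof -
  let ?C = "first_columns (part l 1) l F" and ?g = "first_columns (part l 1) \<mu> G"
  let ?cs = "map (removeAll (Suc m)) ?C"
  have ok: "cols_ok (Suc m) ?cs" by (rule cols_ok_remove[OF part F]) simp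
  note rm = pair_sum_remove[OF cols_ok_cols[OF part F] _ cols_sorted[OF part], of "part l 1"]
  have "len_inversions (map length ?g) = 0"
    using partition_shaped_cols[OF dsplice_partition] by (simp only: partition_shaped_iff)
  then have "pair_sum (col_stat 0 (Suc m)) ?cs = pair_sum (col_stat 0 (Suc m)) ?g + len_inversions (map length ?cs)"
    using splice_steps_invariants(1)[OF dsplice_steps _ ok] by simp
  moreover have "len_inversions (map length ?cs) = (\<Sum>i=1..m. sum_list (word_partition (word (Suc m) l F i)))"
    using rm(3) pair_sum_word(1)[OF part F] by (simp add: atLeastLessThanSuc_atLeastAtMost)
  ultimately show "inv_stat l F = inv_stat \<mu> G + int (\<Sum>i=1..m. sum_list (word_partition (word (Suc m) l F i)))"
    unfolding inv_stat_eq[OF part F order_refl] inv_stat_eq[OF dsplice_partition dsplice_CSF dsplice_part1]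
    using rm(1) by simp
  have "pair_sum (col_stat (Suc 0) (Suc m)) ?cs = pair_sum (col_stat (Suc 0) (Suc m)) ?g"
    using splice_steps_invariants(2)[OF dsplice_steps _ ok] by simp
  then show "quinv_stat l F = quinv_stat \<mu> G +
      int (\<Sum>i=1..m. pair_sum (\<lambda>x y. of_bool (\<not> x \<and> y)) (word (Suc m) l F i))"
    unfolding quinv_stat_eq[OF part F order_refl] quinv_stat_eq[OF dsplice_partition dsplice_CSF dsplice_part1]
    using rm(2) pair_sum_word(2)[OF part F] by (simp add: atLeastLessThanSuc_atLeastAtMost)
qed

lemma gt_bottom: 
  assumes "1 \<le> i" "i \<le> Suc m"
  shows "gt_of_tableau (Suc m) l F (i, Suc m) = int (part l i)"
proof -
  have "{c. (i, c) \<in> dg l \<and> F (i, c) \<le> Suc m} = {1..part l i}"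
    using CSF_range[OF F] assms by (auto simp: dg_iff)
  then show ?thesis using assms by (simp add: gt_of_tableau_def tri_def)
qed

lemma gt_next: 
  assumes "1 \<le> i" "i \<le> m"
  shows "gt_of_tableau (Suc m) l F (i, m) = int (part \<mu> i)"
  using assms by (simp add: gt_of_tableau_def tri_def dsplice_row_length)

lemma gt_restrict: "restrict (gt_of_tableau (Suc m) l F) (tri m) = gt_of_tableau m \<mu> G"
  by (rule ext) (auto simp: gt_of_tableau_def tri_def restrict_def dsplice_row_count)

lemma gt_NE_SE:
  assumes "1 \<le> i" "i \<le> m"
  shows gt_NE: "NE (gt_of_tableau (Suc m) l F) i m = int (count_list (word (Suc m) l F i) True)"
    and gt_SE: "SE (gt_of_tableau (Suc m) l F) i m = int (count_list (word (Suc m) l F i) False)"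
  using assms dsplice_count[OF assms(1)] by (simp_all add: NE_def SE_def gt_bottom gt_next)

lemma mu_eq: "map (\<lambda>i. nat (gt_of_tableau (Suc m) l F (i, m))) [1..<Suc m] = \<mu>"
proof (rule nth_equalityI)
  have len: "length \<mu> = m" using dsplice_partition by (simp add: is_partition_def)
  then show "length (map (\<lambda>i. nat (gt_of_tableau (Suc m) l F (i, m))) [1..<Suc m]) = length \<mu>" by simp
  fix i assume "i < length (map (\<lambda>i. nat (gt_of_tableau (Suc m) l F (i, m))) [1..<Suc m])"
  then have "i < m" by (simp del: upt_Suc)
  then show "map (\<lambda>i. nat (gt_of_tableau (Suc m) l F (i, m))) [1..<Suc m] ! i = \<mu> ! i"
    using len by (simp add: gt_next part_def del: upt_Suc)
qed

end

section \<open>The bijection and its decomposition along the last row\<close>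

primrec overlay_of :: "nat \<Rightarrow> nat list \<Rightarrow> filling \<Rightarrow> overlay" where
  "overlay_of 0 l F = (\<lambda>_. undefined)"
| "overlay_of (Suc m) l F = restrict (\<lambda>(i, j). if j = m then word_partition (word (Suc m) l F i)
     else case dsplice (Suc m) l F of (\<mu>, G) \<Rightarrow> overlay_of m \<mu> G (i, j)) (tri_less (Suc m))"

text \<open>Counting the entries up to \<open>j\<close> in a row ignores their order, so the pattern
  can be taken from \<open>F\<close> itself instead of its row sorted tableau.\<close>

definition psi :: "nat \<Rightarrow> nat list \<Rightarrow> filling \<Rightarrow> pattern \<times> overlay" where
  "psi n l F = (gt_of_tableau n l F, overlay_of n l F)"

lemma overlay_of_extensional: "overlay_of n l F \<in> extensional (tri_less n)"
  by (cases n) (auto simp: extensional_def)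

lemma gt_extensional: "gt_of_tableau n l F \<in> extensional (tri n)"
  by (simp add: gt_of_tableau_def)

lemma tri_less_Suc: "tri_less (Suc m) = tri_less m \<union> (\<lambda>i. (i, m)) ` {1..m}"
  by (auto simp: tri_less_def)

lemma tri_less_tri: "(i, j) \<in> tri_less m \<Longrightarrow> (i, j) \<in> tri m \<and> (i, Suc j) \<in> tri m \<and> (Suc i, Suc j) \<in> tri m"
  by (auto simp: tri_less_def tri_def)

lemma overlay_of_restrict:
  assumes "dsplice (Suc m) l F = (\<mu>, G)"
  shows "restrict (overlay_of (Suc m) l F) (tri_less m) = overlay_of m \<mu> G"
proof (rule ext)
  fix u
  show "restrict (overlay_of (Suc m) l F) (tri_less m) u = overlay_of m \<mu> G u"
    using assms overlay_of_extensional[of m \<mu> G]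
    by (cases u; cases "u \<in> tri_less m") (auto simp: tri_less_def extensional_def)
qed

lemma overlay_of_last: "1 \<le> i \<Longrightarrow> i \<le> m \<Longrightarrow> overlay_of (Suc m) l F (i, m) = word_partition (word (Suc m) l F i)"
  by (simp add: tri_less_def)

lemma br_psi:
  assumes "is_partition (Suc m) l" "F \<in> CSF (Suc m) l" "dsplice (Suc m) l F = (\<mu>, G)"
  shows "br (Suc m) (psi (Suc m) l F) = (\<mu>, psi m \<mu> G)"
  by (simp only: br_def psi_def prod.case diff_Suc_1 mu_eq[OF assms] gt_restrict[OF assms] overlay_of_restrict[OF assms(3)])

lemma NE_restrict: "(i, j) \<in> tri_less m \<Longrightarrow> NE (restrict T (tri m)) i j = NE T i j"
  and SE_restrict: "(i, j) \<in> tri_less m \<Longrightarrow> SE (restrict T (tri m)) i j = SE T i j"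
  using tri_less_tri[of i j m] by (simp_all add: NE_def SE_def)

text \<open>Splits off the last row and its boxes in step with \<open>br\<close>, so that
  well-definedness and surjectivity both reduce to a single level.\<close>

lemma POP_Suc_iff:
  fixes T :: pattern and L :: overlay and m :: nat
  defines "\<mu> \<equiv> map (\<lambda>i. nat (T (i, m))) [1..<Suc m]"
  assumes "T \<in> extensional (tri (Suc m))" "L \<in> extensional (tri_less (Suc m))"
    and "\<And>i. 1 \<le> i \<Longrightarrow> i \<le> Suc m \<Longrightarrow> T (i, Suc m) = int (part l i)" "length l = Suc m"
  shows "(T, L) \<in> POP (Suc m) l \<longleftrightarrow> (restrict T (tri m), restrict L (tri_less m)) \<in> POP m \<mu> \<and>
    (\<forall>i\<in>{1..m}. 0 \<le> NE T i m \<and> 0 \<le> SE T i m \<and> L (i, m) \<in> box_partitions (NE T i m) (SE T i m))"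
proof -
  \<comment> \<open>The conversion by \<open>nat\<close> in \<open>\<mu>\<close> loses nothing:
    interlacing bounds each entry of row \<open>m\<close> from below by a part of
    \<open>l\<close>.\<close>
  have SE0: "0 \<le> T (i, m)" if "0 \<le> SE T i m" "1 \<le> i" "i \<le> m" for i
    using that assms(4)[of "Suc i"] by (simp add: SE_def)
  have \<mu>: "\<mu> ! (i - 1) = nat (T (i, m))" if "1 \<le> i" "i \<le> m" for i
    using that by (cases i) (simp_all add: \<mu>_def del: upt_Suc)
  have bot: "(\<forall>i\<in>{1..Suc m}. T (i, Suc m) = int (l ! (i - 1)))"
    using assms(4,5) by (auto simp: part_def)
  have A: "T \<in> GT (Suc m) l \<longleftrightarrow> (\<forall>(i, j)\<in>tri_less m. 0 \<le> NE T i j \<and> 0 \<le> SE T i j) \<and>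
      (\<forall>i\<in>{1..m}. 0 \<le> NE T i m \<and> 0 \<le> SE T i m)"
    using assms(2) bot by (auto simp: GT_def tri_less_Suc)
  have B: "restrict T (tri m) \<in> GT m \<mu> \<longleftrightarrow> (\<forall>(i, j)\<in>tri_less m. 0 \<le> NE T i j \<and> 0 \<le> SE T i j)"
    if "\<forall>i\<in>{1..m}. 0 \<le> NE T i m \<and> 0 \<le> SE T i m"
  proof -
    have "\<forall>i\<in>{1..m}. restrict T (tri m) (i, m) = int (\<mu> ! (i - 1))"
      using that SE0 \<mu> by (auto simp: tri_def)
    then show ?thesis by (auto simp: GT_def NE_restrict SE_restrict)
  qed
  have C: "L \<in> (\<Pi>\<^sub>E (i, j)\<in>tri_less (Suc m). box_partitions (NE T i j) (SE T i j)) \<longleftrightarrow>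
      (\<forall>(i, j)\<in>tri_less m. L (i, j) \<in> box_partitions (NE T i j) (SE T i j)) \<and>
      (\<forall>i\<in>{1..m}. L (i, m) \<in> box_partitions (NE T i m) (SE T i m))"
    using assms(3) by (auto simp: PiE_iff tri_less_Suc)
  have D: "restrict L (tri_less m) \<in> (\<Pi>\<^sub>E (i, j)\<in>tri_less m. box_partitions (NE (restrict T (tri m)) i j) (SE (restrict T (tri m)) i j)) \<longleftrightarrow>
      (\<forall>(i, j)\<in>tri_less m. L (i, j) \<in> box_partitions (NE T i j) (SE T i j))"
    by (auto simp: PiE_iff NE_restrict SE_restrict)
  show ?thesis unfolding POP_def mem_Collect_eq prod.case C D A using B by blast
qed

lemma psi_POP:
  "is_partition n l \<Longrightarrow> F \<in> CSF n l \<Longrightarrow> psi n l F \<in> POP n l"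
proof (induction n arbitrary: l F)
  case 0
  then show ?case
    by (auto simp: POP_def psi_def GT_def gt_of_tableau_def tri_less_def)
next
  case (Suc m)
  obtain \<mu> G where ds: "dsplice (Suc m) l F = (\<mu>, G)" by (meson surj_pair)
  note a = Suc.prems ds
  have "psi m \<mu> G \<in> POP m \<mu>" by (rule Suc.IH[OF dsplice_partition[OF a] dsplice_CSF[OF a]])
  then have "(restrict (gt_of_tableau (Suc m) l F) (tri m), restrict (overlay_of (Suc m) l F) (tri_less m)) \<in>
      POP m (map (\<lambda>i. nat (gt_of_tableau (Suc m) l F (i, m))) [1..<Suc m])"
    unfolding mu_eq[OF a] gt_restrict[OF a] overlay_of_restrict[OF ds] psi_def .
  moreover have "length l = Suc m" using Suc.prems(1) by (simp add: is_partition_def)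
  ultimately show ?case
    unfolding psi_def
    by (subst POP_Suc_iff[OF gt_extensional overlay_of_extensional gt_bottom[OF a]])
      (simp_all add: gt_NE_SE[OF a] overlay_of_last word_partition_box del: overlay_of.simps upt_Suc)
qed

section \<open>Bijectivity\<close>

lemma col_len_in_block:
  assumes "is_partition n l" "1 \<le> c" "c \<le> part l 1"
  shows "1 \<le> col_len l c \<and> col_len l c \<le> n \<and> c \<in> set (block l (col_len l c))"
proof -
  have "1 \<le> col_len l c" using dg_col_len_iff[OF assms(1,2), of 1] assms by (simp add: dg_iff)
  moreover have "(col_len l c, c) \<in> dg l" "(Suc (col_len l c), c) \<notin> dg l"
    using calculation by (simp_all add: dg_col_len_iff[OF assms(1,2)])
  ultimately show ?thesis using assms col_len_le[OF assms(1,2)] by (auto simp: set_block dg_iff)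
qed

text \<open>Compatibility with \<open>br\<close> and the induction hypothesis recover
  \<open>\<mu>\<close> and \<open>G\<close>, and the last overlay components recover the words. The
  words tell which columns lose their largest entry, hence all lengths after the deletion, and then
  splicing can be cancelled.\<close>

lemma psi_inj:
  "is_partition n l \<Longrightarrow> F \<in> CSF n l \<Longrightarrow> F' \<in> CSF n l \<Longrightarrow> psi n l F = psi n l F' \<Longrightarrow> F = F'"
proof (induction n arbitrary: l F F')
  case 0
  have "dg l = {}" using dg_bound[OF 0(1)] by fastforce
  then show ?case using 0(2,3) by (auto simp: CSF_def)
next
  case (Suc m)
  obtain \<mu> G where ds: "dsplice (Suc m) l F = (\<mu>, G)" by (meson surj_pair)
  obtain \<mu>' G' where ds': "dsplice (Suc m) l F' = (\<mu>', G')" by (meson surj_pair)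
  note part = Suc.prems(1)
  note a = Suc.prems(1,2) ds and a' = Suc.prems(1,3) ds'
  have eq: "\<mu> = \<mu>'" "psi m \<mu> G = psi m \<mu>' G'"
    using br_psi[OF a] br_psi[OF a'] Suc.prems(4) by auto
  have G: "G = G'"
    using Suc.IH[OF dsplice_partition[OF a] dsplice_CSF[OF a]] dsplice_CSF[OF a'] eq by simp
  have w: "word (Suc m) l F i = word (Suc m) l F' i" if "1 \<le> i" "i \<le> Suc m" for i
  proof (rule word_partition_inj)
    show c: "count_list (word (Suc m) l F i) True = count_list (word (Suc m) l F' i) True"
      using dsplice_count_True[OF a that(1)] dsplice_count_True[OF a' that(1)] eq by simp
    show c0: "count_list (word (Suc m) l F i) False = count_list (word (Suc m) l F' i) False"
      using dsplice_count_False[OF a that(1)] dsplice_count_False[OF a' that(1)] eq by simp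
    \<comment> \<open>For \<open>i = Suc m\<close> there is no overlay component, but both words
      lack \<open>False\<close> and give the empty partition.\<close>
    show "word_partition (word (Suc m) l F i) = word_partition (word (Suc m) l F' i)"
    proof (cases "i = Suc m")
      case True
      then show ?thesis
        using word_n[OF part Suc.prems(2)] word_n[OF part Suc.prems(3)] by (simp add: word_partition_no_False)
    next
      case False
      then show ?thesis
        using overlay_of_last[of i m l F] overlay_of_last[of i m l F'] Suc.prems(4) that by (simp add: psi_def del: overlay_of.simps)
    qed
  qed
  let ?C = "first_columns (part l 1) l F" and ?C' = "first_columns (part l 1) l F'"
  have len: "length (removeAll (Suc m) (column l F c)) = length (removeAll (Suc m) (column l F' c))"
    if c: "1 \<le> c" "c \<le> part l 1" for c
  proof -
    note b = col_len_in_block[OF part c]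
    have "F (col_len l c, c) = Suc m \<longleftrightarrow> F' (col_len l c, c) = Suc m"
      using w[of "col_len l c"] b by (auto simp: word_def)
    then have "Suc m \<in> set (column l F c) \<longleftrightarrow> Suc m \<in> set (column l F' c)"
      using b n_in_column[OF part Suc.prems(2), of "col_len l c" c] n_in_column[OF part Suc.prems(3), of "col_len l c" c]
      by blast
    then show ?thesis
      using length_remove[OF col_ok_column[OF part Suc.prems(2) c(1)]]
        length_remove[OF col_ok_column[OF part Suc.prems(3) c(1)]]
      by (cases "Suc m \<in> set (column l F c)") simp_all
  qed
  have cs: "map (removeAll (Suc m)) ?C = map (removeAll (Suc m)) ?C'"
  proof (rule splice_cancel[of "Suc m" "first_columns (part l 1) \<mu> G"])
    show "map length (map (removeAll (Suc m)) ?C) = map length (map (removeAll (Suc m)) ?C')"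
      using len by (simp add: first_columns_def del: upt_Suc)
    show "splice_step\<^sup>*\<^sup>* (map (removeAll (Suc m)) ?C) (first_columns (part l 1) \<mu> G)"
      by (rule dsplice_steps[OF a])
    show "splice_step\<^sup>*\<^sup>* (map (removeAll (Suc m)) ?C') (first_columns (part l 1) \<mu> G)"
      unfolding eq(1) G by (rule dsplice_steps[OF a'])
    show "partition_shaped (first_columns (part l 1) \<mu> G)"
      by (rule partition_shaped_cols[OF dsplice_partition[OF a]])
    show "cols_ok (Suc m) (map (removeAll (Suc m)) ?C)"
      by (rule cols_ok_remove[OF part Suc.prems(2)]) simp
    show "cols_ok (Suc m) (map (removeAll (Suc m)) ?C')"
      by (rule cols_ok_remove[OF part Suc.prems(3)]) simp
  qed simp
  show ?case
  proof (rule extensionalityI)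
    show "F \<in> extensional (dg l)" "F' \<in> extensional (dg l)"
      using Suc.prems(2,3) by (auto simp: CSF_def PiE_iff)
    fix u assume u: "u \<in> dg l"
    obtain r c where rc: "u = (r, c)" by fastforce
    then have c: "1 \<le> r" "1 \<le> c" "c \<le> part l 1" using dg_bound[OF part] u by auto
    have "removeAll (Suc m) (column l F c) = removeAll (Suc m) (column l F' c)"
      using cs c by (auto simp: first_columns_def simp del: upt_Suc)
    \<comment> \<open>No entry exceeds \<open>Suc m\<close>, so inside the diagram the truncation
      changes nothing and the shortened columns already determine the filling.\<close>
    then have "min (Suc m) (F u) = min (Suc m) (F' u)"
      using padded_remove[OF col_ok_column[OF part Suc.prems(2) c(2)], of r]
        padded_remove[OF col_ok_column[OF part Suc.prems(3) c(2)], of r] u c rc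
      by (simp add: padded_column[OF part])
    then show "F u = F' u"
      using CSF_range[OF Suc.prems(2) u] CSF_range[OF Suc.prems(3) u] by simp
  qed
qed

text \<open>The multiplicity of \<open>v\<close> is the difference of the threshold counts at
  \<open>v\<close> and \<open>Suc v\<close>. For column lengths these counts are row
  lengths.\<close>

lemma mset_eq_threshold:
  assumes "length xs = length ys"
    and "\<And>r :: nat. 1 \<le> r \<Longrightarrow> length (filter (\<lambda>x. r \<le> x) xs) = length (filter (\<lambda>x. r \<le> x) ys)"
  shows "mset xs = mset ys"
proof (rule multiset_eqI)
  fix v
  have t: "length (filter (\<lambda>x. r \<le> x) xs) = length (filter (\<lambda>x. r \<le> x) ys)" for r
    using assms by (cases "r = 0") auto
  have "length (filter (\<lambda>x. v \<le> x) zs) = count (mset zs) v + length (filter (\<lambda>x. Suc v \<le> x) zs)" for zs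
    by (induction zs) auto
  from this[of xs] this[of ys] show "count (mset xs) v = count (mset ys) v"
    using t[of v] t[of "Suc v"] by simp
qed

text \<open>The words prescribe which columns end in the largest entry and thereby all lengths after
  its deletion. The condition on the parts of \<open>\<mu>\<close> makes these lengths a
  rearrangement of the column lengths of \<open>G\<close>, so the splices can be run backwards from
  \<open>G\<close>.\<close>

lemma exists_filling:
  assumes part: "is_partition (Suc m) l" and \<mu>: "is_partition m \<mu>" "part \<mu> 1 \<le> part l 1" and G: "G \<in> CSF m \<mu>"
    and w: "\<And>i. 1 \<le> i \<Longrightarrow> i \<le> Suc m \<Longrightarrow> length (w i) = part l i - part l (Suc i)"
      "\<And>i. 1 \<le> i \<Longrightarrow> i \<le> Suc m \<Longrightarrow> part \<mu> i = part l (Suc i) + count_list (w i) False"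
  shows "\<exists>F \<in> CSF (Suc m) l. dsplice (Suc m) l F = (\<mu>, G) \<and> (\<forall>i\<in>{1..Suc m}. word (Suc m) l F i = w i)"
proof -
  let ?M = "part l 1"
  let ?g = "first_columns ?M \<mu> G"
  \<comment> \<open>\<open>full c\<close> is the letter of column \<open>c\<close>, found at its
    offset within the block of its length; \<open>d c\<close> is the length left after the
    deletion.\<close>
  define full where "full c = (w (col_len l c) ! (c - Suc (part l (Suc (col_len l c)))))" for c
  define d where "d c = col_len l c - of_bool (full c)" for c
  define ds where "ds = map d [1..<Suc ?M]"
  have w_block: "w i = map full (block l i)" if "1 \<le> i" "i \<le> Suc m" for i
  proof (rule nth_equalityI)
    show "length (w i) = length (map full (block l i))"
      using w(1)[OF that] by (simp add: block_def del: upt_Suc)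
    fix k assume "k < length (w i)"
    then have k: "k < part l i - part l (Suc i)" using w(1)[OF that] by simp
    then have c: "block l i ! k = Suc (part l (Suc i)) + k" "block l i ! k \<in> set (block l i)"
      by (simp_all add: block_def del: upt_Suc)
    show "w i ! k = map full (block l i) ! k"
      using k col_len_block[OF part that(1) c(2)] c(1) by (simp add: full_def block_def del: upt_Suc)
  qed
  have d_ge: "r \<le> d c \<longleftrightarrow> c \<le> part l (Suc r) \<or> (c \<in> set (block l r) \<and> \<not> full c)"
    if "1 \<le> r" "1 \<le> c" "c \<le> ?M" for r c
  proof -
    note b = col_len_in_block[OF part that(2,3)]
    have "c \<le> part l (Suc r) \<longleftrightarrow> Suc r \<le> col_len l c"
      using dg_col_len_iff[OF part that(2), of "Suc r"] that by (simp add: dg_iff)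
    moreover have "c \<in> set (block l r) \<longleftrightarrow> r = col_len l c"
      using b col_len_block[OF part that(1), of c] by blast
    ultimately show ?thesis using b by (auto simp: d_def)
  qed
  have part_eq: "part \<mu> r = part l (Suc r) + card {c \<in> set (block l r). \<not> full c}" if "1 \<le> r" for r
  proof (cases "r \<le> Suc m")
    case True
    have "count_list (map full xs) False = length (filter (\<lambda>c. \<not> full c) xs)" for xs
      by (induction xs) auto
    then have "count_list (w r) False = length (filter (\<lambda>c. \<not> full c) (block l r))"
      by (simp add: w_block[OF that True])
    also have "\<dots> = card (set (filter (\<lambda>c. \<not> full c) (block l r)))"
      by (rule distinct_card[symmetric]) (simp add: block_def)
    finally show ?thesis using w(2)[OF that True] by simp
  next
    case False
    then show ?thesis using part_beyond[OF part, of r] part_beyond[OF part, of "Suc r"] part_beyond[OF \<mu>(1), of r]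
      by (simp add: set_block)
  qed
  \<comment> \<open>At least \<open>r\<close> cells are left in the columns longer than
    \<open>r\<close> and in those of length \<open>r\<close> that are not \<open>full\<close>;
    together they number \<open>part \<mu> r\<close>.\<close>
  have "mset ds = mset (map length ?g)"
  proof (rule mset_eq_threshold)
    fix r :: nat assume r: "1 \<le> r"
    have cnt: "length (filter (\<lambda>x. r \<le> x) (map h [1..<Suc ?M])) = card {c. 1 \<le> c \<and> c \<le> ?M \<and> r \<le> h c}" for h :: "nat \<Rightarrow> nat"
    proof -
      have "length (filter (\<lambda>x. r \<le> x) (map h [1..<Suc ?M])) = card (set (filter (\<lambda>c. r \<le> h c) [1..<Suc ?M]))"
        by (subst distinct_card) (simp_all add: filter_map comp_def del: upt_Suc)
      also have "set (filter (\<lambda>c. r \<le> h c) [1..<Suc ?M]) = {c. 1 \<le> c \<and> c \<le> ?M \<and> r \<le> h c}" by auto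
      finally show ?thesis .
    qed
    have le: "part l (Suc r) \<le> ?M" "part l r \<le> ?M" using part_antimono[OF part, of 1] r by auto
    have "{c. 1 \<le> c \<and> c \<le> ?M \<and> r \<le> d c} = {1..part l (Suc r)} \<union> {c \<in> set (block l r). \<not> full c}"
      using d_ge[OF r] le by (auto simp: set_block)
    moreover have "{1..part l (Suc r)} \<inter> {c \<in> set (block l r). \<not> full c} = {}" by (auto simp: set_block)
    ultimately have "card {c. 1 \<le> c \<and> c \<le> ?M \<and> r \<le> d c} = part \<mu> r"
      using part_eq[OF r] by (simp add: card_Un_disjoint)
    also have "\<dots> = card {1..part \<mu> r}" by simp
    also have "{1..part \<mu> r} = {c. 1 \<le> c \<and> c \<le> ?M \<and> r \<le> col_len \<mu> c}"
    proof -
      have "part \<mu> r \<le> ?M" using part_antimono[OF \<mu>(1), of 1 r] r \<mu>(2) by simp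
      then show ?thesis using dg_col_len_iff[OF \<mu>(1), of _ r] r by (auto simp: dg_iff)
    qed
    finally show "length (filter (\<lambda>x. r \<le> x) ds) = length (filter (\<lambda>x. r \<le> x) (map length ?g))"
      unfolding ds_def first_columns_def map_map comp_def length_column cnt .
  qed (simp add: ds_def del: upt_Suc)
  then obtain cs where cs: "cols_ok (Suc m) cs" "map length cs = ds" "splice_step\<^sup>*\<^sup>* cs ?g"
    using splice_reverse[OF _ cols_ok_cols[OF \<mu>(1) G] partition_shaped_cols[OF \<mu>(1)]] by blast
  have lcs: "length cs = ?M" using cs(2) by (metis ds_def length_map length_upt diff_Suc_1)
  have len: "length (cs ! (c - 1)) = d c" "cs ! (c - 1) \<in> set cs" if "1 \<le> c" "c \<le> ?M" for c
  proof -
    have "map length cs ! (c - 1) = d c" using that unfolding cs(2) ds_def by (simp del: upt_Suc)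
    then show "length (cs ! (c - 1)) = d c" "cs ! (c - 1) \<in> set cs" using that lcs by auto
  qed
  \<comment> \<open>The padding \<open>Suc m\<close> doubles as the restored largest entry: a column
    of the diagram exceeds the shortened column by at most one cell, and this cell receives the
    padding.\<close>
  define F where "F = restrict (\<lambda>(r, c). padded (Suc m) (cs ! (c - 1)) r) (dg l)"
  have F_eq: "F (r, c) = padded (Suc m) (cs ! (c - 1)) r" if "(r, c) \<in> dg l" for r c
    using that by (simp add: F_def)
  have dle: "d c \<le> col_len l c" "col_len l c \<le> Suc (d c)" for c by (auto simp: d_def)
  have F: "F \<in> CSF (Suc m) l"
  proof -
    have "F \<in> extensional (dg l)" by (simp add: F_def)
    moreover have "1 \<le> F (r, c) \<and> F (r, c) \<le> Suc m" if "(r, c) \<in> dg l" for r c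
    proof -
      have c: "1 \<le> r" "1 \<le> c" "c \<le> ?M" using dg_bound[OF part that] by auto
      have "col_ok (Suc m) (cs ! (c - 1))" using cs(1) len[OF c(2,3)] by blast
      then show ?thesis
        using padded_pos[of "Suc m" "cs ! (c - 1)" r] padded_le[of "Suc m" "cs ! (c - 1)" r] c F_eq[OF that] by simp
    qed
    moreover have "F (r, c) < F (r', c)" if "(r, c) \<in> dg l" "(r', c) \<in> dg l" "r < r'" for r r' c
    proof -
      have c: "1 \<le> c" "c \<le> ?M" using dg_bound[OF part that(1)] by auto
      have "r' \<le> col_len l c" using that(2) dg_col_len_iff[OF part c(1)] by simp
      then have "r \<le> length (cs ! (c - 1))" using dle[of c] len[OF c] that(3) by simp
      then show ?thesis
        using padded_strict[of "Suc m" "cs ! (c - 1)" r r'] cs(1) len[OF c] F_eq that by simp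
    qed
    ultimately show ?thesis by (auto simp: CSF_def PiE_iff)
  qed
  have "map (removeAll (Suc m)) (first_columns ?M l F) = cs"
  proof (rule nth_equalityI)
    fix i assume "i < length (map (removeAll (Suc m)) (first_columns ?M l F))"
    then have i: "1 \<le> Suc i" "Suc i \<le> ?M" by simp_all
    have "removeAll (Suc m) (column l F (Suc i)) = cs ! (Suc i - 1)"
    proof (rule padded_inject_col)
      show "col_ok (Suc m) (removeAll (Suc m) (column l F (Suc i)))"
        by (rule col_ok_remove[OF col_ok_column[OF part F i(1)]]) simp
      show "col_ok (Suc m) (cs ! (Suc i - 1))" using cs(1) len[OF i] by blast
      fix r
      have "padded (Suc m) (removeAll (Suc m) (column l F (Suc i))) r = min (Suc m) (padded (Suc (Suc m)) (column l F (Suc i)) r)"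
        by (rule padded_remove[OF col_ok_column[OF part F i(1)]]) simp
      also have "\<dots> = padded (Suc m) (cs ! (Suc i - 1)) r"
      proof (cases "r = 0 \<or> (r, Suc i) \<in> dg l")
        case True
        then show ?thesis using CSF_range[OF F, of "(r, Suc i)"] F_eq[of r "Suc i"]
          by (auto simp: padded_column[OF part i(1)])
      next
        case False
        then have "col_len l (Suc i) < r" using dg_col_len_iff[OF part i(1), of r] by auto
        then have "length (cs ! (Suc i - 1)) < r" using dle[of "Suc i"] len[OF i] by simp
        then show ?thesis using False by (simp add: padded_column[OF part i(1)] padded_beyond)
      qed
      finally show "padded (Suc m) (removeAll (Suc m) (column l F (Suc i))) r = padded (Suc m) (cs ! (Suc i - 1)) r" .
    qed simp
    then show "map (removeAll (Suc m)) (first_columns ?M l F) ! i = cs ! i"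
      using i by (simp add: first_columns_def del: upt_Suc)
  qed (simp add: lcs)
  then have "dsplice (Suc m) l F = (\<mu>, G)"
    using dsplice_eqI[OF part F _ partition_shaped_cols[OF \<mu>(1)], of ?M G] cs(3)
      columns_roundtrip[OF \<mu>(1) G \<mu>(2)] by simp
  moreover have "word (Suc m) l F i = w i" if "i \<in> {1..Suc m}" for i
  proof -
    have i: "1 \<le> i" "i \<le> Suc m" using that by auto
    have "(F (i, c) = Suc m) = full c" if c: "c \<in> set (block l i)" for c
    proof -
      have c': "(i, c) \<in> dg l" "1 \<le> c" "c \<le> ?M" 
        using c i part_antimono[OF part, of 1 i] by (auto simp: set_block dg_iff)
      have "col_ok (Suc m) (cs ! (c - 1))" using cs(1) len[OF c'(2,3)] by blast
      then have "F (i, c) = Suc m \<longleftrightarrow> d c < i"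
        using padded_eq_iff[of "Suc m" "cs ! (c - 1)" i] F_eq[OF c'(1)] len[OF c'(2,3)] by simp
      then show ?thesis using col_len_block[OF part i(1) c] i(1) by (auto simp: d_def)
    qed
    then show ?thesis unfolding w_block[OF i] word_def by simp
  qed
  ultimately show ?thesis using F by blast
qed

lemma psi_surj:
  "is_partition n l \<Longrightarrow> X \<in> POP n l \<Longrightarrow> \<exists>F\<in>CSF n l. psi n l F = X"
proof (induction n arbitrary: l X)
  case 0
  have "dg l = {}" using dg_bound[OF 0(1)] by fastforce
  then have "(\<lambda>_. undefined) \<in> CSF 0 l" by (auto simp: CSF_def)
  moreover have "psi 0 l (\<lambda>_. undefined) = X"
  proof -
    have "tri 0 = {}" "tri_less 0 = {}" by (auto simp: tri_def tri_less_def)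
    then show ?thesis using 0(2) by (auto simp: POP_def GT_def psi_def gt_of_tableau_def restrict_def)
  qed
  ultimately show ?case by blast
next
  case (Suc m)
  obtain T L where X: "X = (T, L)" by fastforce
  have len: "length l = Suc m" using Suc.prems(1) by (simp add: is_partition_def)
  define \<mu> where "\<mu> = map (\<lambda>i. nat (T (i, m))) [1..<Suc m]"
  have TL: "T \<in> extensional (tri (Suc m))" "L \<in> extensional (tri_less (Suc m))"
    and bot: "T (i, Suc m) = int (part l i)" if "1 \<le> i" "i \<le> Suc m" for i
    using Suc.prems(2) that len by (auto simp: X POP_def GT_def PiE_iff part_def)
  have TL: "T \<in> extensional (tri (Suc m))" "L \<in> extensional (tri_less (Suc m))"
    using Suc.prems(2) by (auto simp: X POP_def GT_def PiE_iff)
  have pop: "(restrict T (tri m), restrict L (tri_less m)) \<in> POP m \<mu>"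
    and box: "\<And>i. i \<in> {1..m} \<Longrightarrow> 0 \<le> NE T i m \<and> 0 \<le> SE T i m \<and> L (i, m) \<in> box_partitions (NE T i m) (SE T i m)"
    using POP_Suc_iff[OF TL bot len] Suc.prems(2) unfolding X \<mu>_def by auto
  have Tm: "T (i, m) = int (part \<mu> i)" "part l (Suc i) \<le> part \<mu> i" "part \<mu> i \<le> part l i"
    "NE T i m = int (part l i - part \<mu> i)" "SE T i m = int (part \<mu> i - part l (Suc i))" if "1 \<le> i" "i \<le> m" for i
  proof -
    have b: "0 \<le> NE T i m" "0 \<le> SE T i m" using box that by auto
    then have "0 \<le> T (i, m)" using bot[of "Suc i"] that by (simp add: SE_def)
    then show T: "T (i, m) = int (part \<mu> i)" 
      using that by (cases i) (simp_all add: \<mu>_def part_def del: upt_Suc)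
    show "part l (Suc i) \<le> part \<mu> i" "part \<mu> i \<le> part l i"
      "NE T i m = int (part l i - part \<mu> i)" "SE T i m = int (part \<mu> i - part l (Suc i))"
      using b T bot[of "Suc i"] bot[of i] that by (auto simp: SE_def NE_def)
  qed
  have \<mu>: "is_partition m \<mu>"
  proof -
    have "\<mu> ! Suc i \<le> \<mu> ! i" if "Suc i < m" for i
      using Tm(2)[of "Suc i"] Tm(3)[of "Suc (Suc i)"] that by (simp add: part_def \<mu>_def del: upt_Suc)
    moreover have "length \<mu> = m" by (simp add: \<mu>_def del: upt_Suc)
    ultimately show ?thesis
      unfolding is_partition_def sorted_wrt_iff_nth_Suc_transp[OF transp_on_ge] by simp
  qed
  have \<mu>1: "part \<mu> 1 \<le> part l 1"
    using Tm(3)[of 1] part_beyond[OF \<mu>, of 1] by (cases "1 \<le> m") auto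
  obtain G where G: "G \<in> CSF m \<mu>" "psi m \<mu> G = (restrict T (tri m), restrict L (tri_less m))"
    using Suc.IH[OF \<mu> pop] by blast
  \<comment> \<open>The overlay supplies the words of the blocks \<open>i <= m\<close>. In block
    \<open>Suc m\<close> the parts of \<open>\<mu>\<close> and of the next row vanish, which leaves
    a constant word.\<close>
  have "\<exists>w. count_list w True = part l i - part \<mu> i \<and> count_list w False = part \<mu> i - part l (Suc i) \<and>
      (i \<le> m \<longrightarrow> word_partition w = L (i, m))" if "1 \<le> i" "i \<le> Suc m" for i
  proof (cases "i \<le> m")
    case True
    then show ?thesis using word_partition_surj[of "L (i, m)"] box[of i] Tm[OF that(1) True] that by auto
  next
    case False
    then have "part \<mu> i = 0" "part l (Suc i) = 0" using part_beyond[OF \<mu>, of i] part_beyond[OF Suc.prems(1), of "Suc i"] that by auto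
    moreover have "count_list (replicate k True) True = k \<and> count_list (replicate k True) False = 0" for k
      by (induction k) auto
    ultimately show ?thesis using False by (intro exI[of _ "replicate (part l i) True"]) simp
  qed
  then obtain w where w: "\<And>i. 1 \<le> i \<Longrightarrow> i \<le> Suc m \<Longrightarrow> count_list (w i) True = part l i - part \<mu> i \<and>
      count_list (w i) False = part \<mu> i - part l (Suc i) \<and> (i \<le> m \<longrightarrow> word_partition (w i) = L (i, m))"
    by metis
  have le: "part l (Suc i) \<le> part \<mu> i \<and> part \<mu> i \<le> part l i" if "1 \<le> i" "i \<le> Suc m" for i
    using Tm(2,3)[of i] that part_beyond[OF \<mu>, of i] part_beyond[OF Suc.prems(1), of "Suc i"] by (cases "i \<le> m") auto
  obtain F where F: "F \<in> CSF (Suc m) l" "dsplice (Suc m) l F = (\<mu>, G)"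
    "\<And>i. i \<in> {1..Suc m} \<Longrightarrow> word (Suc m) l F i = w i"
  proof -
    have "\<exists>F \<in> CSF (Suc m) l. dsplice (Suc m) l F = (\<mu>, G) \<and> (\<forall>i\<in>{1..Suc m}. word (Suc m) l F i = w i)"
    proof (rule exists_filling[OF Suc.prems(1) \<mu> \<mu>1 G(1)])
      fix i assume i: "1 \<le> i" "i \<le> Suc m"
      show "length (w i) = part l i - part l (Suc i)"
        using w[OF i] le[OF i] count_True_False[of "w i"] by simp
      show "part \<mu> i = part l (Suc i) + count_list (w i) False"
        using w[OF i] le[OF i] by simp
    qed
    then show ?thesis using that by blast
  qed
  note a = Suc.prems(1) F(1,2)
  have "gt_of_tableau (Suc m) l F = T"
  proof (rule extensionalityI[OF gt_extensional TL(1)])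
    fix u assume u: "u \<in> tri (Suc m)"
    then obtain i j where ij: "u = (i, j)" "1 \<le> i" "i \<le> j" "j \<le> Suc m" by (auto simp: tri_def)
    show "gt_of_tableau (Suc m) l F u = T u"
    proof (cases "j = Suc m")
      case True
      then show ?thesis using ij gt_bottom[OF a] bot by simp
    next
      case False
      then have "u \<in> tri m" using ij by (auto simp: tri_def)
      moreover have "restrict (gt_of_tableau (Suc m) l F) (tri m) u = restrict T (tri m) u"
        using gt_restrict[OF a] G(2) by (simp add: psi_def)
      ultimately show ?thesis by simp
    qed
  qed
  moreover have "overlay_of (Suc m) l F = L"
  proof (rule extensionalityI[OF overlay_of_extensional TL(2)])
    fix u assume u: "u \<in> tri_less (Suc m)"
    then consider i where "u = (i, m)" "1 \<le> i" "i \<le> m" | "u \<in> tri_less m" by (auto simp: tri_less_Suc)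
    then show "overlay_of (Suc m) l F u = L u"
    proof cases
      case 1
      then show ?thesis using overlay_of_last[of i m l F] F(3)[of i] w[of i] by (simp del: overlay_of.simps)
    next
      case 2
      moreover have "restrict (overlay_of (Suc m) l F) (tri_less m) u = restrict L (tri_less m) u"
        using overlay_of_restrict[OF F(2)] G(2) by (simp add: psi_def del: overlay_of.simps)
      ultimately show ?thesis by (simp del: overlay_of.simps)
    qed
  qed
  ultimately show ?case using F(1) unfolding X psi_def by blast
qed

lemma psi_bij: "is_partition n l \<Longrightarrow> bij_betw (psi n l) (CSF n l) (POP n l)"
  unfolding bij_betw_def
proof
  assume p: "is_partition n l"
  show "inj_on (psi n l) (CSF n l)" using psi_inj[OF p] by (rule inj_onI)
  show "psi n l ` CSF n l = POP n l" using psi_surj[OF p] psi_POP[OF p] by blast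
qed

section \<open>Statistics and row sorting\<close>

lemma overlay_size_Suc:
  "overlay_size (Suc m) L = overlay_size m (restrict L (tri_less m)) + (\<Sum>i=1..m. sum_list (L (i, m)))"
proof -
  have fin: "finite (tri_less m)"
    by (rule finite_subset[of _ "{1..m} \<times> {1..m}"]) (auto simp: tri_less_def)
  have "tri_less m \<inter> (\<lambda>i. (i, m)) ` {1..m} = {}" by (auto simp: tri_less_def)
  then have "overlay_size (Suc m) L = (\<Sum>u\<in>tri_less m. sum_list (L u)) + (\<Sum>u\<in>(\<lambda>i. (i, m)) ` {1..m}. sum_list (L u))"
    unfolding overlay_size_def tri_less_Suc using fin by (simp add: sum.union_disjoint)
  then show ?thesis by (simp add: overlay_size_def sum.reindex inj_on_def)
qed

lemma psi_inv_stat: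
  "is_partition n l \<Longrightarrow> F \<in> CSF n l \<Longrightarrow> inv_stat l F = int (overlay_size n (overlay_of n l F))"
proof (induction n arbitrary: l F)
  case 0
  then have "dg l = {}" using dg_bound[OF 0(1)] by fastforce
  moreover have "tri_less 0 = {}" by (auto simp: tri_less_def)
  ultimately show ?case by (simp add: inv_stat_def Inv_def Des_def overlay_size_def)
next
  case (Suc m)
  obtain \<mu> G where ds: "dsplice (Suc m) l F = (\<mu>, G)" by (meson surj_pair)
  note a = Suc.prems ds
  show ?case
    using dsplice_inv[OF a] Suc.IH[OF dsplice_partition[OF a] dsplice_CSF[OF a]]
    by (simp add: overlay_size_Suc overlay_of_restrict[OF ds] overlay_of_last del: overlay_of.simps)
qed

text \<open>The box at \<open>(i, j)\<close> involves only rows \<open>j\<close> and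
  \<open>j + 1\<close> of the pattern, so complementing commutes with dropping the last row.\<close>

lemma br_boxcomp:
  assumes "br (Suc m) X = (\<mu>, Y)"
  shows "br (Suc m) (boxcomp (Suc m) X) = (\<mu>, boxcomp m Y)"
proof -
  obtain T L where X: "X = (T, L)" by fastforce
  have "restrict (restrict (\<lambda>(i, j). partition_compl (nat (NE T i j)) (nat (SE T i j)) (L (i, j))) (tri_less (Suc m))) (tri_less m) =
      restrict (\<lambda>(i, j). partition_compl (nat (NE (restrict T (tri m)) i j)) (nat (SE (restrict T (tri m)) i j))
        (restrict L (tri_less m) (i, j))) (tri_less m)"
    by (rule ext) (auto simp: restrict_def NE_restrict[unfolded restrict_def] SE_restrict[unfolded restrict_def] tri_less_Suc)
  then show ?thesis using assms by (auto simp: br_def boxcomp_def X)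
qed

text \<open>On each level \<open>quinv\<close> gains the pairs with \<open>False\<close> before
  \<open>True\<close>. The opposite pairs form the size of the overlaid partition and both kinds
  together the area of its box, so the gain is the size of the complement.\<close>

lemma psi_quinv_stat:
  "is_partition n l \<Longrightarrow> F \<in> CSF n l \<Longrightarrow> quinv_stat l F = int (overlay_size n (snd (boxcomp n (psi n l F))))"
proof (induction n arbitrary: l F)
  case 0
  then have "dg l = {}" using dg_bound[OF 0(1)] by fastforce
  moreover have "tri_less 0 = {}" by (auto simp: tri_less_def)
  ultimately show ?case by (simp add: quinv_stat_def Quinv_def Des_def overlay_size_def)
next
  case (Suc m)
  obtain \<mu> G where ds: "dsplice (Suc m) l F = (\<mu>, G)" by (meson surj_pair)
  note a = Suc.prems ds
  let ?L = "snd (boxcomp (Suc m) (psi (Suc m) l F))"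
  have "restrict ?L (tri_less m) = snd (snd (br (Suc m) (boxcomp (Suc m) (psi (Suc m) l F))))"
    by (simp add: br_def case_prod_beta)
  also have "\<dots> = snd (boxcomp m (psi m \<mu> G))"
    by (simp add: br_boxcomp[OF br_psi[OF a]])
  finally have 1: "restrict ?L (tri_less m) = snd (boxcomp m (psi m \<mu> G))" .
  have 2: "sum_list (?L (i, m)) = pair_sum (\<lambda>x y. of_bool (\<not> x \<and> y)) (word (Suc m) l F i)" if "i \<in> {1..m}" for i
  proof -
    let ?w = "word (Suc m) l F i"
    have i: "1 \<le> i" "i \<le> m" using that by auto
    then have "(i, m) \<in> tri_less (Suc m)" by (simp add: tri_less_def)
    then have "?L (i, m) = partition_compl (count_list ?w True) (count_list ?w False) (word_partition ?w)"
      using gt_NE_SE[OF a i] overlay_of_last[OF i, of l F] by (simp add: boxcomp_def psi_def del: overlay_of.simps)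
    then show ?thesis
      using partition_compl_sum[OF word_partition_box[of ?w]] pair_sum_True_False[of ?w] word_partition_sum[of ?w] by simp
  qed
  show ?case
    using dsplice_quinv[OF a] Suc.IH[OF dsplice_partition[OF a] dsplice_CSF[OF a]] 1 2
    by (simp add: overlay_size_Suc)
qed

lemma boxcomp_POP:
  assumes "X \<in> POP n l"
  shows boxcomp_in_POP: "boxcomp n X \<in> POP n l"
    and boxcomp_boxcomp: "boxcomp n (boxcomp n X) = X"
proof -
  obtain T L where X: "X = (T, L)" by fastforce
  have T: "T \<in> GT n l" and L: "L \<in> (\<Pi>\<^sub>E (i, j)\<in>tri_less n. box_partitions (NE T i j) (SE T i j))"
    using assms by (auto simp: X POP_def)
  have box: "L (i, j) \<in> box_partitions (int (nat (NE T i j))) (int (nat (SE T i j)))" and pos: "0 \<le> NE T i j" "0 \<le> SE T i j"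
    if "(i, j) \<in> tri_less n" for i j
  proof -
    show pos: "0 \<le> NE T i j" "0 \<le> SE T i j" using T that by (auto simp: GT_def)
    then show "L (i, j) \<in> box_partitions (int (nat (NE T i j))) (int (nat (SE T i j)))"
      using L that by (auto simp: PiE_iff)
  qed
  show "boxcomp n X \<in> POP n l"
    using T partition_compl_box[OF box] pos by (auto simp: X boxcomp_def POP_def)
  have "restrict (\<lambda>(i, j). partition_compl (nat (NE T i j)) (nat (SE T i j))
      (restrict (\<lambda>(i, j). partition_compl (nat (NE T i j)) (nat (SE T i j)) (L (i, j))) (tri_less n) (i, j))) (tri_less n) = L"
  proof (rule extensionalityI[OF restrict_extensional])
    show "L \<in> extensional (tri_less n)" using L by (simp add: PiE_iff)
  qed (use partition_compl_invol[OF box] in auto)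
  then show "boxcomp n (boxcomp n X) = X" by (simp add: X boxcomp_def)
qed

lemma boxcomp_bij: "bij_betw (boxcomp n) (POP n l) (POP n l)"
  by (rule bij_betw_byWitness[where f' = "boxcomp n"]) (auto simp: boxcomp_boxcomp boxcomp_in_POP)

section \<open>Row sorting, semistandard tableaux and weights\<close>

lemma sorted_nth_le_iff:
  "sorted xs \<Longrightarrow> k < length xs \<Longrightarrow> xs ! k \<le> v \<longleftrightarrow> k < length (filter (\<lambda>x. x \<le> v) xs)" for v :: nat
proof (induction xs arbitrary: k)
  case (Cons x xs)
  show ?case
  proof (cases "x \<le> v")
    case True
    then show ?thesis using Cons by (cases k) auto
  next
    case False
    then have "filter (\<lambda>y. y \<le> v) (x # xs) = []"
      using Cons.prems(1) by (fastforce simp: filter_empty_conv)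
    moreover have "\<not> (x # xs) ! k \<le> v"
      using False Cons.prems nth_mem[of k "x # xs"] by fastforce
    ultimately show ?thesis by simp
  qed
qed simp

definition row :: "nat list \<Rightarrow> filling \<Rightarrow> nat \<Rightarrow> nat list" where
  "row l F r = map (\<lambda>c. F (r, c)) [1..<Suc (part l r)]"

lemma length_row [simp]: "length (row l F r) = part l r"
  by (simp add: row_def del: upt_Suc)

lemma set_row: "set (row l F r) = {F (r, c) |c. 1 \<le> c \<and> c \<le> part l r}"
  by (auto simp: row_def)

lemma row_nth: "1 \<le> c \<Longrightarrow> c \<le> part l r \<Longrightarrow> row l F r ! (c - 1) = F (r, c)"
  by (cases c) (simp_all add: row_def del: upt_Suc)

lemma rsort_eq: "(r, c) \<in> dg l \<Longrightarrow> rsort l F (r, c) = sort (row l F r) ! (c - 1)"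
  by (auto simp: rsort_def row_def part_def dg_def)

lemma row_rsort: "1 \<le> r \<Longrightarrow> row l (rsort l F) r = sort (row l F r)"
proof (rule nth_equalityI)
  fix i assume "1 \<le> r" "i < length (row l (rsort l F) r)"
  then have "(r, Suc i) \<in> dg l" "Suc i \<le> part l r" by (auto simp: dg_iff)
  then show "row l (rsort l F) r ! i = sort (row l F r) ! i"
    using rsort_eq[of r "Suc i" l F] row_nth[of "Suc i" l r "rsort l F"] by simp
qed simp

lemma row_card:
  assumes "1 \<le> i"
  shows "card {c. (i, c) \<in> dg l \<and> F (i, c) \<le> j} = length (filter (\<lambda>x. x \<le> j) (row l F i))"
proof -
  have "length (filter (\<lambda>x. x \<le> j) (row l F i)) = card (set (filter (\<lambda>c. F (i, c) \<le> j) [1..<Suc (part l i)]))"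
    by (subst distinct_card) (simp_all add: row_def filter_map comp_def del: upt_Suc)
  also have "set (filter (\<lambda>c. F (i, c) \<le> j) [1..<Suc (part l i)]) = {c. (i, c) \<in> dg l \<and> F (i, c) \<le> j}"
    using assms by (auto simp: dg_iff)
  finally show ?thesis by simp
qed

lemma length_filter_sort: "length (filter P (sort xs)) = length (filter P xs)"
  by (metis mset_filter mset_sort size_mset)

lemma gt_rsort: "gt_of_tableau n l (rsort l F) = gt_of_tableau n l F"
proof (rule ext)
  fix u
  show "gt_of_tableau n l (rsort l F) u = gt_of_tableau n l F u"
    by (cases u) (auto simp: gt_of_tableau_def tri_def restrict_def row_card row_rsort length_filter_sort)
qed

text \<open>If \<open>v\<close> is the \<open>c\<close>-th smallest entry of row \<open>r'\<close>,
  at least \<open>c\<close> cells there have entries up to \<open>v\<close>. The cells above them in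
  row \<open>r\<close> have smaller entries, so the \<open>c\<close>-th smallest entry of row
  \<open>r\<close> is at most \<open>v - 1\<close>.\<close>

lemma rsort_CSF:
  assumes "is_partition n l" "F \<in> CSF n l"
  shows "rsort l F \<in> CSF n l"
proof -
  have rng: "1 \<le> rsort l F (r, c) \<and> rsort l F (r, c) \<le> n" if d: "(r, c) \<in> dg l" for r c
  proof -
    have "c - 1 < length (sort (row l F r))" using d by (auto simp: dg_iff)
    then have "rsort l F (r, c) \<in> set (row l F r)"
      using nth_mem[of "c - 1" "sort (row l F r)"] by (simp add: rsort_eq[OF d])
    then obtain c' where "rsort l F (r, c) = F (r, c')" "(r, c') \<in> dg l"
      using d by (auto simp: set_row dg_iff)
    then show ?thesis using CSF_range[OF assms(2)] by simp
  qed
  have strict: "rsort l F (r, c) < rsort l F (r', c)" if d: "(r, c) \<in> dg l" "(r', c) \<in> dg l" "r < r'" for r r' c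
  proof -
    define v where "v = rsort l F (r', c)"
    have v: "1 \<le> v" using rng[OF d(2)] by (simp add: v_def)
    have b: "1 \<le> r" "1 \<le> r'" "c - 1 < part l r" "c - 1 < part l r'" using d by (auto simp: dg_iff)
    have "c - 1 < length (filter (\<lambda>x. x \<le> v) (sort (row l F r')))"
      using sorted_nth_le_iff[of "sort (row l F r')" "c - 1" v] rsort_eq[OF d(2), of F] b by (simp add: v_def)
    then have "c - 1 < card {c. (r', c) \<in> dg l \<and> F (r', c) \<le> v}"
      using row_card[OF b(2)] by (simp add: length_filter_sort)
    also have "\<dots> \<le> card {c. (r, c) \<in> dg l \<and> F (r, c) \<le> v - 1}"
    proof (rule card_mono)
      show "finite {c. (r, c) \<in> dg l \<and> F (r, c) \<le> v - 1}"
        by (rule finite_subset[of _ "{1..part l r}"]) (auto simp: dg_iff)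
      show "{c. (r', c) \<in> dg l \<and> F (r', c) \<le> v} \<subseteq> {c. (r, c) \<in> dg l \<and> F (r, c) \<le> v - 1}"
      proof clarify
        fix c assume c: "(r', c) \<in> dg l" "F (r', c) \<le> v"
        then have "(r, c) \<in> dg l"
          using part_antimono[OF assms(1) b(1), of r'] d(3) b(1) by (auto simp: dg_iff)
        then show "(r, c) \<in> dg l \<and> F (r, c) \<le> v - 1"
          using CSF_strict[OF assms(2) _ c(1) d(3)] c(2) by fastforce
      qed
    qed
    also have "\<dots> = length (filter (\<lambda>x. x \<le> v - 1) (sort (row l F r)))"
      using row_card[OF b(1)] by (simp add: length_filter_sort)
    finally have "rsort l F (r, c) \<le> v - 1"
      using sorted_nth_le_iff[of "sort (row l F r)" "c - 1" "v - 1"] rsort_eq[OF d(1), of F] b by simp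
    then show ?thesis using v by (simp add: v_def)
  qed
  have "rsort l F \<in> extensional (dg l)" by (simp add: rsort_def)
  then show ?thesis using rng strict by (auto simp: CSF_def PiE_iff)
qed

lemma rsort_SSYT:
  assumes "is_partition n l" "F \<in> CSF n l"
  shows "rsort l F \<in> SSYT n l"
proof -
  have "rsort l F (r, c) \<le> rsort l F (r, c')" if "(r, c) \<in> dg l" "(r, c') \<in> dg l" "c < c'" for r c c'
    using rsort_eq[OF that(1), of F] rsort_eq[OF that(2), of F] that
    by (auto simp: dg_iff intro!: sorted_nth_mono)
  then show ?thesis using rsort_CSF[OF assms] by (simp add: SSYT_def)
qed

text \<open>In a weakly increasing row the entries up to \<open>j\<close> form an initial segment,
  whose length decides about each cell. The bound \<open>i <= j\<close> keeps the index inside the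
  triangle on which patterns live.\<close>

lemma SSYT_le_iff:
  assumes "S \<in> SSYT n l" "(i, c) \<in> dg l" "i \<le> j" "j \<le> n"
  shows "S (i, c) \<le> j \<longleftrightarrow> int c \<le> gt_of_tableau n l S (i, j)"
proof -
  have i: "1 \<le> i" "1 \<le> c" using assms(2) by (auto simp: dg_iff)
  let ?A = "{c. (i, c) \<in> dg l \<and> S (i, c) \<le> j}"
  have "?A = {1..card ?A}"
  proof (rule down_closed_interval)
    show "finite ?A" by (rule finite_subset[of _ "{1..part l i}"]) (auto simp: dg_iff)
    fix r r' assume r: "r \<in> ?A" "1 \<le> r'" "r' \<le> r"
    then have "(i, r') \<in> dg l" by (auto simp: dg_iff)
    moreover have "S (i, r') \<le> S (i, r)"
      using assms(1) r calculation by (cases "r' = r") (auto simp: SSYT_def)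
    ultimately show "r' \<in> ?A" using r(1) by simp
  qed (simp add: dg_iff)
  then have "c \<in> ?A \<longleftrightarrow> c \<in> {1..card ?A}" by (rule arg_cong)
  then show ?thesis using assms i by (simp add: gt_of_tableau_def tri_def)
qed

text \<open>The pattern is consulted at \<open>j = S u\<close>, which lies in the triangle because
  column strictness makes an entry of row \<open>i\<close> at least \<open>i\<close>. This bounds
  \<open>S'\<close> by \<open>S\<close>, and symmetry gives equality. Injectivity gives the inverse
  \<open>tableau_of_gt\<close> its meaning.\<close>

lemma gt_inj_on_SSYT:
  assumes "is_partition n l"
  shows "inj_on (gt_of_tableau n l) (SSYT n l)"
proof (rule inj_onI)
  have le: "S' u \<le> S u" if S: "S \<in> SSYT n l" "S' \<in> SSYT n l" "gt_of_tableau n l S = gt_of_tableau n l S'" "u \<in> dg l" for S S' u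
  proof -
    obtain i c where u: "u = (i, c)" by fastforce
    have csf: "S \<in> CSF n l" using S(1) by (simp add: SSYT_def)
    have c: "1 \<le> c" using S(4) u by (simp add: dg_iff)
    have "i \<le> padded (Suc n) (column l S c) i"
      by (rule padded_ge[OF col_ok_column[OF assms csf c]]) (use S(4) u dg_col_len_iff[OF assms c] in auto)
    then have "i \<le> S u" using S(4) u by (simp add: padded_column[OF assms c] dg_iff split: if_splits)
    moreover have "S u \<le> n" using CSF_range[OF csf S(4)] by simp
    ultimately show ?thesis
      using SSYT_le_iff[OF S(1), of i c "S u"] SSYT_le_iff[OF S(2), of i c "S u"] S(3,4) u by simp
  qed
  fix S S' assume S: "S \<in> SSYT n l" "S' \<in> SSYT n l" "gt_of_tableau n l S = gt_of_tableau n l S'"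
  show "S = S'"
  proof (rule extensionalityI)
    show "S \<in> extensional (dg l)" "S' \<in> extensional (dg l)" using S by (auto simp: SSYT_def CSF_def PiE_iff)
    show "\<And>u. u \<in> dg l \<Longrightarrow> S u = S' u" using le[OF S] le[OF S(2,1) S(3)[symmetric]] by (meson antisym)
  qed
qed

text \<open>Row by row, the weight visibly depends only on the multiset of entries of each
  row.\<close>

lemma x_filling_rows: "x_filling l F = (\<Prod>r\<in>{1..length l}. prod_list (map var (row l F r)))"
proof -
  have "dg l = (SIGMA r:{1..length l}. {1..part l r})" by (auto simp: dg_def part_def)
  then have "x_filling l F = (\<Prod>r\<in>{1..length l}. \<Prod>c\<in>{1..part l r}. var (F (r, c)))"
    by (simp add: x_filling_def prod.Sigma)
  moreover have "(\<Prod>c\<in>{1..part l r}. var (F (r, c))) = prod_list (map var (row l F r))" for r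
    using prod.distinct_set_conv_list[of "[1..<Suc (part l r)]" "\<lambda>c. var (F (r, c))"]
    by (simp add: row_def comp_def atLeastLessThanSuc_atLeastAtMost del: upt_Suc)
  ultimately show ?thesis by simp
qed

lemma x_filling_rsort: "x_filling l (rsort l F) = x_filling l F"
proof -
  have "prod_list (map var (sort xs)) = prod_list (map var xs)" for xs
    by (metis mset_map mset_sort prod_mset_prod_list)
  then show ?thesis by (simp add: x_filling_rows row_rsort)
qed

text \<open>\<open>F\<close> and \<open>rsort l F\<close> share their pattern, so by injectivity its
  tableau is \<open>rsort l F\<close>, which has the weight of \<open>F\<close>.\<close>

lemma x_pattern_gt:
  assumes "is_partition n l" "F \<in> CSF n l"
  shows "x_pattern n l (gt_of_tableau n l F) = x_filling l F"
  unfolding x_pattern_def tableau_of_gt_def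
  using the_inv_into_f_f[OF gt_inj_on_SSYT[OF assms(1)] rsort_SSYT[OF assms]]
  by (simp add: gt_rsort x_filling_rsort)

theorem theorem2:
  "\<exists>\<psi>inv \<psi>quinv :: nat \<Rightarrow> nat list \<Rightarrow> filling \<Rightarrow> pattern \<times> overlay.
     (\<forall>(v, \<psi>) \<in> {(inv_stat, \<psi>inv), (quinv_stat, \<psi>quinv)}.
        bij_betw (\<psi> 0 []) (CSF 0 []) (POP 0 []) \<and>
        (\<forall>n \<ge> 1. \<forall>l. is_partition n l \<longrightarrow>
           bij_betw (\<psi> n l) (CSF n l) (POP n l) \<and>
           (\<forall>F \<in> CSF n l. \<forall>T L. \<psi> n l F = (T, L) \<longrightarrow>
              x_filling l F = x_pattern n l T \<and> v l F = int (overlay_size n L)) \<and>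
           (\<forall>F \<in> CSF n l. fst (\<psi> n l F) = gt_of_tableau n l (rsort l F)) \<and>
           (\<forall>F \<in> CSF n l. \<exists>\<mu> G. dsplice n l F = (\<mu>, G) \<and> \<mu> \<prec> l \<and> G \<in> CSF (n - 1) \<mu> \<and>
              br n (\<psi> n l F) = (\<mu>, \<psi> (n - 1) \<mu> G)))) \<and>
     (\<forall>n \<ge> 1. \<forall>l. is_partition n l \<longrightarrow>
        (\<forall>F \<in> CSF n l. \<psi>quinv n l F = boxcomp n (\<psi>inv n l F)))"
proof -
  \<comment> \<open>Property 3 holds by this choice, and bijectivity is inherited because the
    complement is an involution of \<open>POP n l\<close>.\<close>
  define psiq where "psiq n l F = boxcomp n (psi n l F)" for n l F
  have p0: "is_partition 0 []" by (simp add: is_partition_def)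
  have bij: "bij_betw (psi n l) (CSF n l) (POP n l)" "bij_betw (psiq n l) (CSF n l) (POP n l)"
    if "is_partition n l" for n l
  proof -
    show 1: "bij_betw (psi n l) (CSF n l) (POP n l)" by (rule psi_bij[OF that])
    have "psiq n l = boxcomp n \<circ> psi n l" by (simp add: psiq_def fun_eq_iff)
    then show "bij_betw (psiq n l) (CSF n l) (POP n l)"
      using bij_betw_trans[OF 1 boxcomp_bij] by simp
  qed
  have fst_psiq: "fst (psiq n l F) = gt_of_tableau n l F" for n l F
    by (simp add: psiq_def psi_def boxcomp_def)
  \<comment> \<open>Both families need the same list of properties. It is derived once for a
    bijective family \<open>f\<close> whose patterns are the row counts, whose overlay size is
    \<open>v\<close>, and which is compatible with \<open>br\<close>.\<close>
  have main: "bij_betw (f 0 []) (CSF 0 []) (POP 0 []) \<and>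
        (\<forall>n \<ge> 1. \<forall>l. is_partition n l \<longrightarrow>
           bij_betw (f n l) (CSF n l) (POP n l) \<and>
           (\<forall>F \<in> CSF n l. \<forall>T L. f n l F = (T, L) \<longrightarrow>
              x_filling l F = x_pattern n l T \<and> v l F = int (overlay_size n L)) \<and>
           (\<forall>F \<in> CSF n l. fst (f n l F) = gt_of_tableau n l (rsort l F)) \<and>
           (\<forall>F \<in> CSF n l. \<exists>\<mu> G. dsplice n l F = (\<mu>, G) \<and> \<mu> \<prec> l \<and> G \<in> CSF (n - 1) \<mu> \<and>
              br n (f n l F) = (\<mu>, f (n - 1) \<mu> G)))"
    if bij: "\<And>n l. is_partition n l \<Longrightarrow> bij_betw (f n l) (CSF n l) (POP n l)"
      and f: "\<And>n l F. fst (f n l F) = gt_of_tableau n l F"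
      and v: "\<And>n l F. is_partition n l \<Longrightarrow> F \<in> CSF n l \<Longrightarrow> v l F = int (overlay_size n (snd (f n l F)))"
      and b: "\<And>m l F \<mu> G. is_partition (Suc m) l \<Longrightarrow> F \<in> CSF (Suc m) l \<Longrightarrow>
        dsplice (Suc m) l F = (\<mu>, G) \<Longrightarrow> br (Suc m) (f (Suc m) l F) = (\<mu>, f m \<mu> G)"
    for f :: "nat \<Rightarrow> nat list \<Rightarrow> filling \<Rightarrow> pattern \<times> overlay" and v :: "nat list \<Rightarrow> filling \<Rightarrow> int"
  proof (intro conjI ballI allI impI)
    show "bij_betw (f 0 []) (CSF 0 []) (POP 0 [])" by (rule bij[OF p0])
  next
    fix n :: nat and l assume n: "1 \<le> n" and l: "is_partition n l"
    show "bij_betw (f n l) (CSF n l) (POP n l)" by (rule bij[OF l])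
    fix F assume F: "F \<in> CSF n l"
    show "fst (f n l F) = gt_of_tableau n l (rsort l F)" by (simp add: f gt_rsort)
    show "x_filling l F = x_pattern n l T" if "f n l F = (T, L)" for T L
      using f[of n l F] that x_pattern_gt[OF l F] by simp
    show "v l F = int (overlay_size n L)" if "f n l F = (T, L)" for T L
      using v[OF l F] that by simp
    obtain \<mu> G where ds: "dsplice n l F = (\<mu>, G)" by (meson surj_pair)
    obtain m where m: "n = Suc m" using n by (cases n) auto
    note a = l[unfolded m] F[unfolded m] ds[unfolded m]
    show "\<exists>\<mu> G. dsplice n l F = (\<mu>, G) \<and> \<mu> \<prec> l \<and> G \<in> CSF (n - 1) \<mu> \<and> br n (f n l F) = (\<mu>, f (n - 1) \<mu> G)"
      using ds dsplice_interlaces[OF a] dsplice_CSF[OF a] b[OF a] m by auto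
  qed
  have br_psiq: "br (Suc m) (psiq (Suc m) l F) = (\<mu>, psiq m \<mu> G)"
    if "is_partition (Suc m) l" "F \<in> CSF (Suc m) l" "dsplice (Suc m) l F = (\<mu>, G)" for m l F \<mu> G
    unfolding psiq_def by (rule br_boxcomp[OF br_psi[OF that]])
  have psiq_stat: "quinv_stat l F = int (overlay_size n (snd (psiq n l F)))"
    if "is_partition n l" "F \<in> CSF n l" for n l F
    unfolding psiq_def by (rule psi_quinv_stat[OF that])
  note inv = main[of psi inv_stat, OF bij(1) _ _ br_psi]
  note quinv = main[of psiq quinv_stat, OF bij(2) fst_psiq psiq_stat br_psiq]
  show ?thesis
  proof (rule exI[of _ psi], rule exI[of _ psiq], intro conjI allI impI ballI)
    fix p assume "p \<in> {(inv_stat, psi), (quinv_stat, psiq)}"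
    then consider "p = (inv_stat, psi)" | "p = (quinv_stat, psiq)" by blast
    then show "case p of (v, \<psi>) \<Rightarrow> bij_betw (\<psi> 0 []) (CSF 0 []) (POP 0 []) \<and>
        (\<forall>n \<ge> 1. \<forall>l. is_partition n l \<longrightarrow>
           bij_betw (\<psi> n l) (CSF n l) (POP n l) \<and>
           (\<forall>F \<in> CSF n l. \<forall>T L. \<psi> n l F = (T, L) \<longrightarrow>
              x_filling l F = x_pattern n l T \<and> v l F = int (overlay_size n L)) \<and>
           (\<forall>F \<in> CSF n l. fst (\<psi> n l F) = gt_of_tableau n l (rsort l F)) \<and>
           (\<forall>F \<in> CSF n l. \<exists>\<mu> G. dsplice n l F = (\<mu>, G) \<and> \<mu> \<prec> l \<and> G \<in> CSF (n - 1) \<mu> \<and>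
              br n (\<psi> n l F) = (\<mu>, \<psi> (n - 1) \<mu> G)))"
    proof cases
      case 1
      show ?thesis
        unfolding 1 prod.case by (intro inv) (simp_all add: psi_def psi_inv_stat)
    next
      case 2
      show ?thesis
        unfolding 2 prod.case by (rule quinv)
    qed
  qed (rule psiq_def)
qed

end
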